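(* Let $d\ge 2$, let $E$ be a complex Banach space, let $P\in\mathbb{C}\{\boldsymbol{x}\}\setminus\{0\}$ be a germ of analytic function at $\boldsymbol{0}\in\mathbb{C}^d$ with $P(\boldsymbol{0})=0$, and let $k>0$. If $\hat f\in E\{\boldsymbol{x}\}^{P}_{1/k}$ (i.e. $\hat f\in E[[\boldsymbol{x}]]$ is $P$-$k$-summable) has no singular directions, then $\hat f$ is convergent.
   Context: Notation: $\boldsymbol{x}=(x_1,\dots,x_d)$, $|\boldsymbol{x}|=\max_j|x_j|$, $D_r^d=\{\boldsymbol{x}\in\mathbb{C}^d: |\boldsymbol{x}|<r\}$. $E[[\boldsymbol{x}]]$ and $E\{\boldsymbol{x}\}$ are the spaces of formal and of convergent power series in $\boldsymbol{x}$ with coefficients in $E$. $\mathcal{O}_b(\Omega,E)$ is the space of bounded holomorphic $E$-valued maps on $\Omega$; $J(g)$ denotes the Taylor series at $\boldsymbol{0}$ of a map $g$ holomorphic near $\boldsymbol{0}$. $P$-sectors: for real $a<b$ and a polyradius $\boldsymbol{R}=(R_1,\dots,R_d)\in(0,\infty)^d$, $\Pi_P(a,b;\boldsymbol{R})$ is the set of $\boldsymbol{x}\in\mathbb{C}^d$ with $P(\boldsymbol{x})\neq0$, $a<\arg P(\boldsymbol{x})<b$ and $0<|x_j|<R_j$ for all $j$. Any convenient branch of $\arg$ may be used. The opening of the sector is $b-a$ and its bisecting direction is $(a+b)/2$. Only $P$-sectors of opening not greater than $2\pi$ are considered. A subsector is $\Pi_P(a',b';\boldsymbol{R}')$ with $a<a'<b'<b$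 and $0<R_j'<R_j$ for all $j$. $P$-$s$-Gevrey asymptotic expansion ($s>0$): a holomorphic $f:\Pi_P=\Pi_P(a,b;\boldsymbol{R})\to E$ has $\hat f\in E[[\boldsymbol{x}]]$ as $P$-$s$-Gevrey asymptotic expansion, written $f\sim^P_s\hat f$ on $\Pi_P$, if there are $r>0$, a sequence $(f_n)_{n\in\mathbb{N}}\subset\mathcal{O}_b(D_r^d,E)$ and $K,A>0$ with $J(f_n)\equiv\hat f \bmod P^nE[[\boldsymbol{x}]]$ and $\|f_n(\boldsymbol{x})\|\le KA^n n!^s$ on $D_r^d$ for all $n$, such that for every subsector $\Pi_P'$ of $\Pi_P$ there are $C,B>0$ with $\|f(\boldsymbol{x})-f_N(\boldsymbol{x})\|\le CB^N N!^s|P(\boldsymbol{x})|^N$ on $\Pi_P'\cap D_r^d$ for all $N\in\mathbb{N}$. Summability: $\hat f\in E[[\boldsymbol{x}]]$ is $P$-$k$-summable in direction $\theta\in\mathbb{R}$ if there are a $P$-sector $\Pi_P$ with bisecting direction $\theta$ and opening $>\pi/k$ and a holomorphic $f:\Pi_P\to E$ with $f\sim^P_{1/k}\hat f$ on $\Pi_P$. It is $P$-$k$-summable if it is $P$-$k$-summable in all directions up to a finite number of them mod $2\pi$; the exceptional directions are the singular directions. $E\{\boldsymbol{x}\}^P_{1/k}$ denotes the space of $P$-$k$-summable series. *)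

theory Defs
  imports "HOL-Analysis.Analysis"
begin

text \<open>Complex Banach spaces: real Banach spaces with a compatible complex scalar multiplication.\<close>

class complex_banach = banach +
  fixes scaleC :: "complex \<Rightarrow> 'a \<Rightarrow> 'a"  (infixr "*\<^sub>C" 75)
  assumes scaleC_add_right: "c *\<^sub>C (x + y) = c *\<^sub>C x + c *\<^sub>C y"
    and scaleC_add_left: "(b + c) *\<^sub>C x = b *\<^sub>C x + c *\<^sub>C x"
    and scaleC_scaleC: "b *\<^sub>C c *\<^sub>C x = (b * c) *\<^sub>C x"
    and scaleC_of_real: "complex_of_real r *\<^sub>C x = r *\<^sub>R x"
    and norm_scaleC: "norm (c *\<^sub>C x) = norm c * norm x"

instantiation complex :: complex_banach
begin

definition scaleC_complex :: "complex \<Rightarrow> complex \<Rightarrow> complex" where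
  "scaleC_complex c z = c * z"

instance
  by standard (simp_all add: scaleC_complex_def algebra_simps norm_mult scaleR_conv_of_real)

end


section \<open>Holomorphic maps on subsets of \<open>\<complex>\<^sup>d\<close>\<close>

text \<open>
  Complex differentiability at each point: the real Frechet derivative exists and is
  complex linear. The definition is only meant for open sets \<open>\<Omega>\<close>.
\<close>

definition holomorphic_map_on :: "(complex^'d \<Rightarrow> 'e::complex_banach) \<Rightarrow> (complex^'d) set \<Rightarrow> bool" where
  "holomorphic_map_on f \<Omega> \<longleftrightarrow>
     (\<forall>x\<in>\<Omega>. \<exists>D. (f has_derivative D) (at x within \<Omega>) \<and> (\<forall>c v. D (c *s v) = c *\<^sub>C D v))"

definition bounded_holomorphic :: "(complex^'d) set \<Rightarrow> (complex^'d \<Rightarrow> 'e::complex_banach) set" where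
  "bounded_holomorphic \<Omega> = {f. holomorphic_map_on f \<Omega> \<and> bounded (f ` \<Omega>)}"

definition polydisc :: "real^'d \<Rightarrow> (complex^'d) set" where
  "polydisc R = {x. \<forall>j. norm (x $ j) < R $ j}"


section \<open>Power series in several variables\<close>

text \<open>A formal power series is the family of its coefficients, indexed by multi-indices.\<close>

type_synonym ('d, 'e) mps = "('d \<Rightarrow> nat) \<Rightarrow> 'e"

definition monomial :: "complex^'d \<Rightarrow> ('d \<Rightarrow> nat) \<Rightarrow> complex" where
  "monomial x \<alpha> = (\<Prod>j\<in>UNIV. (x $ j) ^ \<alpha> j)"

definition mps_abs_conv_on :: "('d, 'e::complex_banach) mps \<Rightarrow> (complex^'d) set \<Rightarrow> bool" where
  "mps_abs_conv_on F \<Omega> \<longleftrightarrow> (\<forall>x\<in>\<Omega>. (\<lambda>\<alpha>. norm (monomial x \<alpha> *\<^sub>C F \<alpha>)) summable_on UNIV)"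

definition mps_convergent :: "('d::finite, 'e::complex_banach) mps \<Rightarrow> bool" where
  "mps_convergent F \<longleftrightarrow> (\<exists>r>0. mps_abs_conv_on F (polydisc (vec r)))"

definition mps_eval :: "('d, 'e::complex_banach) mps \<Rightarrow> complex^'d \<Rightarrow> 'e" where
  "mps_eval F x = (\<Sum>\<^sub>\<infinity>\<alpha>. monomial x \<alpha> *\<^sub>C F \<alpha>)"

definition mps_mult :: "('d, complex) mps \<Rightarrow> ('d, 'e::complex_banach) mps \<Rightarrow> ('d, 'e) mps" where
  "mps_mult p F = (\<lambda>\<alpha>. \<Sum>\<beta> | \<beta> \<le> \<alpha>. p \<beta> *\<^sub>C F (\<lambda>j. \<alpha> j - \<beta> j))"

primrec mps_power :: "('d, complex) mps \<Rightarrow> nat \<Rightarrow> ('d, complex) mps" where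
  "mps_power p 0 = (\<lambda>\<alpha>. if \<alpha> = (\<lambda>_. 0) then 1 else 0)"
| "mps_power p (Suc n) = mps_mult p (mps_power p n)"

text \<open>Congruence modulo \<open>P\<^sup>n E[[x]]\<close>.\<close>

definition mps_cong :: "('d, complex) mps \<Rightarrow> nat \<Rightarrow>
    ('d, 'e::complex_banach) mps \<Rightarrow> ('d, 'e) mps \<Rightarrow> bool" where
  "mps_cong p n F G \<longleftrightarrow> (\<exists>H. (\<lambda>\<alpha>. F \<alpha> - G \<alpha>) = mps_mult (mps_power p n) H)"

definition has_mps_expansion ::
    "(complex^'d \<Rightarrow> 'e::complex_banach) \<Rightarrow> ('d::finite, 'e) mps \<Rightarrow> bool" where
  "has_mps_expansion g F \<longleftrightarrow>
     (\<exists>\<rho>>0. \<forall>x\<in>polydisc (vec \<rho>). ((\<lambda>\<alpha>. monomial x \<alpha> *\<^sub>C F \<alpha>) has_sum g x) UNIV)"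

text \<open>The Taylor series at the origin, meaningful for maps holomorphic near the origin.\<close>

definition taylor_series ::
    "(complex^'d \<Rightarrow> 'e::complex_banach) \<Rightarrow> ('d::finite, 'e) mps" where
  "taylor_series g = (THE F. has_mps_expansion g F)"


section \<open>Sectors, asymptotic expansions and summability\<close>

text \<open>
  The germ \<open>P\<close> is given by its power series \<open>p\<close>. Any value of the argument of
  \<open>P(x)\<close> lying in \<open>(a, b)\<close> is admitted, so no branch has to be chosen.
\<close>

definition P_sector ::
    "('d, complex) mps \<Rightarrow> real \<Rightarrow> real \<Rightarrow> real^'d \<Rightarrow> (complex^'d) set" where
  "P_sector p a b R =
     {x. mps_eval p x \<noteq> 0 \<and> (\<exists>t. is_Arg (mps_eval p x) t \<and> a < t \<and> t < b) \<and>
         (\<forall>j. 0 < norm (x $ j) \<and> norm (x $ j) < R $ j)}"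

text \<open>
  Admissible data for a sector; the germ has to be defined on the whole polydisc of
  polyradius \<open>R\<close>.
\<close>

definition P_sector_data :: "('d, complex) mps \<Rightarrow> real \<Rightarrow> real \<Rightarrow> real^'d \<Rightarrow> bool" where
  "P_sector_data p a b R \<longleftrightarrow>
     a < b \<and> b - a \<le> 2 * pi \<and> (\<forall>j. 0 < R $ j) \<and> mps_abs_conv_on p (polydisc R)"

definition P_gevrey_asymptotic :: "('d::finite, complex) mps \<Rightarrow> real \<Rightarrow> real \<Rightarrow> real \<Rightarrow> real^'d \<Rightarrow>
    (complex^'d \<Rightarrow> 'e::complex_banach) \<Rightarrow> ('d, 'e) mps \<Rightarrow> bool" where
  "P_gevrey_asymptotic p s a b R f F \<longleftrightarrow>
     (\<exists>r>0. \<exists>fn :: nat \<Rightarrow> complex^'d \<Rightarrow> 'e. \<exists>K>0. \<exists>A>0.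
        (\<forall>n. fn n \<in> bounded_holomorphic (polydisc (vec r)) \<and>
             mps_cong p n (taylor_series (fn n)) F \<and>
             (\<forall>x\<in>polydisc (vec r). norm (fn n x) \<le> K * A ^ n * fact n powr s)) \<and>
        (\<forall>a' b' R'. a < a' \<and> a' < b' \<and> b' < b \<and> (\<forall>j. 0 < R' $ j \<and> R' $ j < R $ j) \<longrightarrow>
           (\<exists>C>0. \<exists>B>0. \<forall>N. \<forall>x \<in> P_sector p a' b' R' \<inter> polydisc (vec r).
              norm (f x - fn N x) \<le> C * B ^ N * fact N powr s * norm (mps_eval p x) ^ N)))"

definition P_summable_in_direction ::
    "('d::finite, complex) mps \<Rightarrow> real \<Rightarrow> ('d, 'e::complex_banach) mps \<Rightarrow> real \<Rightarrow> bool" where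
  "P_summable_in_direction p k F \<theta> \<longleftrightarrow>
     (\<exists>a b R f. P_sector_data p a b R \<and> (a + b) / 2 = \<theta> \<and> b - a > pi / k \<and>
        holomorphic_map_on f (P_sector p a b R) \<and>
        P_gevrey_asymptotic p (1 / k) a b R f F)"

definition singular_directions ::
    "('d::finite, complex) mps \<Rightarrow> real \<Rightarrow> ('d, 'e::complex_banach) mps \<Rightarrow> real set" where
  "singular_directions p k F = {\<theta>. \<not> P_summable_in_direction p k F \<theta>}"

definition P_summable ::
    "('d::finite, complex) mps \<Rightarrow> real \<Rightarrow> ('d, 'e::complex_banach) mps \<Rightarrow> bool" where
  "P_summable p k F \<longleftrightarrow>
     (\<exists>S. finite S \<and> (\<forall>\<theta> \<in> singular_directions p k F. \<exists>\<sigma>\<in>S. \<exists>m::int. \<theta> = \<sigma> + 2 * pi * m))"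

end

theory Submission
  imports Defs "HOL-Complex_Analysis.Complex_Analysis"
begin

text \<open>
  Let \<open>Q\<close> be the lowest-order homogeneous part of \<open>P\<close>, of degree \<open>l\<close>, and let \<open>v\<close> range over a small
  polydisc on which neither \<open>Q\<close> nor any coordinate vanishes. On the lines \<open>t \<mapsto> t v\<close> one has
  \<open>P (t v) = t\<^sup>l Q v (1 + o(1))\<close>, so \<open>P\<close>-sectors become ordinary sectors in \<open>t\<close>, and the
  series \<open>\<Sum>\<^sub>m F\<^sub>m(v) t\<^sup>m\<close> of homogeneous parts of \<open>F\<close> is \<open>k l\<close>-summable in every
  direction, with bounds that are uniform in \<open>v\<close>. By Watson's lemma the sums in neighbouring directions agree,
  hence they glue to a bounded holomorphic function on a punctured disc; removing the singularity and applying
  Cauchy's estimates gives \<open>norm (F\<^sub>m v) \<le> C M\<^sup>m\<close>. A polynomial of degree \<open>m\<close> bounded in this way on a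
  polydisc has geometrically bounded coefficients, so \<open>F\<close> converges.

  Everything is reduced to scalar functions by norming functionals. Working on lines avoids
  extending functions holomorphically across the hypersurface \<open>P = 0\<close>.
\<close>

text \<open>The opening is exactly right: the argument of \<open>t ^ l\<close> is \<open>l\<close>
  times that of \<open>t\<close>, so an opening above \<open>pi / k\<close> for \<open>P\<close>
  becomes one above \<open>pi / (k * l)\<close> in \<open>t\<close>, while Gevrey order
  \<open>1 / k\<close> in powers of \<open>P\<close> becomes order \<open>1 / (k * l)\<close> in
  powers of \<open>t\<close>. This is the threshold in Watson's lemma. The coefficients of
  \<open>F\<close> enter because a multiple of \<open>P ^ n\<close> has no terms of degree below
  \<open>l * n\<close>, so up to there \<open>F\<close> agrees with the Taylor series of the n-th
  approximating function.

  Summability provides separate constants and radii for each direction. Compactness of the circle of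
  directions makes them uniform, which requires that no direction be singular. Uniformity in
  \<open>v\<close> matters only for the radius in \<open>t\<close> and for the bound with
  \<open>N = 0\<close>; the other Gevrey constants may depend on \<open>v\<close>, since they only
  serve to identify sums and coefficients.

  The approximating functions are Banach-valued in several variables and their Taylor series are
  definite descriptions, so existence and uniqueness of the expansions have to be established before
  any coefficients can be compared.\<close>

no_notation fps_nth (infixl "$" 75)

section \<open>Norming functionals\<close>

definition sublinear :: "('a::real_vector \<Rightarrow> real) \<Rightarrow> bool" where
  "sublinear q \<longleftrightarrow> (\<forall>x y. q (x + y) \<le> q x + q y) \<and> (\<forall>c\<ge>0. \<forall>x. q (c *\<^sub>R x) = c * q x)"

lemma sublinear_zero: "sublinear q \<Longrightarrow> q 0 = 0"
  unfolding sublinear_def by (metis mult_zero_left order_refl scale_zero_left)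

lemma sublinear_norm: "sublinear norm"
  by (simp add: sublinear_def norm_triangle_ineq)

lemma sublinear_neg_ge: "sublinear q \<Longrightarrow> - q (- x) \<le> q x"
  using sublinear_zero[of q] unfolding sublinear_def by (metis add.right_inverse add.commute minus_le_iff diff_0 diff_le_eq)

text \<open>The lowering step of the Hahn-Banach argument: \<open>t = 0\<close> shows that the cut
  lies below \<open>q\<close>, and \<open>t = 1\<close> at the point \<open>- y\<close> brings its
  value there down to \<open>- q y\<close>.\<close>

definition sublinear_cut :: "('a::real_vector \<Rightarrow> real) \<Rightarrow> 'a \<Rightarrow> 'a \<Rightarrow> real" where
  "sublinear_cut q y x = (INF t\<in>{0..}. q (x + t *\<^sub>R y) - t * q y)"

text \<open>The lower bound does not depend on \<open>t\<close>, so the infimum in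
  \<open>sublinear_cut\<close> is a genuine one.\<close>

lemma sublinear_cut_bdd:
  assumes "sublinear q" "t \<ge> 0"
  shows "- q (- x) \<le> q (x + t *\<^sub>R y) - t * q y"
proof -
  have "q (t *\<^sub>R y) \<le> q (x + t *\<^sub>R y) + q (- x)"
    using assms(1) unfolding sublinear_def
    by (metis add.commute add_diff_cancel_left' diff_conv_add_uminus)
  moreover have "q (t *\<^sub>R y) = t * q y"
    using assms unfolding sublinear_def by blast
  ultimately show ?thesis by linarith
qed

lemma sublinear_cut_le:
  assumes "sublinear q" "t \<ge> 0"
  shows "sublinear_cut q y x \<le> q (x + t *\<^sub>R y) - t * q y"
  unfolding sublinear_cut_def
  by (rule cINF_lower) (use assms sublinear_cut_bdd in \<open>auto intro!: bdd_belowI2\<close>)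

lemma sublinear_cut_greatest:
  assumes "\<And>t. t \<ge> 0 \<Longrightarrow> m \<le> q (x + t *\<^sub>R y) - t * q y"
  shows "m \<le> sublinear_cut q y x"
  unfolding sublinear_cut_def
  by (rule cINF_greatest) (use assms in auto)

lemma sublinear_sublinear_cut:
  assumes q: "sublinear q"
  shows "sublinear (sublinear_cut q y)"
  unfolding sublinear_def
proof (intro conjI allI impI)
  fix x x'
  let ?c = "sublinear_cut q y"
  have *: "?c (x + x') \<le> (q (x + t *\<^sub>R y) - t * q y) + (q (x' + u *\<^sub>R y) - u * q y)"
    if "t \<ge> 0" "u \<ge> 0" for t u
  proof -
    have "?c (x + x') \<le> q (x + x' + (t + u) *\<^sub>R y) - (t + u) * q y"
      using sublinear_cut_le[OF q] that by simp
    also have "x + x' + (t + u) *\<^sub>R y = (x + t *\<^sub>R y) + (x' + u *\<^sub>R y)"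
      by (simp add: algebra_simps)
    also have "q \<dots> \<le> q (x + t *\<^sub>R y) + q (x' + u *\<^sub>R y)"
      using q unfolding sublinear_def by blast
    finally show ?thesis by (simp add: algebra_simps)
  qed
  have "?c (x + x') - (q (x' + u *\<^sub>R y) - u * q y) \<le> ?c x" if "u \<ge> 0" for u
    by (rule sublinear_cut_greatest) (use *[OF _ that] in \<open>simp add: algebra_simps\<close>)
  then have "?c (x + x') - ?c x \<le> ?c x'"
    by (intro sublinear_cut_greatest) (force simp: algebra_simps)
  then show "?c (x + x') \<le> ?c x + ?c x'" by simp
next
  fix c :: real and x assume c: "0 \<le> c"
  let ?c = "sublinear_cut q y"
  have le: "a * ?c z \<le> ?c (a *\<^sub>R z)" if "a > 0" for a z
  proof (rule sublinear_cut_greatest)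
    fix t :: real assume t: "t \<ge> 0"
    have "a * ?c z \<le> a * (q (z + (t / a) *\<^sub>R y) - t / a * q y)"
      using sublinear_cut_le[OF q, of "t / a"] t that by simp
    also have "\<dots> = a * q (z + (t / a) *\<^sub>R y) - t * q y"
      using that by (simp add: field_simps)
    also have "a * q (z + (t / a) *\<^sub>R y) = q (a *\<^sub>R (z + (t / a) *\<^sub>R y))"
      using q that unfolding sublinear_def by simp
    also have "a *\<^sub>R (z + (t / a) *\<^sub>R y) = a *\<^sub>R z + t *\<^sub>R y"
      using that by (simp add: scaleR_add_right)
    finally show "a * ?c z \<le> q (a *\<^sub>R z + t *\<^sub>R y) - t * q y" .
  qed
  show "?c (c *\<^sub>R x) = c * ?c x"
  proof (cases "c = 0")
    case True
    have "?c 0 \<le> 0" using sublinear_cut_le[OF q, of 0 y 0] sublinear_zero[OF q] by simp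
    moreover have "0 \<le> ?c 0"
      by (rule sublinear_cut_greatest) (use q in \<open>auto simp: sublinear_def\<close>)
    ultimately show ?thesis using True by simp
  next
    case False
    then have "c > 0" using c by simp
    have "inverse c * ?c (c *\<^sub>R x) \<le> ?c (inverse c *\<^sub>R (c *\<^sub>R x))"
      using le[of "inverse c" "c *\<^sub>R x"] \<open>c > 0\<close> by simp
    then have "?c (c *\<^sub>R x) \<le> c * ?c x" using \<open>c > 0\<close> by (simp add: field_simps)
    then show ?thesis using le[OF \<open>c > 0\<close>, of x] by simp
  qed
qed

text \<open>Zorn's lemma for the reversed order. A nonempty chain is bounded by its pointwise
  infimum, which is finite because every sublinear \<open>q \<le> p\<close> satisfies
  \<open>- p (- x) \<le> q x\<close>.\<close>

lemma sublinear_minimal_exists: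
  assumes p: "sublinear (p :: 'a::real_vector \<Rightarrow> real)"
  obtains q where "sublinear q" "q \<le> p" "\<And>q'. sublinear q' \<Longrightarrow> q' \<le> q \<Longrightarrow> q' = q"
proof -
  define A where "A = {q. sublinear q \<and> q \<le> p}"
  have "\<exists>m\<in>A. \<forall>a\<in>A. m \<ge> a \<longrightarrow> a = m"
  proof (rule predicate_Zorn)
    show "partial_order_on A (relation_of (\<ge>) A)"
      by (auto simp: partial_order_on_def preorder_on_def refl_on_def trans_def antisym_def relation_of_def)
  next
    fix C assume C: "C \<in> Chains (relation_of (\<ge>) A)"
    show "\<exists>u\<in>A. \<forall>a\<in>C. a \<ge> u"
    proof (cases "C = {}")
      case True
      then show ?thesis using p by (auto simp: A_def)
    next
      case False
      have CA: "sublinear q" "q \<le> p" if "q \<in> C" for q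
        using C that by (auto simp: Chains_def relation_of_def A_def)
      have tot: "q \<le> q' \<or> q' \<le> q" if "q \<in> C" "q' \<in> C" for q q'
        using C that by (auto simp: Chains_def relation_of_def)
      define u where "u x = (INF q\<in>C. q x)" for x
      have lb: "- p (- x) \<le> q x" if "q \<in> C" for q x
        using sublinear_neg_ge[OF CA(1)[OF that], of x] CA(2)[OF that] by (metis le_fun_def neg_le_iff_le order_trans)
      have ule: "u x \<le> q x" if "q \<in> C" for q x
        unfolding u_def by (rule cINF_lower) (use lb that in \<open>auto intro!: bdd_belowI2\<close>)
      have ugr: "m \<le> u x" if "\<And>q. q \<in> C \<Longrightarrow> m \<le> q x" for m x
        unfolding u_def by (rule cINF_greatest) (use False that in auto)
      have "sublinear u"
        unfolding sublinear_def
      proof (intro conjI allI impI)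
        fix x y
        \<comment> \<open>The two summands may come from different members of the chain; totality
          puts a single member below both.\<close>
        have *: "u (x + y) \<le> q x + q' y" if q: "q \<in> C" "q' \<in> C" for q q'
        proof -
          obtain s where s: "s \<in> C" "s \<le> q" "s \<le> q'" using tot[OF q] q by auto
          have "u (x + y) \<le> s (x + y)" by (rule ule[OF s(1)])
          also have "\<dots> \<le> s x + s y" using CA(1)[OF s(1)] by (simp add: sublinear_def)
          also have "\<dots> \<le> q x + q' y" using s by (simp add: le_fun_def add_mono)
          finally show ?thesis .
        qed
        have "u (x + y) - q' y \<le> u x" if "q' \<in> C" for q'
          by (rule ugr) (use *[OF _ that] in \<open>simp add: algebra_simps\<close>)
        then have "u (x + y) - u x \<le> u y"
          by (intro ugr) (force simp: algebra_simps)
        then show "u (x + y) \<le> u x + u y" by simp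
      next
        fix c :: real and x assume c: "0 \<le> c"
        have hom: "q (c *\<^sub>R x) = c * q x" if "q \<in> C" for q
          using CA(1)[OF that] c by (simp add: sublinear_def)
        show "u (c *\<^sub>R x) = c * u x"
        proof (cases "c = 0")
          case True
          moreover have "q 0 = 0" if "q \<in> C" for q
            by (rule sublinear_zero[OF CA(1)[OF that]])
          ultimately have "(\<lambda>q. q 0) ` C = {0}" using \<open>C \<noteq> {}\<close> by force
          then show ?thesis using True by (simp add: u_def)
        next
          case False
          then have c: "c > 0" using c by simp
          have "c * u x \<le> u (c *\<^sub>R x)"
            by (rule ugr) (subst hom, simp, intro mult_left_mono ule, use c in auto)
          moreover have "u (c *\<^sub>R x) / c \<le> u x"
            by (rule ugr) (use c in \<open>simp add: pos_divide_le_eq ule hom[symmetric] mult.commute[of _ c]\<close>)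
          ultimately show ?thesis using c by (simp add: field_simps)
        qed
      qed
      moreover have "u \<le> p"
        using False ule CA(2) unfolding le_fun_def by (meson ex_in_conv order_trans)
      ultimately show ?thesis using ule by (auto simp: A_def le_fun_def)
    qed
  qed
  then obtain q where q: "q \<in> A" "\<And>a. a \<in> A \<Longrightarrow> a \<le> q \<Longrightarrow> a = q" by auto
  show ?thesis
    by (rule that[of q]) (use q in \<open>auto simp: A_def\<close>)
qed

text \<open>A minimal sublinear function \<open>q\<close> equals all its cuts, which makes it odd and hence linear.\<close>

lemma exists_linear_below_norm:
  fixes x0 :: "'a::real_normed_vector"
  obtains f :: "'a \<Rightarrow> real" where "linear f" "\<And>x. f x \<le> norm x" "f x0 = norm x0"
proof -
  \<comment> \<open>Starting from this cut instead of the norm gives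
    \<open>p (- x0) \<le> - norm x0\<close>; oddness of the minimal function then forces the value
    \<open>norm x0\<close> at \<open>x0\<close>.\<close>
  define p where "p = sublinear_cut norm x0"
  have ple: "p x \<le> norm x" for x
    using sublinear_cut_le[OF sublinear_norm, of 0 x0 x] by (simp add: p_def)
  have p0: "p (- x0) \<le> - norm x0"
    using sublinear_cut_le[OF sublinear_norm, of 1 x0 "- x0"] by (simp add: p_def)
  have "sublinear p"
    unfolding p_def by (rule sublinear_sublinear_cut[OF sublinear_norm])
  from sublinear_minimal_exists[OF this] obtain q where q: "sublinear q" "q \<le> p"
    and min: "\<And>q'. sublinear q' \<Longrightarrow> q' \<le> q \<Longrightarrow> q' = q"
    by metis
  have odd: "q (- y) = - q y" for y
  proof -
    have "sublinear_cut q y = q"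
      by (rule min[OF sublinear_sublinear_cut[OF q(1)]])
         (use sublinear_cut_le[OF q(1), of 0] in \<open>simp add: le_fun_def\<close>)
    then have "q (- y) \<le> - q y"
      using sublinear_cut_le[OF q(1), of 1 y "- y"] sublinear_zero[OF q(1)] by simp
    then show ?thesis using sublinear_neg_ge[OF q(1), of y] by simp
  qed
  have sub: "q (x + y) \<le> q x + q y" for x y using q(1) by (simp add: sublinear_def)
  have add: "q (x + y) = q x + q y" for x y
    using sub[of x y] sub[of "- x" "- y"] odd[of "x + y"] odd[of x] odd[of y]
    by (simp add: algebra_simps)
  have scale: "q (c *\<^sub>R x) = c * q x" for c x
  proof (cases "c \<ge> 0")
    case False
    then have "q ((- c) *\<^sub>R x) = - c * q x"
      using q(1) unfolding sublinear_def by (metis linear neg_0_le_iff_le)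
    then show ?thesis using odd[of "c *\<^sub>R x"] by simp
  qed (use q(1) in \<open>simp add: sublinear_def\<close>)
  have le: "q x \<le> norm x" for x
    using q(2) ple[of x] by (meson le_fun_def order_trans)
  have "q x0 \<ge> norm x0"
    using odd[of x0] p0 q(2) by (smt (verit) le_fun_def)
  then show ?thesis
    using that[OF linearI[of q]] add scale le[of x0] le by auto
qed

definition dual_ball :: "('e::complex_banach \<Rightarrow> complex) set" where
  "dual_ball = {\<phi>. (\<forall>x y. \<phi> (x + y) = \<phi> x + \<phi> y) \<and> (\<forall>c x. \<phi> (c *\<^sub>C x) = c * \<phi> x) \<and>
     (\<forall>x. norm (\<phi> x) \<le> norm x)}"

lemma dual_ballD:
  assumes "\<phi> \<in> dual_ball"
  shows dual_ball_scaleC: "\<phi> (c *\<^sub>C x) = c * \<phi> x"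
    and dual_ball_norm: "norm (\<phi> x) \<le> norm x"
    and dual_ball_bounded_linear: "bounded_linear \<phi>"
proof -
  have add: "\<phi> (x + y) = \<phi> x + \<phi> y" for x y using assms by (simp add: dual_ball_def)
  show sc: "\<phi> (c *\<^sub>C x) = c * \<phi> x" for c x using assms by (simp add: dual_ball_def)
  show no: "norm (\<phi> x) \<le> norm x" for x using assms by (simp add: dual_ball_def)
  show "bounded_linear \<phi>"
    by (rule bounded_linear_intro[of _ 1])
       (use add no sc[of "complex_of_real _"] in \<open>simp_all add: scaleC_of_real scaleR_conv_of_real\<close>)
qed

lemma dual_ball_diff: "\<phi> \<in> dual_ball \<Longrightarrow> \<phi> (x - y) = \<phi> x - \<phi> y"
  using linear_diff[OF bounded_linear.linear[OF dual_ball_bounded_linear]] by blast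

lemma Hahn_Banach_norming:
  fixes x0 :: "'e::complex_banach"
  obtains \<phi> where "\<phi> \<in> dual_ball" "\<phi> x0 = norm x0"
proof -
  obtain f :: "'e \<Rightarrow> real" where f: "linear f" "\<And>x. f x \<le> norm x" "f x0 = norm x0"
    using exists_linear_below_norm[of x0] by blast
  \<comment> \<open>The only complex linear functional with real part \<open>f\<close>.\<close>
  define \<phi> where "\<phi> x = Complex (f x) (- f (\<i> *\<^sub>C x))" for x
  have fadd: "f (x + y) = f x + f y" and fsc: "f (r *\<^sub>R x) = r * f x" for x y r
    using f(1) by (simp_all add: linear_add linear_scale)
  have neg: "(- 1) *\<^sub>C x = - x" for x :: 'e
    using scaleC_of_real[of "- 1" x] by simp
  have dec: "c *\<^sub>C x = Re c *\<^sub>R x + Im c *\<^sub>R (\<i> *\<^sub>C x)" for c and x :: 'e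
  proof -
    have "c *\<^sub>C x = (complex_of_real (Re c) + complex_of_real (Im c) * \<i>) *\<^sub>C x"
      using complex_eq[of c] by (simp add: mult.commute)
    then show ?thesis by (simp only: scaleC_add_left scaleC_scaleC[symmetric] scaleC_of_real)
  qed
  have fi: "f (c *\<^sub>C x) = Re c * f x + Im c * f (\<i> *\<^sub>C x)" for c x
    by (subst dec) (simp add: fadd fsc)
  have add: "\<phi> (x + y) = \<phi> x + \<phi> y" for x y
    by (simp add: \<phi>_def fadd scaleC_add_right complex_eq_iff)
  have sc: "\<phi> (c *\<^sub>C x) = c * \<phi> x" for c x
    unfolding \<phi>_def scaleC_scaleC
    by (simp add: fi[of c x] fi[of "\<i> * c" x] complex_eq_iff algebra_simps)
  have no: "norm (\<phi> x) \<le> norm x" for x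
  proof (cases "\<phi> x = 0")
    case False
    \<comment> \<open>Rotating \<open>x\<close> by this unit makes the value of the functional real
      and nonnegative, where the real bound on \<open>f\<close> applies.\<close>
    define u where "u = cnj (sgn (\<phi> x))"
    have "norm u = 1" using False by (simp add: u_def norm_sgn)
    have "u * \<phi> x = complex_of_real (norm (\<phi> x))"
      using False complex_norm_square[of "\<phi> x"]
      by (simp add: u_def sgn_eq power2_eq_square mult.commute nonzero_divide_eq_eq)
    then have "norm (\<phi> x) = Re (\<phi> (u *\<^sub>C x))" by (simp add: sc)
    also have "\<dots> = f (u *\<^sub>C x)" by (simp add: \<phi>_def)
    also have "\<dots> \<le> norm x" using f(2)[of "u *\<^sub>C x"] \<open>norm u = 1\<close> by (simp add: norm_scaleC)
    finally show ?thesis .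
  qed simp
  have mem: "\<phi> \<in> dual_ball" using add sc no by (simp add: dual_ball_def)
  have re: "Re (\<phi> x0) = norm x0" by (simp add: \<phi>_def f(3))
  \<comment> \<open>The real part already exhausts the permitted modulus, which leaves no room for
    an imaginary part.\<close>
  have "(norm (\<phi> x0))\<^sup>2 \<le> (norm x0)\<^sup>2" by (simp add: no power_mono)
  then have "Im (\<phi> x0) = 0" by (simp add: cmod_power2 re)
  with re have "\<phi> x0 = norm x0" by (simp add: complex_eq_iff)
  with mem show ?thesis by (rule that)
qed

lemma norm_le_dual_ball:
  fixes x :: "'e::complex_banach"
  assumes "\<And>\<phi>. \<phi> \<in> dual_ball \<Longrightarrow> norm (\<phi> x) \<le> B"
  shows "norm x \<le> B"
  using Hahn_Banach_norming[of x] assms by (metis norm_of_real abs_norm_cancel)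

lemma eq_dual_ball:
  fixes x y :: "'e::complex_banach"
  assumes "\<And>\<phi>. \<phi> \<in> dual_ball \<Longrightarrow> \<phi> x = \<phi> y"
  shows "x = y"
  using norm_le_dual_ball[of "x - y" 0] assms by (simp add: dual_ball_diff)

section \<open>Summability in all directions in one variable\<close>

lemma higher_deriv_power_series_0:
  fixes c :: "nat \<Rightarrow> complex"
  assumes "\<tau> > 0" and "\<And>t. norm t < \<tau> \<Longrightarrow> (\<lambda>n. c n * t ^ n) sums g t"
  shows "(deriv ^^ m) g 0 = fact m * c m"
proof -
  have "eventually (\<lambda>t. t \<in> ball 0 \<tau>) (nhds (0::complex))"
    using assms(1) by (intro eventually_nhds_in_open) auto
  then have "g has_fps_expansion Abs_fps c"
    by (intro has_fps_expansionI, elim eventually_mono) (use assms(2) in auto)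
  from fps_nth_fps_expansion[OF this, of m] show ?thesis by simp
qed

lemma higher_deriv_le_punctured:
  assumes g: "g holomorphic_on ball 0 \<tau>" and \<rho>: "0 < \<rho>" "\<rho> < \<tau>"
    and le: "\<And>t. norm t = \<rho> \<Longrightarrow> norm (g t) \<le> S"
  shows "norm ((deriv ^^ m) g 0) \<le> fact m * S / \<rho> ^ m"
  by (rule Cauchy_inequality)
     (use \<rho> le in \<open>auto intro!: holomorphic_on_subset[OF g] holomorphic_on_imp_continuous_on\<close>)

text \<open>Circles of radius below \<open>\<tau>\<close> avoid the origin, so no bound there is
  needed; the radius \<open>\<tau>\<close> itself is reached in the limit.\<close>

lemma Cauchy_estimate_punctured:
  assumes g: "g holomorphic_on ball 0 \<tau>" and \<tau>: "\<tau> > 0"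
    and le: "\<And>t. norm t < \<tau> \<Longrightarrow> t \<noteq> 0 \<Longrightarrow> norm (g t) \<le> S"
  shows "norm ((deriv ^^ m) g 0 / fact m) * \<tau> ^ m \<le> S"
proof -
  let ?a = "norm ((deriv ^^ m) g 0 / fact m)"
  have *: "?a * \<rho> ^ m \<le> S" if "0 < \<rho>" "\<rho> < \<tau>" for \<rho>
    using higher_deriv_le_punctured[OF g that, of S m] le that
    by (force simp: norm_divide field_simps)
  have "((\<lambda>\<rho>. ?a * \<rho> ^ m) \<longlongrightarrow> ?a * \<tau> ^ m) (at_left \<tau>)"
    by (intro tendsto_intros)
  moreover have "eventually (\<lambda>\<rho>. ?a * \<rho> ^ m \<le> S) (at_left \<tau>)"
    using eventually_at_left_real[OF \<tau>] by eventually_elim (use * in auto)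
  ultimately show ?thesis
    by (rule tendsto_upperbound) simp
qed

text \<open>Cauchy's inequality on circles shrinking to the origin.\<close>

lemma higher_deriv_eq_0_of_order:
  assumes g: "g holomorphic_on ball 0 \<tau>" and \<tau>: "\<tau> > 0"
    and le: "\<And>t. norm t < \<tau> \<Longrightarrow> t \<noteq> 0 \<Longrightarrow> norm (g t) \<le> C * norm t ^ M" and m: "m < M"
  shows "(deriv ^^ m) g 0 = 0"
proof -
  have *: "norm ((deriv ^^ m) g 0) \<le> fact m * C * \<rho> ^ (M - m)" if "0 < \<rho>" "\<rho> < \<tau>" for \<rho>
  proof -
    have "norm ((deriv ^^ m) g 0) \<le> fact m * (C * \<rho> ^ M) / \<rho> ^ m"
      by (rule higher_deriv_le_punctured[OF g that]) (use le that in auto)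
    then show ?thesis using that m by (simp add: power_diff)
  qed
  have "((\<lambda>\<rho>. fact m * C * \<rho> ^ (M - m)) \<longlongrightarrow> fact m * C * 0 ^ (M - m)) (at_right 0)"
    by (intro tendsto_intros)
  moreover have "eventually (\<lambda>\<rho>. norm ((deriv ^^ m) g 0) \<le> fact m * C * \<rho> ^ (M - m)) (at_right 0)"
    using eventually_at_right_real[OF \<tau>] by eventually_elim (use * in auto)
  ultimately have "norm ((deriv ^^ m) g 0) \<le> fact m * C * 0 ^ (M - m)"
    by (rule tendsto_lowerbound) simp
  moreover have "(0::real) ^ (M - m) = 0" using m by simp
  ultimately show ?thesis by simp
qed

text \<open>Cauchy's estimates bound the tail by a geometric series of ratio
  \<open>norm t / \<tau> \<le> 1 / 2\<close>; its sum accounts for the factor 2.\<close>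

lemma taylor_remainder_bound:
  assumes g: "g holomorphic_on ball 0 \<tau>" and \<tau>: "\<tau> > 0"
    and le: "\<And>t. norm t < \<tau> \<Longrightarrow> norm (g t) \<le> S" and t: "norm t \<le> \<tau> / 2"
  shows "norm (g t - (\<Sum>m<M. (deriv ^^ m) g 0 / fact m * t ^ m)) \<le> 2 * S * (norm t / \<tau>) ^ M"
proof -
  define c where "c m = (deriv ^^ m) g 0 / fact m" for m
  define x where "x = norm t / \<tau>"
  have x: "0 \<le> x" "x \<le> 1 / 2" using t \<tau> by (simp_all add: x_def field_simps)
  have "S \<ge> 0" using le[of 0] \<tau> by (metis norm_ge_zero norm_zero order_trans)
  have c: "norm (c m * t ^ m) \<le> S * x ^ m" for m
  proof -
    have "norm (c m) * \<tau> ^ m \<le> S"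
      unfolding c_def by (rule Cauchy_estimate_punctured[OF g \<tau>]) (use le in auto)
    then have "norm (c m) * \<tau> ^ m * x ^ m \<le> S * x ^ m"
      using x by (intro mult_right_mono) auto
    then show ?thesis
      using \<tau> by (simp add: x_def norm_mult norm_power power_divide)
  qed
  have "(\<lambda>m. c m * (t - 0) ^ m) sums g t"
    unfolding c_def by (rule holomorphic_power_series[OF g]) (use t \<tau> in auto)
  then have "(\<lambda>m. c (m + M) * t ^ (m + M)) sums (g t - (\<Sum>m<M. c m * t ^ m))"
    using sums_split_initial_segment[of "\<lambda>m. c m * t ^ m" "g t" M] by simp
  then have "norm (g t - (\<Sum>m<M. c m * t ^ m)) = norm (\<Sum>m. c (m + M) * t ^ (m + M))"
    by (simp add: sums_iff)
  also have "\<dots> \<le> (\<Sum>m. S * x ^ M * (1 / 2) ^ m)"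
  proof (rule norm_suminf_le)
    fix m
    have "norm (c (m + M) * t ^ (m + M)) \<le> S * x ^ (m + M)" by (rule c)
    also have "\<dots> = S * x ^ M * x ^ m" by (simp add: power_add)
    also have "\<dots> \<le> S * x ^ M * (1 / 2) ^ m"
      using x \<open>S \<ge> 0\<close> by (intro mult_left_mono power_mono) auto
    finally show "norm (c (m + M) * t ^ (m + M)) \<le> S * x ^ M * (1 / 2) ^ m" .
  qed (intro summable_mult summable_geometric, simp)
  also have "\<dots> = 2 * S * x ^ M"
    by (subst suminf_mult) (auto simp: suminf_geometric intro!: summable_geometric)
  finally show ?thesis by (simp add: c_def x_def)
qed

text \<open>
  The multiplier \<open>exp (\<mu> exp (\<beta> z))\<close> with \<open>\<beta> < \<kappa>\<close> has modulus 1 on the horizontal sides of a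
  slightly smaller strip, grows more slowly than \<open>D\<close> decays, and blows up with \<open>\<mu>\<close>
  relative to its values on the left side.
\<close>

lemma Watson_strip:
  fixes D :: "complex \<Rightarrow> complex"
  assumes hol: "D holomorphic_on {z. x0 < Re z \<and> \<bar>Im z\<bar> < h}"
    and \<kappa>: "\<kappa> > 0" and h: "pi / (2 * \<kappa>) < h" and c: "c > 0"
    and le: "\<And>z. x0 < Re z \<Longrightarrow> \<bar>Im z\<bar> < h \<Longrightarrow> norm (D z) \<le> C * exp (- c * exp (\<kappa> * Re z))"
    and x: "x0 < x"
  shows "D (of_real x) = 0"
proof -
  obtain h' where h': "pi / (2 * \<kappa>) < h'" "h' < h" using dense[OF h] by blast
  have h'0: "h' > 0" using h'(1) \<kappa> by (meson divide_pos_pos less_trans mult_pos_pos pi_gt_zero zero_less_numeral)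
  \<comment> \<open>The cosine of \<open>\<beta> * Im z\<close> vanishes on the sides
    \<open>Im z = h'\<close> and \<open>Im z = - h'\<close>, and
    \<open>h' > pi / (2 * \<kappa>)\<close> is the same as
    \<open>\<beta> < \<kappa>\<close>.\<close>
  define \<beta> where "\<beta> = pi / (2 * h')"
  have \<beta>: "0 < \<beta>" "\<beta> < \<kappa>" "\<beta> * h' = pi / 2"
    using h'(1) h'0 \<kappa> by (simp_all add: \<beta>_def field_simps)
  have C: "C \<ge> 0"
  proof -
    have "0 \<le> norm (D (of_real x))" by simp
    also have "\<dots> \<le> C * exp (- c * exp (\<kappa> * x))" using le[of "of_real x"] x h' h'0 by simp
    finally show ?thesis by (simp add: zero_le_mult_iff)
  qed
  obtain x1 where x1: "x0 < x1" "x1 < x" using dense[OF x] by blast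
  have main: "norm (D (of_real x)) * exp (\<mu> * exp (\<beta> * x)) \<le> C * exp (\<mu> * exp (\<beta> * x1))"
    if \<mu>: "\<mu> > 0" for \<mu>
  proof -
    \<comment> \<open>The right side of the rectangle is moved so far out that the decay of
      \<open>D\<close> outweighs the multiplier there; its position may depend on
      \<open>\<mu>\<close>.\<close>
    have "filterlim (\<lambda>X. c * exp ((\<kappa> - \<beta>) * X)) at_top at_top"
      using \<beta> c by (intro filterlim_tendsto_pos_mult_at_top[OF tendsto_const] filterlim_compose[OF exp_at_top]
          filterlim_tendsto_pos_mult_at_top[OF tendsto_const _ filterlim_ident]) auto
    then have "eventually (\<lambda>X. \<mu> \<le> c * exp ((\<kappa> - \<beta>) * X)) at_top"
      by (simp add: filterlim_at_top)
    then have "eventually (\<lambda>X. \<mu> \<le> c * exp ((\<kappa> - \<beta>) * X) \<and> x < X) at_top"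
      using eventually_gt_at_top by (rule eventually_conj)
    from eventually_happens'[OF trivial_limit_at_top_linorder this]
    obtain X where X: "\<mu> \<le> c * exp ((\<kappa> - \<beta>) * X)" "x < X" by blast
    define S where "S = cbox (Complex x1 (- h')) (Complex X h')"
    define M where "M z = D z * exp (of_real \<mu> * exp (of_real \<beta> * z))" for z
    have S: "S \<subseteq> {z. x0 < Re z \<and> \<bar>Im z\<bar> < h}"
      using h' x1 by (auto simp: S_def in_cbox_complex_iff)
    have Mhol: "M holomorphic_on S"
      unfolding M_def by (intro holomorphic_intros holomorphic_on_subset[OF hol S])
    have nM: "norm (M z) = norm (D z) * exp (\<mu> * (exp (\<beta> * Re z) * cos (\<beta> * Im z)))" for z
      by (simp add: M_def norm_mult norm_exp_eq_Re Re_exp)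
    have "norm (M (of_real x)) \<le> C * exp (\<mu> * exp (\<beta> * x1))"
    proof (rule maximum_modulus_frontier[where S = S and f = M])
      show "M holomorphic_on interior S"
        by (rule holomorphic_on_subset[OF Mhol]) (rule interior_subset)
      show "continuous_on (closure S) M"
        using holomorphic_on_imp_continuous_on[OF Mhol] by (simp add: S_def)
      show "bounded S" by (simp add: S_def bounded_cbox)
      show "of_real x \<in> S" using x1 X h'0 by (simp add: S_def in_cbox_complex_iff)
    next
      fix z assume z: "z \<in> frontier S"
      then have zS: "x1 \<le> Re z" "Re z \<le> X" "\<bar>Im z\<bar> \<le> h'" "z \<notin> box (Complex x1 (- h')) (Complex X h')"
        by (auto simp: S_def frontier_cbox in_cbox_complex_iff)
      have Dz: "norm (D z) \<le> C * exp (- c * exp (\<kappa> * Re z))"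
        using le[of z] zS x1 h' by auto
      have cospos: "0 \<le> cos (\<beta> * Im z)"
      proof (rule cos_ge_zero)
        have "\<bar>\<beta> * Im z\<bar> \<le> \<beta> * h'" using zS(3) \<beta>(1) by (simp add: abs_mult)
        then show "- (pi / 2) \<le> \<beta> * Im z" "\<beta> * Im z \<le> pi / 2" using \<beta>(3) by linarith+
      qed
      have DC: "norm (D z) \<le> C"
        using Dz mult_left_mono[OF _ C, of "exp (- c * exp (\<kappa> * Re z))" 1] c by fastforce
      have ge1: "1 \<le> exp (\<mu> * exp (\<beta> * x1))" using \<mu> by simp
      consider "\<bar>Im z\<bar> = h'" | "Re z = x1" | "Re z = X"
        using zS by (auto simp: in_box_complex_iff)
      then show "norm (M z) \<le> C * exp (\<mu> * exp (\<beta> * x1))"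
      proof cases
        case 1
        then have "\<bar>\<beta> * Im z\<bar> = pi / 2" using \<beta> by (simp add: abs_mult)
        then have "cos (\<beta> * Im z) = 0" by (metis abs_real_def cos_minus cos_pi_half)
        then have "norm (M z) \<le> C" using DC by (simp add: nM)
        also have "\<dots> \<le> C * exp (\<mu> * exp (\<beta> * x1))" using mult_left_mono[OF ge1 C] by simp
        finally show ?thesis .
      next
        case 2
        have "exp (\<beta> * Re z) * cos (\<beta> * Im z) \<le> exp (\<beta> * x1)"
          using 2 by (simp add: mult_left_le)
        then show ?thesis
          unfolding nM using DC \<mu> C by (intro mult_mono) auto
      next
        case 3
        have "exp (\<beta> * X) * cos (\<beta> * Im z) \<le> exp (\<beta> * X)" by (simp add: mult_left_le)
        then have "\<mu> * (exp (\<beta> * X) * cos (\<beta> * Im z)) \<le> \<mu> * exp (\<beta> * X)" using \<mu> by simp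
        also have "\<dots> \<le> c * exp ((\<kappa> - \<beta>) * X) * exp (\<beta> * X)" using X by simp
        also have "\<dots> = c * exp (\<kappa> * X)" by (simp add: mult_exp_exp algebra_simps)
        finally have "norm (M z) \<le> C * exp (- c * exp (\<kappa> * X)) * exp (c * exp (\<kappa> * X))"
          unfolding nM using Dz C 3 by (intro mult_mono) auto
        also have "\<dots> = C" by (simp add: mult.assoc mult_exp_exp)
        also have "\<dots> \<le> C * exp (\<mu> * exp (\<beta> * x1))" using mult_left_mono[OF ge1 C] by simp
        finally show ?thesis .
      qed
    qed
    then show ?thesis by (simp add: nM)
  qed
  define d where "d = exp (\<beta> * x) - exp (\<beta> * x1)"
  have d: "d > 0" using x1 \<beta> by (simp add: d_def)
  have "norm (D (of_real x)) \<le> C * exp (- (\<mu> * d))" if "\<mu> > 0" for \<mu>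
  proof -
    have "norm (D (of_real x)) * exp (\<mu> * exp (\<beta> * x)) * exp (- (\<mu> * exp (\<beta> * x)))
        \<le> C * exp (\<mu> * exp (\<beta> * x1)) * exp (- (\<mu> * exp (\<beta> * x)))"
      using main[OF that] by (intro mult_right_mono) auto
    then show ?thesis by (simp add: mult.assoc mult_exp_exp d_def algebra_simps)
  qed
  then have "eventually (\<lambda>\<mu>. norm (D (of_real x)) \<le> C * exp (- (\<mu> * d))) at_top"
    by (intro eventually_mono[OF eventually_gt_at_top[of 0]])
  moreover have "((\<lambda>\<mu>. C * exp (- (\<mu> * d))) \<longlongrightarrow> C * 0) at_top"
    using d by (intro tendsto_mult tendsto_const filterlim_compose[OF exp_at_bot] filterlim_compose[OF filterlim_uminus_at_bot_at_top]
        filterlim_at_top_mult_tendsto_pos[OF tendsto_const _ filterlim_ident])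
  ultimately have "norm (D (of_real x)) \<le> C * 0"
    by (intro tendsto_lowerbound) auto
  then show ?thesis by simp
qed

text \<open>Optimal truncation: take \<open>N\<close> close to \<open>(e B y)\<close> to the power \<open>- k\<close>.\<close>

lemma Gevrey_exponentially_small:
  fixes k B y :: real
  assumes k: "k > 0" and B: "B > 0" and y: "y > 0" and C: "C \<ge> 0"
    and le: "\<And>N. d \<le> C * B ^ N * fact N powr (1 / k) * y ^ N"
  shows "d \<le> C * exp 1 * exp (- ((exp 1 * B) powr (- k)) * y powr (- k))"
proof -
  define a where "a = (exp 1 * B * y) powr (- k)"
  define N where "N = nat \<lfloor>a\<rfloor>"
  have a: "a > 0" using B y by (simp add: a_def)
  have N: "real N \<le> a" "a < real N + 1" using a by (simp_all add: N_def)
  \<comment> \<open>By \<open>fact N \<le> N ^ N\<close> and \<open>N \<le> a\<close>, each of the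
    \<open>N\<close> factors is at most \<open>B * a powr (1 / k) * y = exp (- 1)\<close>.\<close>
  have "B ^ N * fact N powr (1 / k) * y ^ N \<le> exp (- real N)"
  proof (cases "N = 0")
    case False
    have "(fact N :: real) \<le> real N ^ N"
      using fact_le_power[of N] by (metis of_nat_fact of_nat_power)
    then have "fact N powr (1 / k) \<le> (real N ^ N) powr (1 / k)"
      using k by (intro powr_mono2) auto
    also have "\<dots> = (real N powr (1 / k)) ^ N"
      using False by (simp add: powr_powr powr_realpow[symmetric] mult.commute)
    also have "\<dots> \<le> (a powr (1 / k)) ^ N"
      using N k by (intro power_mono powr_mono2) auto
    also have "a powr (1 / k) = (exp 1 * B * y) powr (- 1)"
      unfolding a_def powr_powr using k by simp
    also have "\<dots> = inverse (exp 1 * B * y)"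
      using B y by (simp add: powr_minus)
    finally have "B ^ N * fact N powr (1 / k) * y ^ N \<le> B ^ N * inverse (exp 1 * B * y) ^ N * y ^ N"
      using B y by (intro mult_right_mono mult_left_mono) auto
    also have "\<dots> = (exp (- 1)) ^ N"
    proof -
      have "B * inverse (exp 1 * B * y) * y = exp (- 1)"
        using B y by (simp add: exp_minus field_simps)
      then show ?thesis by (simp only: power_mult_distrib[symmetric])
    qed
    also have "\<dots> = exp (- real N)" by (simp add: exp_of_nat_mult[symmetric])
    finally show ?thesis .
  qed simp
  \<comment> \<open>Rounding \<open>a\<close> down to \<open>N\<close> costs at most the factor
    \<open>exp 1\<close>.\<close>
  also have "\<dots> \<le> exp (1 - a)" using N by simp
  finally have "C * (B ^ N * fact N powr (1 / k) * y ^ N) \<le> C * exp (1 - a)"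
    using C by (rule mult_left_mono)
  with le[of N] have "d \<le> C * exp (1 - a)" by (simp add: mult.assoc)
  also have "exp (1 - a) = exp 1 * exp (- a)" by (simp add: mult_exp_exp)
  also have "a = (exp 1 * B) powr (- k) * y powr (- k)"
    using B y by (simp add: a_def powr_mult)
  finally show ?thesis by (simp add: mult.assoc)
qed

text \<open>The angle is measured from the unit vector \<open>\<omega>\<close>, so no branch cut of
  \<open>Arg\<close> interferes; \<open>h\<close> is half the opening.\<close>

definition sector :: "complex \<Rightarrow> real \<Rightarrow> real \<Rightarrow> complex set" where
  "sector \<omega> h \<tau> = {t. t \<noteq> 0 \<and> norm t < \<tau> \<and> (\<exists>\<psi>. \<bar>\<psi>\<bar> < h \<and> t = of_real (norm t) * \<omega> * cis \<psi>)}"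

text \<open>Sums in neighbouring directions have the same asymptotic series, so their difference is
  exponentially small on a common sector wide enough for \<open>Watson_strip\<close>. The constants
  \<open>C\<close> and \<open>B\<close> are absent from the conclusion: they only make sums agree
  and identify the Taylor coefficients of the glued function.\<close>

lemma summable_all_directions_coeff_bound:
  fixes c :: "nat \<Rightarrow> complex" and g :: "complex \<Rightarrow> complex \<Rightarrow> complex" and l :: nat
  assumes l: "l \<ge> 1" and k: "k > 0" and h: "pi / (2 * (k * real l)) < h" and \<tau>: "\<tau> > 0" and B: "B > 0"
    and hol: "\<And>\<omega>. norm \<omega> = 1 \<Longrightarrow> g \<omega> holomorphic_on sector \<omega> h \<tau>"
    and bdd: "\<And>\<omega> t. norm \<omega> = 1 \<Longrightarrow> t \<in> sector \<omega> h \<tau> \<Longrightarrow> norm (g \<omega> t) \<le> C0"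
    and asym: "\<And>\<omega> t N. norm \<omega> = 1 \<Longrightarrow> t \<in> sector \<omega> h \<tau> \<Longrightarrow>
        norm (g \<omega> t - (\<Sum>m<l * N. c m * t ^ m)) \<le> C * B ^ N * fact N powr (1 / k) * norm t ^ (l * N)"
  shows "norm (c m) * \<tau> ^ m \<le> C0"
proof -
  define \<kappa> where "\<kappa> = k * real l"
  have \<kappa>: "\<kappa> > 0" using l k by (simp add: \<kappa>_def)
  \<comment> \<open>Half-width \<open>h1\<close> still suffices for Watson's lemma, and the
    remainder \<open>\<eta> = h - h1\<close> is how far two directions may differ while their
    sectors share one of half-opening \<open>h1\<close>.\<close>
  obtain h1 where h1: "pi / (2 * \<kappa>) < h1" "h1 < h" using dense[OF h] by (auto simp: \<kappa>_def)
  have h1pos: "h1 > 0" using h1(1) \<kappa> by (meson divide_pos_pos less_trans mult_pos_pos pi_gt_zero zero_less_numeral)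
  define \<eta> where "\<eta> = h - h1"
  have \<eta>: "\<eta> > 0" using h1 by (simp add: \<eta>_def)
  have C: "C \<ge> 0"
  proof -
    have mem: "of_real (\<tau> / 2) \<in> sector 1 h \<tau>"
      using \<tau> h1pos h1 by (auto simp: sector_def intro!: exI[of _ 0])
    have "0 \<le> norm (g 1 (of_real (\<tau> / 2)) - (\<Sum>m<l * 0. c m * of_real (\<tau> / 2) ^ m))" by simp
    also have "\<dots> \<le> C" using asym[OF _ mem, of 0] by simp
    finally show ?thesis .
  qed
  have agree: "g \<omega> t = g (sgn t) t"
    if \<omega>: "norm \<omega> = 1" and t: "t \<noteq> 0" "norm t < \<tau>" and \<delta>: "\<bar>\<delta>\<bar> < \<eta>" "sgn t = \<omega> * cis \<delta>" for \<omega> t \<delta>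
  proof -
    define \<omega>' where "\<omega>' = sgn t"
    have \<omega>': "norm \<omega>' = 1" using t by (simp add: \<omega>'_def norm_sgn)
    \<comment> \<open>In the logarithmic coordinate \<open>z\<close> the common sector becomes a
      half strip, with \<open>exp (- Re z)\<close> as the modulus of the point and the ray through
      \<open>t\<close> as the real axis.\<close>
    define D where "D z = g \<omega> (\<omega>' * exp (- z)) - g \<omega>' (\<omega>' * exp (- z))" for z
    define U where "U = {z. - ln \<tau> < Re z \<and> \<bar>Im z\<bar> < h1}"
    have pol: "\<omega>' * exp (- z) = of_real (exp (- Re z)) * \<omega>' * cis (- Im z)" for z
      by (simp add: exp_eq_polar)
    have nrm: "norm (\<omega>' * exp (- z)) = exp (- Re z)" for z
      using \<omega>' by (simp add: norm_mult)
    have small: "exp (- Re z) < \<tau>" if "z \<in> U" for z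
    proof -
      have "exp (- Re z) < exp (ln \<tau>)" using that by (simp add: U_def)
      then show ?thesis using \<tau> by simp
    qed
    have in1: "\<omega>' * exp (- z) \<in> sector \<omega>' h \<tau>" if z: "z \<in> U" for z
      unfolding sector_def
    proof (intro CollectI conjI exI)
      show "\<bar>- Im z\<bar> < h" using z h1 by (simp add: U_def)
      show "\<omega>' * exp (- z) = complex_of_real (cmod (\<omega>' * exp (- z))) * \<omega>' * cis (- Im z)"
        unfolding nrm by (rule pol)
    qed (use small[OF z] nrm[of z] \<omega>' in auto)
    have in2: "\<omega>' * exp (- z) \<in> sector \<omega> h \<tau>" if z: "z \<in> U" for z
      unfolding sector_def
    proof (intro CollectI conjI exI)
      have "\<bar>Im z\<bar> < h1" using z by (simp add: U_def)
      then show "\<bar>\<delta> - Im z\<bar> < h" using \<delta>(1) unfolding \<eta>_def by linarith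
      show "\<omega>' * exp (- z) = complex_of_real (cmod (\<omega>' * exp (- z))) * \<omega> * cis (\<delta> - Im z)"
        unfolding nrm by (subst pol) (simp add: \<omega>'_def \<delta>(2) mult.assoc cis_mult)
    qed (use small[OF z] nrm[of z] \<omega>' in auto)
    have "D holomorphic_on U"
      unfolding D_def
      by (intro holomorphic_on_diff holomorphic_on_compose_gen[OF _ hol, unfolded o_def] holomorphic_intros)
         (use \<omega> \<omega>' in1 in2 in auto)
    have Dle: "norm (D z) \<le> 2 * C * exp 1 * exp (- ((exp 1 * B) powr (- k)) * exp (\<kappa> * Re z))" if z: "z \<in> U" for z
    proof -
      let ?t = "\<omega>' * exp (- z)"
      \<comment> \<open>This is the \<open>l\<close>-th power of the modulus, so the exponential
        bound in \<open>y powr (- k)\<close> decays at the rate \<open>\<kappa> = k * l\<close> that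
        \<open>Watson_strip\<close> expects.\<close>
      define y where "y = exp (- real l * Re z)"
      have y: "y ^ N = norm ?t ^ (l * N)" for N
        by (simp add: nrm y_def exp_of_nat_mult[symmetric] algebra_simps)
      have "norm (D z) \<le> 2 * C * exp 1 * exp (- ((exp 1 * B) powr (- k)) * y powr (- k))"
      proof (rule Gevrey_exponentially_small[OF k B])
        fix N
        have "norm (D z) \<le> norm (g \<omega> ?t - (\<Sum>m<l * N. c m * ?t ^ m)) + norm (g \<omega>' ?t - (\<Sum>m<l * N. c m * ?t ^ m))"
          unfolding D_def by (rule order_trans[OF _ norm_triangle_ineq4]) simp
        also have "\<dots> \<le> C * B ^ N * fact N powr (1 / k) * norm ?t ^ (l * N) + C * B ^ N * fact N powr (1 / k) * norm ?t ^ (l * N)"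
          by (intro add_mono asym in1 in2 z \<omega> \<omega>')
        finally show "norm (D z) \<le> 2 * C * B ^ N * fact N powr (1 / k) * y ^ N"
          by (simp add: y)
      qed (use C in \<open>auto simp: y_def\<close>)
      moreover have "y powr (- k) = exp (\<kappa> * Re z)"
        by (simp add: y_def powr_def \<kappa>_def)
      ultimately show ?thesis by simp
    qed
    have "D (of_real (- ln (norm t))) = 0"
    proof (rule Watson_strip[OF \<open>D holomorphic_on U\<close>[unfolded U_def] \<kappa> h1(1)])
      show "0 < (exp 1 * B) powr (- k)" using B by simp
      show "- ln \<tau> < - ln (norm t)" using t \<tau> ln_less_cancel_iff[of "norm t" \<tau>] by simp
    qed (use Dle in \<open>auto simp: U_def\<close>)
    moreover have "\<omega>' * exp (- of_real (- ln (norm t))) = t"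
      using t by (simp add: \<omega>'_def exp_of_real sgn_eq)
    ultimately show ?thesis by (simp add: D_def \<omega>'_def)
  qed
  \<comment> \<open>Each point uses the sum in its own direction; \<open>agree\<close> replaces this
    locally by the sum in one fixed direction, which yields holomorphy.\<close>
  define g0 where "g0 t = g (sgn t) t" for t
  have insec: "t \<in> sector (sgn t) h \<tau>" if "t \<noteq> 0" "norm t < \<tau>" for t
    using that h1 h1pos by (auto simp: sector_def sgn_eq intro!: exI[of _ 0])
  have "g0 holomorphic_on ball 0 \<tau> - {0}"
    unfolding holomorphic_on_def
  proof
    fix t0 :: complex assume t0: "t0 \<in> ball 0 \<tau> - {0}"
    then have "t0 \<noteq> 0" "norm t0 < \<tau>" by auto
    \<comment> \<open>The quotient stays near 1, away from the branch cut of \<open>Arg\<close>, for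
      every \<open>t0\<close>.\<close>
    have "((\<lambda>t. Arg (t / t0)) \<longlongrightarrow> Arg (t0 / t0)) (at t0)"
      using \<open>t0 \<noteq> 0\<close> by (intro isCont_tendsto_compose[OF continuous_at_Arg] tendsto_intros) auto
    then have "((\<lambda>t. Arg (t / t0)) \<longlongrightarrow> 0) (nhds t0)"
      using \<open>t0 \<noteq> 0\<close> by (simp add: tendsto_nhds_iff)
    then have "eventually (\<lambda>t. \<bar>Arg (t / t0)\<bar> < \<eta>) (nhds t0)"
      using \<eta> by (auto simp: tendsto_iff dist_real_def)
    moreover have "eventually (\<lambda>t. t \<in> ball 0 \<tau> - {0}) (nhds t0)"
      using t0 by (intro eventually_nhds_in_open) auto
    ultimately have "eventually (\<lambda>t. \<bar>Arg (t / t0)\<bar> < \<eta> \<and> t \<in> ball 0 \<tau> - {0}) (nhds t0)"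
      by (rule eventually_conj)
    then obtain V where V: "open V" "t0 \<in> V"
      "\<And>t. t \<in> V \<Longrightarrow> \<bar>Arg (t / t0)\<bar> < \<eta> \<and> t \<in> ball 0 \<tau> - {0}"
      unfolding eventually_nhds by blast
    have sg: "sgn t = sgn t0 * cis (Arg (t / t0))" if "t \<in> V" for t
    proof -
      have "cis (Arg (t / t0)) = sgn t / sgn t0"
        using V(3)[OF that] \<open>t0 \<noteq> 0\<close> by (subst cis_Arg) (auto simp: sgn_divide)
      then show ?thesis using \<open>t0 \<noteq> 0\<close> by (simp add: sgn_zero_iff)
    qed
    have n1: "norm (sgn t0) = 1" using \<open>t0 \<noteq> 0\<close> by (simp add: norm_sgn)
    have "V \<subseteq> sector (sgn t0) h \<tau>"
    proof
      fix t assume t: "t \<in> V"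
      show "t \<in> sector (sgn t0) h \<tau>"
        unfolding sector_def
      proof (intro CollectI conjI exI)
        show "\<bar>Arg (t / t0)\<bar> < h" using V(3)[OF t] h1pos by (simp add: \<eta>_def)
        have "t = of_real (norm t) * sgn t" using V(3)[OF t] by (simp add: sgn_eq)
        then show "t = of_real (norm t) * sgn t0 * cis (Arg (t / t0))"
          using sg[OF t] by (simp add: mult.assoc)
      qed (use V(3)[OF t] in auto)
    qed
    then have "g (sgn t0) holomorphic_on V"
      using hol[OF n1] holomorphic_on_subset by blast
    moreover have "g (sgn t0) t = g0 t" if "t \<in> V" for t
      unfolding g0_def by (rule agree[OF n1 _ _ _ sg[OF that]]) (use V(3)[OF that] in auto)
    ultimately have "g0 holomorphic_on V"
      by (rule holomorphic_transform)
    then have "g0 field_differentiable at t0"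
      using V(1,2) by (rule holomorphic_on_imp_differentiable_at)
    then show "g0 field_differentiable at t0 within ball 0 \<tau> - {0}"
      by (rule field_differentiable_at_within)
  qed
  moreover have "eventually (\<lambda>t. norm (g0 t) \<le> C0) (at 0)"
  proof -
    have "eventually (\<lambda>t. t \<in> ball 0 \<tau> - {0}) (at (0::complex))"
      using \<tau> by (intro eventually_at_in_open) auto
    then show ?thesis
      by eventually_elim (auto simp: g0_def norm_sgn intro!: bdd insec)
  qed
  ultimately obtain G where G: "G holomorphic_on ball 0 \<tau>" "\<And>t. t \<in> ball 0 \<tau> - {0} \<Longrightarrow> G t = g0 t"
    using holomorphic_on_extend_bounded[of g0 "ball 0 \<tau>" 0] \<tau> by auto
  have "norm ((deriv ^^ m) G 0 / fact m) * \<tau> ^ m \<le> C0"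
    by (rule Cauchy_estimate_punctured[OF G(1) \<tau>]) (auto simp: G(2) g0_def norm_sgn intro!: bdd insec)
  moreover have "(deriv ^^ m) G 0 = fact m * c m"
  proof -
    \<comment> \<open>Since \<open>l \<ge> 1\<close>, this truncation includes the coefficient
      \<open>c m\<close>, and \<open>G\<close> minus the truncation vanishes to an order beyond
      \<open>m\<close>.\<close>
    define N where "N = Suc m"
    have "1 * Suc m \<le> l * N" unfolding N_def using l by (intro mult_le_mono) auto
    then have mN: "m < l * N" by simp
    define p where "p t = (\<Sum>i<l * N. c i * t ^ i)" for t
    have p: "p holomorphic_on ball 0 \<tau>" unfolding p_def by (intro holomorphic_intros)
    have "(deriv ^^ m) p 0 = fact m * (if m < l * N then c m else 0)"
    proof (rule higher_deriv_power_series_0[OF \<tau>])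
      fix t
      have "(\<lambda>n. if n \<in> {..<l * N} then c n * t ^ n else 0) sums (\<Sum>n\<in>{..<l * N}. c n * t ^ n)"
        by (rule sums_If_finite_set) simp
      moreover have "(\<lambda>n. if n \<in> {..<l * N} then c n * t ^ n else 0) = (\<lambda>n. (if n < l * N then c n else 0) * t ^ n)"
        by auto
      ultimately show "(\<lambda>n. (if n < l * N then c n else 0) * t ^ n) sums p t"
        by (simp add: p_def)
    qed
    moreover have "(deriv ^^ m) (\<lambda>t. G t - p t) 0 = 0"
    proof (rule higher_deriv_eq_0_of_order[OF _ \<tau> _ mN])
      show "(\<lambda>t. G t - p t) holomorphic_on ball 0 \<tau>" by (intro holomorphic_intros G p)
      fix t :: complex assume t: "norm t < \<tau>" "t \<noteq> 0"
      have "norm (g (sgn t) t - (\<Sum>m<l * N. c m * t ^ m)) \<le> C * B ^ N * fact N powr (1 / k) * norm t ^ (l * N)"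
        by (rule asym) (use t insec in \<open>auto simp: norm_sgn\<close>)
      then show "norm (G t - p t) \<le> (C * B ^ N * fact N powr (1 / k)) * norm t ^ (l * N)"
        using t G(2)[of t] by (simp add: p_def g0_def)
    qed
    moreover have "(deriv ^^ m) (\<lambda>t. G t - p t) 0 = (deriv ^^ m) G 0 - (deriv ^^ m) p 0"
      by (rule higher_deriv_diff[OF G(1) p]) (use \<tau> in auto)
    ultimately show ?thesis using mN by simp
  qed
  ultimately show ?thesis by simp
qed

section \<open>Coefficient bounds for polynomials\<close>

lemma polynomial_coeff_bound:
  fixes c :: "nat \<Rightarrow> complex"
  assumes \<tau>: "\<tau> > 0" and le: "\<And>z. norm z < \<tau> \<Longrightarrow> norm (\<Sum>i\<le>m. c i * z ^ i) \<le> S" and i: "i \<le> m"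
  shows "norm (c i) * \<tau> ^ i \<le> S"
proof -
  define q where "q z = (\<Sum>i\<le>m. c i * z ^ i)" for z
  have "(deriv ^^ i) q 0 = fact i * (if i \<le> m then c i else 0)"
  proof (rule higher_deriv_power_series_0[OF \<tau>])
    fix t
    have "(\<lambda>n. if n \<in> {..m} then c n * t ^ n else 0) sums (\<Sum>n\<in>{..m}. c n * t ^ n)"
      by (rule sums_If_finite_set) simp
    moreover have "(\<lambda>n. if n \<in> {..m} then c n * t ^ n else 0) = (\<lambda>n. (if n \<le> m then c n else 0) * t ^ n)"
      by auto
    ultimately show "(\<lambda>n. (if n \<le> m then c n else 0) * t ^ n) sums q t"
      by (simp add: q_def)
  qed
  moreover have "norm ((deriv ^^ i) q 0 / fact i) * \<tau> ^ i \<le> S"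
    by (rule Cauchy_estimate_punctured[OF _ \<tau>]) (auto simp: q_def[abs_def] intro!: holomorphic_intros le)
  ultimately show ?thesis using i by simp
qed

lemma polynomial_recenter:
  fixes c :: "nat \<Rightarrow> complex"
  obtains b where "\<And>w. (\<Sum>i\<le>m. c i * (v + w) ^ i) = (\<Sum>j\<le>m. b j * w ^ j)"
proof
  fix w
  have "(v + w) ^ i = (\<Sum>j\<le>m. of_nat (i choose j) * w ^ j * v ^ (i - j))" if "i \<le> m" for i
  proof -
    have "(v + w) ^ i = (\<Sum>j\<le>i. of_nat (i choose j) * w ^ j * v ^ (i - j))"
      by (subst add.commute) (rule binomial_ring)
    also have "\<dots> = (\<Sum>j\<le>m. of_nat (i choose j) * w ^ j * v ^ (i - j))"
      using that by (intro sum.mono_neutral_left) (auto simp: binomial_eq_0)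
    finally show ?thesis .
  qed
  then have "(\<Sum>i\<le>m. c i * (v + w) ^ i) = (\<Sum>i\<le>m. \<Sum>j\<le>m. c i * (of_nat (i choose j) * w ^ j * v ^ (i - j)))"
    by (simp add: sum_distrib_left)
  also have "\<dots> = (\<Sum>j\<le>m. \<Sum>i\<le>m. c i * (of_nat (i choose j) * w ^ j * v ^ (i - j)))"
    by (rule sum.swap)
  also have "\<dots> = (\<Sum>j\<le>m. (\<Sum>i\<le>m. c i * of_nat (i choose j) * v ^ (i - j)) * w ^ j)"
    by (simp add: sum_distrib_left sum_distrib_right mult_ac)
  finally show "(\<Sum>i\<le>m. c i * (v + w) ^ i) = (\<Sum>j\<le>m. (\<Sum>i\<le>m. c i * of_nat (i choose j) * v ^ (i - j)) * w ^ j)" .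
qed

text \<open>Cauchy's estimates for the expansion at \<open>v\<close> control the polynomial on the
  unit disc about 0, where they are applied again. The loss is geometric in \<open>m\<close>, with a
  base depending only on \<open>v\<close> and \<open>\<epsilon>\<close>.\<close>

lemma polynomial_coeff_bound_off_center:
  fixes v :: complex
  assumes \<epsilon>: "\<epsilon> > 0"
  obtains L :: real where "L \<ge> 1"
    "\<And>m c S i. (\<And>z. norm (z - v) < \<epsilon> \<Longrightarrow> norm (\<Sum>i\<le>m. c i * z ^ i) \<le> S) \<Longrightarrow> i \<le> m \<Longrightarrow> norm (c i) \<le> S * L ^ m"
proof -
  \<comment> \<open>The disc of radius \<open>1 + norm v\<close> about \<open>v\<close> contains the
    unit disc; the quotient compares it with the disc on which the bound is known.\<close>
  define X where "X = max 1 ((1 + norm v) / \<epsilon>)"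
  have X: "X \<ge> 1" by (simp add: X_def)
  show ?thesis
  proof
    show "2 * X \<ge> 1" using X by simp
    fix m S i and c :: "nat \<Rightarrow> complex"
    assume le: "\<And>z. norm (z - v) < \<epsilon> \<Longrightarrow> norm (\<Sum>i\<le>m. c i * z ^ i) \<le> S" and i: "i \<le> m"
    have S: "S \<ge> 0" using le[of v] \<epsilon> by (smt (verit) diff_self norm_ge_zero norm_zero)
    obtain b where b: "\<And>w. (\<Sum>i\<le>m. c i * (v + w) ^ i) = (\<Sum>j\<le>m. b j * w ^ j)"
      using polynomial_recenter[of c v m] by blast
    have bj: "norm (b j) * \<epsilon> ^ j \<le> S" if "j \<le> m" for j
      by (rule polynomial_coeff_bound[OF \<epsilon> _ that]) (use le[of "v + _"] in \<open>simp add: b\<close>)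
    have "norm (\<Sum>i\<le>m. c i * z ^ i) \<le> S * (2 * X) ^ m" if z: "norm z < 1" for z
    proof -
      have w: "norm (z - v) \<le> 1 + norm v" using z by (smt (verit) norm_triangle_ineq4)
      have "(\<Sum>i\<le>m. c i * z ^ i) = (\<Sum>j\<le>m. b j * (z - v) ^ j)" using b[of "z - v"] by simp
      also have "norm \<dots> \<le> (\<Sum>j\<le>m. S * X ^ m)"
      proof (rule sum_norm_le)
        fix j assume "j \<in> {..m}"
        then have j: "j \<le> m" by simp
        have "norm (b j * (z - v) ^ j) = norm (b j) * norm (z - v) ^ j"
          by (simp add: norm_mult norm_power)
        also have "\<dots> \<le> norm (b j) * (1 + norm v) ^ j"
          using w by (intro mult_left_mono power_mono) auto
        also have "\<dots> = norm (b j) * \<epsilon> ^ j * ((1 + norm v) / \<epsilon>) ^ j"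
          using \<epsilon> by (simp add: power_divide)
        also have "\<dots> \<le> S * X ^ j"
          using bj[OF j] \<epsilon> S by (intro mult_mono power_mono) (auto simp: X_def)
        also have "\<dots> \<le> S * X ^ m"
          using S X j by (intro mult_left_mono power_increasing) auto
        finally show "norm (b j * (z - v) ^ j) \<le> S * X ^ m" .
      qed
      also have "\<dots> = real (m + 1) * (S * X ^ m)" by simp
      \<comment> \<open>The number of summands is absorbed into the geometric constant, which is why
        the base is \<open>2 * X\<close>.\<close>
      also have "\<dots> \<le> 2 ^ m * (S * X ^ m)"
      proof (rule mult_right_mono)
        have "m + 1 \<le> 2 ^ m" using Suc_leI[OF less_exp[of m]] by simp
        then show "real (m + 1) \<le> 2 ^ m" by (metis of_nat_le_iff of_nat_numeral of_nat_power)
      qed (use S X in auto)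
      finally show ?thesis by (simp add: power_mult_distrib mult_ac)
    qed
    then have "norm (c i) * 1 ^ i \<le> S * (2 * X) ^ m"
      by (intro polynomial_coeff_bound[OF _ _ i]) auto
    then show "norm (c i) \<le> S * (2 * X) ^ m" by simp
  qed
qed

text \<open>The one-variable bound is applied to one coordinate after another, so the constants of
  the coordinates multiply.\<close>

lemma mpolynomial_coeff_bound:
  fixes v0 :: "complex^'d::finite"
  assumes \<epsilon>: "\<epsilon> > 0"
  obtains L :: real where "L \<ge> 1"
    "\<And>m S I c (\<alpha> :: 'd \<Rightarrow> nat). finite I \<Longrightarrow> (\<And>\<beta> j. \<beta> \<in> I \<Longrightarrow> \<beta> j \<le> m) \<Longrightarrow>
       (\<And>v. (\<And>j. norm (v $ j - v0 $ j) < \<epsilon>) \<Longrightarrow> norm (\<Sum>\<beta>\<in>I. monomial v \<beta> * c \<beta>) \<le> S) \<Longrightarrow>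
       \<alpha> \<in> I \<Longrightarrow> norm (c \<alpha>) \<le> S * L ^ m"
proof -
  define good :: "'d \<Rightarrow> real \<Rightarrow> bool" where "good j L \<longleftrightarrow> L \<ge> 1 \<and>
    (\<forall>m c S i. (\<forall>z. norm (z - v0 $ j) < \<epsilon> \<longrightarrow> norm (\<Sum>i\<le>m. c i * z ^ i) \<le> S) \<longrightarrow> i \<le> m \<longrightarrow> norm (c i) \<le> S * L ^ m)" for j L
  have "\<exists>L. good j L" for j
    unfolding good_def by (rule polynomial_coeff_bound_off_center[OF \<epsilon>, of "v0 $ j"]) blast
  then obtain \<Lambda> where good: "\<And>j. good j (\<Lambda> j)" by metis
  have \<Lambda>: "\<Lambda> j \<ge> 1" for j using good[of j] by (simp add: good_def)
  have uni: "norm (c i) \<le> S * \<Lambda> j ^ m"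
    if "\<And>z. norm (z - v0 $ j) < \<epsilon> \<Longrightarrow> norm (\<Sum>i\<le>m. c i * z ^ i) \<le> S" "i \<le> m" for j m c S i
    using good[of j] that unfolding good_def by blast
  show ?thesis
  proof (rule that[of "\<Prod>j\<in>UNIV. \<Lambda> j"])
    show "1 \<le> (\<Prod>j\<in>UNIV. \<Lambda> j)" using \<Lambda> by (intro prod_ge_1) auto
    fix m S I and c :: "('d \<Rightarrow> nat) \<Rightarrow> complex" and \<alpha>
    assume I: "finite I" and m: "\<And>\<beta> j. \<beta> \<in> I \<Longrightarrow> \<beta> j \<le> m"
      and le: "\<And>v. (\<And>j. norm (v $ j - v0 $ j) < \<epsilon>) \<Longrightarrow> norm (\<Sum>\<beta>\<in>I. monomial v \<beta> * c \<beta>) \<le> S"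
      and \<alpha>: "\<alpha> \<in> I"
    \<comment> \<open>The coordinates in \<open>A\<close> have been processed: their exponents are
      frozen to those of \<open>\<alpha>\<close> and their variables removed. Thus
      \<open>G {}\<close> is the given polynomial and \<open>G UNIV\<close> the single coefficient
      \<open>c \<alpha>\<close>.\<close>
    define G where "G A v = (\<Sum>\<beta> | \<beta> \<in> I \<and> (\<forall>j\<in>A. \<beta> j = \<alpha> j). (\<Prod>j\<in>-A. (v $ j) ^ \<beta> j) * c \<beta>)" for A and v :: "complex^'d"
    have "norm (G A v) \<le> S * (\<Prod>j\<in>A. \<Lambda> j ^ m)" if v: "\<And>j. norm (v $ j - v0 $ j) < \<epsilon>" for A v
      using finite[of A] v
    proof (induction A arbitrary: v rule: finite_induct)
      case empty
      show ?case using le[OF empty] by (simp add: G_def monomial_def)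
    next
      case (insert a A)
      define b where "b i = (\<Sum>\<beta> | \<beta> \<in> I \<and> (\<forall>j\<in>A. \<beta> j = \<alpha> j) \<and> \<beta> a = i. (\<Prod>j\<in>-insert a A. (v $ j) ^ \<beta> j) * c \<beta>)" for i
      \<comment> \<open>As a polynomial in coordinate \<open>a\<close> alone, \<open>G A\<close> has
        \<open>G (insert a A)\<close> as its coefficient at the exponent
        \<open>\<alpha> a\<close>.\<close>
      have "G A (\<chi> j. if j = a then z else v $ j) = (\<Sum>i\<le>m. b i * z ^ i)" for z
      proof -
        let ?u = "\<chi> j. if j = a then z else v $ j"
        let ?J = "{\<beta> \<in> I. \<forall>j\<in>A. \<beta> j = \<alpha> j}"
        have "G A ?u = (\<Sum>i\<le>m. \<Sum>\<beta> | \<beta> \<in> ?J \<and> \<beta> a = i. (\<Prod>j\<in>-A. (?u $ j) ^ \<beta> j) * c \<beta>)"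
          unfolding G_def by (rule sum.group[symmetric]) (use I m in auto)
        also have "\<dots> = (\<Sum>i\<le>m. b i * z ^ i)"
        proof (rule sum.cong[OF refl])
          fix i
          have "(\<Prod>j\<in>-A. (?u $ j) ^ \<beta> j) = z ^ \<beta> a * (\<Prod>j\<in>-insert a A. (v $ j) ^ \<beta> j)" for \<beta>
          proof -
            have "(\<Prod>j\<in>-A. (?u $ j) ^ \<beta> j) = (?u $ a) ^ \<beta> a * (\<Prod>j\<in>-A - {a}. (?u $ j) ^ \<beta> j)"
              by (rule prod.remove) (use insert.hyps in auto)
            also have "-A - {a} = -insert a A" by auto
            also have "(\<Prod>j\<in>-insert a A. (?u $ j) ^ \<beta> j) = (\<Prod>j\<in>-insert a A. (v $ j) ^ \<beta> j)"
              by (rule prod.cong) auto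
            finally show ?thesis by simp
          qed
          then show "(\<Sum>\<beta> | \<beta> \<in> ?J \<and> \<beta> a = i. (\<Prod>j\<in>-A. (?u $ j) ^ \<beta> j) * c \<beta>) = b i * z ^ i"
            unfolding b_def sum_distrib_right by (intro sum.cong) (auto simp: mult_ac)
        qed
        finally show ?thesis .
      qed
      moreover have "norm (G A (\<chi> j. if j = a then z else v $ j)) \<le> S * (\<Prod>j\<in>A. \<Lambda> j ^ m)" if "norm (z - v0 $ a) < \<epsilon>" for z
        by (rule insert.IH) (use insert.prems that in auto)
      ultimately have "norm (b (\<alpha> a)) \<le> S * (\<Prod>j\<in>A. \<Lambda> j ^ m) * \<Lambda> a ^ m"
        by (intro uni m[OF \<alpha>]) simp
      moreover have "b (\<alpha> a) = G (insert a A) v"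
        unfolding b_def G_def by (rule sum.cong) auto
      ultimately show ?case using insert.hyps by (simp add: mult_ac)
    qed
    from this[of v0 UNIV] have "norm (G UNIV v0) \<le> S * (\<Prod>j\<in>UNIV. \<Lambda> j ^ m)" using \<epsilon> by simp
    moreover have "G UNIV v0 = c \<alpha>"
    proof -
      have "{\<beta>. \<beta> \<in> I \<and> (\<forall>j\<in>UNIV. \<beta> j = \<alpha> j)} = {\<alpha>}" using \<alpha> by auto
      then show ?thesis unfolding G_def by (simp only:) simp
    qed
    ultimately show "norm (c \<alpha>) \<le> S * (\<Prod>j\<in>UNIV. \<Lambda> j) ^ m" by (simp add: prod_power_distrib)
  qed
qed

section \<open>Total degree, homogeneous parts and restriction to lines\<close>

definition mdeg :: "('d::finite \<Rightarrow> nat) \<Rightarrow> nat" where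
  "mdeg \<alpha> = (\<Sum>j\<in>UNIV. \<alpha> j)"

lemma mdeg_ge: "\<alpha> j \<le> mdeg \<alpha>"
  unfolding mdeg_def by (rule member_le_sum) auto

lemma finite_mdeg [simp]: "finite {\<alpha> :: 'd::finite \<Rightarrow> nat. mdeg \<alpha> = m}"
proof (rule finite_subset)
  show "{\<alpha> :: 'd \<Rightarrow> nat. mdeg \<alpha> = m} \<subseteq> PiE UNIV (\<lambda>_. {..m})"
    using mdeg_ge by (auto simp: PiE_def)
qed (auto intro: finite_PiE)

lemma monomial_scale: "monomial (t *s v) \<alpha> = t ^ mdeg \<alpha> * monomial v \<alpha>"
  by (simp add: monomial_def mdeg_def power_mult_distrib prod.distrib power_sum)

lemma norm_monomial_le:
  assumes "\<And>j. norm (x $ j) \<le> \<rho>"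
  shows "norm (monomial x \<alpha>) \<le> \<rho> ^ mdeg \<alpha>"
  unfolding monomial_def prod_norm[symmetric] mdeg_def power_sum
  by (rule prod_mono) (use assms in \<open>auto simp: norm_power intro: power_mono\<close>)

definition mps_hom :: "('d::finite, 'e::complex_banach) mps \<Rightarrow> nat \<Rightarrow> complex^'d \<Rightarrow> 'e" where
  "mps_hom c m v = (\<Sum>\<alpha> | mdeg \<alpha> = m. monomial v \<alpha> *\<^sub>C c \<alpha>)"

lemma has_sum_dual:
  fixes c :: "'a \<Rightarrow> 'e::complex_banach"
  assumes "\<phi> \<in> dual_ball" "((\<lambda>\<alpha>. b \<alpha> *\<^sub>C c \<alpha>) has_sum s) A"
  shows "((\<lambda>\<alpha>. b \<alpha> *\<^sub>C \<phi> (c \<alpha>)) has_sum \<phi> s) A"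
  using has_sum_bounded_linear[OF dual_ball_bounded_linear[OF assms(1)] assms(2)]
  by (simp add: o_def dual_ball_scaleC[OF assms(1)] scaleC_complex_def)

text \<open>The sum is unconditional, so its terms can be grouped by total degree, and each group is
  finite.\<close>

lemma has_sum_imp_sums_line:
  fixes c :: "('d::finite, complex) mps"
  assumes "((\<lambda>\<alpha>. monomial (t *s v) \<alpha> *\<^sub>C c \<alpha>) has_sum s) UNIV"
  shows "(\<lambda>m. mps_hom c m v * t ^ m) sums s"
proof -
  let ?f = "\<lambda>\<alpha>. monomial (t *s v) \<alpha> *\<^sub>C c \<alpha>"
  have "((\<lambda>(m, \<alpha>). ?f \<alpha>) has_sum s) (Sigma UNIV (\<lambda>m. {\<alpha>. mdeg \<alpha> = m})) \<longleftrightarrow> (?f has_sum s) UNIV"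
    by (rule has_sum_reindex_bij_witness[where j = snd and i = "\<lambda>\<alpha>. (mdeg \<alpha>, \<alpha>)"]) auto
  with assms have "((\<lambda>(m, \<alpha>). ?f \<alpha>) has_sum s) (Sigma UNIV (\<lambda>m. {\<alpha>. mdeg \<alpha> = m}))" by simp
  then have "((\<lambda>m. mps_hom c m v * t ^ m) has_sum s) UNIV"
  proof (rule has_sum_Sigma')
    fix m
    have "((\<lambda>\<alpha>. ?f \<alpha>) has_sum (\<Sum>\<alpha> | mdeg \<alpha> = m. ?f \<alpha>)) {\<alpha>. mdeg \<alpha> = m}"
      by (rule has_sum_finite) simp
    moreover have "(\<Sum>\<alpha> | mdeg \<alpha> = m. ?f \<alpha>) = mps_hom c m v * t ^ m"
      by (simp add: mps_hom_def sum_distrib_left sum_distrib_right scaleC_complex_def monomial_scale mult_ac)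
    ultimately show "((\<lambda>\<alpha>. case (m, \<alpha>) of (m, \<alpha>) \<Rightarrow> ?f \<alpha>) has_sum mps_hom c m v * t ^ m) {\<alpha>. mdeg \<alpha> = m}"
      by simp
  qed
  then show ?thesis by (rule has_sum_imp_sums)
qed

text \<open>The centre \<open>v0\<close> is arbitrary because homogeneous parts of \<open>F\<close>
  can be estimated only near points where the leading form of the germ does not vanish.\<close>

lemma mps_hom_coeff_bound:
  fixes v0 :: "complex^'d::finite"
  assumes \<epsilon>: "\<epsilon> > 0"
  obtains L :: real where "L \<ge> 1"
    "\<And>S (c :: ('d, complex) mps) (\<alpha> :: 'd \<Rightarrow> nat).
       (\<And>v. (\<And>j. norm (v $ j - v0 $ j) < \<epsilon>) \<Longrightarrow> norm (mps_hom c (mdeg \<alpha>) v) \<le> S) \<Longrightarrow>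
       norm (c \<alpha>) \<le> S * L ^ mdeg \<alpha>"
proof -
  obtain L where L: "L \<ge> 1"
    "\<And>m S I c (\<alpha> :: 'd \<Rightarrow> nat). finite I \<Longrightarrow> (\<And>\<beta> j. \<beta> \<in> I \<Longrightarrow> \<beta> j \<le> m) \<Longrightarrow>
       (\<And>v. (\<And>j. norm (v $ j - v0 $ j) < \<epsilon>) \<Longrightarrow> norm (\<Sum>\<beta>\<in>I. monomial v \<beta> * c \<beta>) \<le> S) \<Longrightarrow>
       \<alpha> \<in> I \<Longrightarrow> norm (c \<alpha>) \<le> S * L ^ m"
    using mpolynomial_coeff_bound[OF \<epsilon>, of v0] by blast
  show ?thesis
  proof (rule that[OF L(1)])
    fix S and c :: "('d, complex) mps" and \<alpha> :: "'d \<Rightarrow> nat"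
    assume *: "\<And>v. (\<And>j. norm (v $ j - v0 $ j) < \<epsilon>) \<Longrightarrow> norm (mps_hom c (mdeg \<alpha>) v) \<le> S"
    show "norm (c \<alpha>) \<le> S * L ^ mdeg \<alpha>"
      by (rule L(2)[where I = "{\<beta>. mdeg \<beta> = mdeg \<alpha>}"])
         (use * in \<open>auto simp: mps_hom_def scaleC_complex_def intro: order_trans[OF mdeg_ge]\<close>)
  qed
qed

text \<open>After applying a functional, the difference of the two series vanishes on every short
  segment through 0. Its homogeneous parts therefore vanish near 0, and the coefficient bound with
  \<open>S = 0\<close> finishes.\<close>

lemma has_mps_expansion_unique:
  fixes F G :: "('d::finite, 'e::complex_banach) mps"
  assumes F: "has_mps_expansion g F" and G: "has_mps_expansion g G"
  shows "F = G"
proof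
  fix \<alpha>
  obtain \<rho>1 \<rho>2 where \<rho>12: "\<rho>1 > 0" "\<rho>2 > 0"
    and hs: "\<And>x. x \<in> polydisc (vec \<rho>1) \<Longrightarrow> ((\<lambda>\<alpha>. monomial x \<alpha> *\<^sub>C F \<alpha>) has_sum g x) UNIV"
     "\<And>x. x \<in> polydisc (vec \<rho>2) \<Longrightarrow> ((\<lambda>\<alpha>. monomial x \<alpha> *\<^sub>C G \<alpha>) has_sum g x) UNIV"
    using F G unfolding has_mps_expansion_def by blast
  define \<rho> where "\<rho> = min \<rho>1 \<rho>2"
  have \<rho>: "\<rho> > 0" using \<rho>12 by (simp add: \<rho>_def)
  show "F \<alpha> = G \<alpha>"
  proof (rule eq_dual_ball)
    fix \<phi> :: "'e \<Rightarrow> complex" assume \<phi>: "\<phi> \<in> dual_ball"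
    define c where "c \<beta> = \<phi> (F \<beta>) - \<phi> (G \<beta>)" for \<beta>
    have hc: "((\<lambda>\<alpha>. monomial x \<alpha> *\<^sub>C c \<alpha>) has_sum 0) UNIV" if "x \<in> polydisc (vec \<rho>)" for x
    proof -
      have "x \<in> polydisc (vec \<rho>1)" "x \<in> polydisc (vec \<rho>2)"
        using that by (auto simp: polydisc_def \<rho>_def)
      from has_sum_add[OF has_sum_dual[OF \<phi> hs(1)[OF this(1)]] has_sum_uminusI[OF has_sum_dual[OF \<phi> hs(2)[OF this(2)]]]]
      show ?thesis by (simp add: c_def scaleC_complex_def algebra_simps)
    qed
    have z: "mps_hom c m v = 0" if v: "\<And>j. norm (v $ j - 0 $ j) < \<rho>" for m v
    proof -
      have "(deriv ^^ m) (\<lambda>_. 0) 0 = fact m * mps_hom c m v"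
      proof (rule higher_deriv_power_series_0[of 1])
        fix t :: complex assume "norm t < 1"
        then have "norm t * norm (v $ j) < \<rho>" for j
          using v[of j] mult_left_le_one_le[of "norm (v $ j)" "norm t"] by fastforce
        then have "t *s v \<in> polydisc (vec \<rho>)" by (simp add: polydisc_def norm_mult)
        then show "(\<lambda>m. mps_hom c m v * t ^ m) sums 0"
          by (intro has_sum_imp_sums_line hc)
      qed simp
      then show ?thesis by simp
    qed
    obtain L where "L \<ge> 1" "\<And>S (c :: ('d, complex) mps) (\<alpha> :: 'd \<Rightarrow> nat).
       (\<And>v. (\<And>j. norm (v $ j - 0 $ j) < \<rho>) \<Longrightarrow> norm (mps_hom c (mdeg \<alpha>) v) \<le> S) \<Longrightarrow>
       norm (c \<alpha>) \<le> S * L ^ mdeg \<alpha>"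
      using mps_hom_coeff_bound[OF \<rho>, of 0] by blast
    from this(2)[of c \<alpha> 0] z have "c \<alpha> = 0" by simp
    then show "\<phi> (F \<alpha>) = \<phi> (G \<alpha>)" by (simp add: c_def)
  qed
qed

section \<open>Power series expansions of bounded holomorphic maps\<close>

text \<open>The Schwarz lemma wants a strict bound by 1, so the function is scaled by some
  \<open>B' > B\<close> and \<open>B'\<close> is then lowered to \<open>B\<close>; this also covers
  \<open>B = 0\<close>.\<close>

lemma Schwarz_scaled:
  assumes h: "h holomorphic_on ball 0 r" and r: "r > 0" and h0: "h 0 = 0"
    and le: "\<And>z. norm z < r \<Longrightarrow> norm (h z) \<le> B" and z: "norm z < r"
  shows "norm (h z) \<le> B * norm z / r"
proof -
  have "norm (h z) \<le> B' * norm z / r" if B': "B' > B" for B'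
  proof -
    have "B' > 0" using le[of 0] h0 r B' by simp
    define f where "f w = h (of_real r * w) / of_real B'" for w
    have "norm (f (z / of_real r)) \<le> norm (z / of_real r)"
    proof (rule Schwarz_Lemma)
      show "f holomorphic_on ball 0 1"
        unfolding f_def using \<open>B' > 0\<close> r
        by (intro holomorphic_intros holomorphic_on_compose_gen[OF _ h, unfolded o_def])
           (auto simp: norm_mult)
      show "norm (f w) < 1" if "norm w < 1" for w
      proof -
        have "norm (h (of_real r * w)) \<le> B" using that r by (intro le) (simp add: norm_mult)
        then show ?thesis using B' \<open>B' > 0\<close> by (simp add: f_def norm_divide)
      qed
    qed (use z r in \<open>auto simp: f_def h0 norm_divide\<close>)
    then show ?thesis using r \<open>B' > 0\<close> by (simp add: f_def norm_divide field_simps)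
  qed
  then have "eventually (\<lambda>B'. norm (h z) \<le> B' * norm z / r) (at_right B)"
    by (auto simp: eventually_at_right_field intro!: exI[of _ "B + 1"])
  moreover have "((\<lambda>B'. B' * norm z / r) \<longlongrightarrow> B * norm z / r) (at_right B)"
    using r by (intro tendsto_intros) auto
  ultimately show ?thesis by (intro tendsto_lowerbound) auto
qed

lemma scaleC_0_left [simp]: "0 *\<^sub>C x = (0 :: 'e::complex_banach)"
  using scaleC_of_real[of 0 x] by simp

lemma scaleC_1_left [simp]: "1 *\<^sub>C x = (x :: 'e::complex_banach)"
  using scaleC_of_real[of 1 x] by simp

lemma scaleC_zero_right [simp]: "c *\<^sub>C 0 = (0 :: 'e::complex_banach)"
  using norm_scaleC[of c "0 :: 'e"] by simp

lemma bounded_linear_scaleC_right: "bounded_linear (\<lambda>x :: 'e::complex_banach. c *\<^sub>C x)"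
  by (rule bounded_linear_intro[of _ "norm c"])
     (simp_all add: scaleC_add_right norm_scaleC scaleC_scaleC mult.commute flip: scaleC_of_real)

text \<open>At \<open>z = 0\<close> this is 0 by the convention \<open>inverse 0 = 0\<close>; users
  substitute the true limit there.\<close>

definition quot0 :: "(complex \<Rightarrow> 'e::complex_banach) \<Rightarrow> complex \<Rightarrow> 'e" where
  "quot0 g z = inverse z *\<^sub>C (g z - g 0)"

text \<open>The bounds are uniform over the functionals, so the difference quotients are Cauchy in norm at 0.\<close>

lemma difference_quotient_extends:
  fixes g :: "complex \<Rightarrow> 'e::complex_banach"
  assumes r: "r > 0" and hol: "\<And>\<phi>. \<phi> \<in> dual_ball \<Longrightarrow> (\<lambda>z. \<phi> (g z)) holomorphic_on ball 0 r"
    and le: "\<And>z. norm z < r \<Longrightarrow> norm (g z) \<le> S"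
  obtains e where "\<And>\<phi>. \<phi> \<in> dual_ball \<Longrightarrow> (\<lambda>z. \<phi> (if z = 0 then e else quot0 g z)) holomorphic_on ball 0 r"
    "norm e \<le> 2 / r * S"
    "\<And>z. norm z < r \<Longrightarrow> z \<noteq> 0 \<Longrightarrow> norm (quot0 g z) \<le> 2 / r * S"
    "\<And>z. norm z < r \<Longrightarrow> z \<noteq> 0 \<Longrightarrow> norm (quot0 g z - e) \<le> 4 * S / r\<^sup>2 * norm z"
proof -
  define k where "k \<phi> z = (if z = 0 then deriv (\<lambda>z. \<phi> (g z)) 0 else (\<phi> (g z) - \<phi> (g 0)) / (z - 0))" for \<phi> :: "'e \<Rightarrow> complex" and z
  have q: "\<phi> (quot0 g z) = k \<phi> z" if "\<phi> \<in> dual_ball" "z \<noteq> 0" for \<phi> z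
    using that by (simp add: quot0_def k_def dual_ball_scaleC dual_ball_diff field_simps)
  have khol: "k \<phi> holomorphic_on ball 0 r" if "\<phi> \<in> dual_ball" for \<phi>
    unfolding k_def by (rule pole_lemma_open[OF hol[OF that]]) simp
  have kle: "norm (k \<phi> z) \<le> 2 / r * S" if \<phi>: "\<phi> \<in> dual_ball" and z: "norm z < r" for \<phi> z
  proof (cases "z = 0")
    case True
    have "norm ((deriv ^^ 1) (\<lambda>z. \<phi> (g z)) 0 / fact 1) * r ^ 1 \<le> S"
      by (rule Cauchy_estimate_punctured[OF hol[OF \<phi>] r])
         (use le dual_ball_norm[OF \<phi>] order_trans in blast)
    moreover have "S \<ge> 0" using le[of 0] r by (metis norm_ge_zero norm_zero order_trans)
    ultimately show ?thesis using True r by (simp add: k_def field_simps)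
  next
    case False
    have "norm (\<phi> (g z) - \<phi> (g 0)) \<le> 2 * S * norm z / r"
    proof (rule Schwarz_scaled[where h = "\<lambda>z. \<phi> (g z) - \<phi> (g 0)"])
      show "(\<lambda>z. \<phi> (g z) - \<phi> (g 0)) holomorphic_on ball 0 r"
        by (intro holomorphic_intros hol \<phi>)
      fix w :: complex assume w: "norm w < r"
      have "norm (\<phi> (g w)) \<le> S" "norm (\<phi> (g 0)) \<le> S"
        using le[OF w] le[of 0] r dual_ball_norm[OF \<phi>] order_trans by (blast, metis norm_zero order_trans)
      then show "norm (\<phi> (g w) - \<phi> (g 0)) \<le> 2 * S"
        using norm_triangle_ineq4[of "\<phi> (g w)" "\<phi> (g 0)"] by simp
    qed (use r z in auto)
    then show ?thesis using False by (simp add: k_def norm_divide field_simps)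
  qed
  \<comment> \<open>A second use of the Schwarz lemma: two values bounded by
    \<open>2 / r * S\<close> differ by at most \<open>4 / r * S\<close>. The constant is free of
    \<open>\<phi>\<close>, which turns weak convergence at 0 into convergence in norm.\<close>
  have kdiff: "norm (k \<phi> z - k \<phi> 0) \<le> 4 * S / r\<^sup>2 * norm z" if \<phi>: "\<phi> \<in> dual_ball" and z: "norm z < r" for \<phi> z
  proof -
    have "norm (k \<phi> z - k \<phi> 0) \<le> (4 / r * S) * norm z / r"
    proof (rule Schwarz_scaled[where h = "\<lambda>z. k \<phi> z - k \<phi> 0"])
      show "(\<lambda>z. k \<phi> z - k \<phi> 0) holomorphic_on ball 0 r"
        by (intro holomorphic_intros khol \<phi>)
      fix w :: complex assume "norm w < r"
      then show "norm (k \<phi> w - k \<phi> 0) \<le> 4 / r * S"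
        using kle[OF \<phi>, of w] kle[OF \<phi>, of 0] r norm_triangle_ineq4[of "k \<phi> w" "k \<phi> 0"] by simp
    qed (use r z in auto)
    then show ?thesis by (simp add: power2_eq_square field_simps)
  qed
  \<comment> \<open>Any null sequence in the punctured disc would serve; the shift by 2 keeps every
    term inside.\<close>
  define z where "z n = complex_of_real (r / (real n + 2))" for n :: nat
  have zn: "norm (z n) < r" "z n \<noteq> 0" for n
    using r by (simp_all add: z_def norm_divide field_simps add_pos_nonneg del: of_real_divide)
  have z0: "z \<longlonglongrightarrow> 0"
  proof -
    have "(\<lambda>n. r / (real n + 2)) \<longlonglongrightarrow> 0" by real_asymp
    then have "(\<lambda>n. complex_of_real (r / (real n + 2))) \<longlonglongrightarrow> complex_of_real 0"
      by (rule tendsto_of_real)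
    then show ?thesis unfolding z_def by simp
  qed
  have "Cauchy (\<lambda>n. quot0 g (z n))"
  proof (rule metric_CauchyI)
    fix \<epsilon> :: real assume \<epsilon>: "\<epsilon> > 0"
    have "(\<lambda>n. 4 * S / r\<^sup>2 * norm (z n)) \<longlonglongrightarrow> 4 * S / r\<^sup>2 * norm (0 :: complex)"
      by (intro tendsto_intros z0)
    then have "eventually (\<lambda>n. 4 * S / r\<^sup>2 * norm (z n) < \<epsilon> / 2) sequentially"
      by (rule order_tendstoD) (use \<epsilon> in simp)
    then obtain M where M: "\<And>n. n \<ge> M \<Longrightarrow> 4 * S / r\<^sup>2 * norm (z n) < \<epsilon> / 2"
      by (auto simp: eventually_sequentially)
    show "\<exists>M. \<forall>m\<ge>M. \<forall>n\<ge>M. dist (quot0 g (z m)) (quot0 g (z n)) < \<epsilon>"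
    proof (intro exI allI impI)
      fix m n assume mn: "M \<le> m" "M \<le> n"
      have "norm (quot0 g (z m) - quot0 g (z n)) \<le> 4 * S / r\<^sup>2 * norm (z m) + 4 * S / r\<^sup>2 * norm (z n)"
      proof (rule norm_le_dual_ball)
        fix \<phi> :: "'e \<Rightarrow> complex" assume \<phi>: "\<phi> \<in> dual_ball"
        have "\<phi> (quot0 g (z m) - quot0 g (z n)) = (k \<phi> (z m) - k \<phi> 0) - (k \<phi> (z n) - k \<phi> 0)"
          using zn by (simp add: dual_ball_diff[OF \<phi>] q[OF \<phi>])
        also have "norm \<dots> \<le> norm (k \<phi> (z m) - k \<phi> 0) + norm (k \<phi> (z n) - k \<phi> 0)"
          by (rule norm_triangle_ineq4)
        also have "\<dots> \<le> 4 * S / r\<^sup>2 * norm (z m) + 4 * S / r\<^sup>2 * norm (z n)"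
          by (intro add_mono kdiff \<phi> zn)
        finally show "norm (\<phi> (quot0 g (z m) - quot0 g (z n))) \<le> 4 * S / r\<^sup>2 * norm (z m) + 4 * S / r\<^sup>2 * norm (z n)" .
      qed
      then show "dist (quot0 g (z m)) (quot0 g (z n)) < \<epsilon>"
        using M[OF mn(1)] M[OF mn(2)] by (simp add: dist_norm)
    qed
  qed
  then obtain e where e: "(\<lambda>n. quot0 g (z n)) \<longlonglongrightarrow> e"
    using Cauchy_convergent convergent_def by blast
  have \<phi>e: "\<phi> e = k \<phi> 0" if \<phi>: "\<phi> \<in> dual_ball" for \<phi>
  proof (rule LIMSEQ_unique)
    show "(\<lambda>n. \<phi> (quot0 g (z n))) \<longlonglongrightarrow> \<phi> e"
      using bounded_linear.tendsto[OF dual_ball_bounded_linear[OF \<phi>] e] .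
    have "isCont (k \<phi>) 0"
      using khol[OF \<phi>] r by (intro continuous_on_interior[OF holomorphic_on_imp_continuous_on]) auto
    then have "(\<lambda>n. k \<phi> (z n)) \<longlonglongrightarrow> k \<phi> 0" by (rule isCont_tendsto_compose[OF _ z0])
    then show "(\<lambda>n. \<phi> (quot0 g (z n))) \<longlonglongrightarrow> k \<phi> 0" using zn q[OF \<phi>] by simp
  qed
  show ?thesis
  proof (rule that[of e])
    fix \<phi> :: "'e \<Rightarrow> complex" assume \<phi>: "\<phi> \<in> dual_ball"
    have "(\<lambda>z. \<phi> (if z = 0 then e else quot0 g z)) = k \<phi>"
      using \<phi>e[OF \<phi>] q[OF \<phi>] by auto
    then show "(\<lambda>z. \<phi> (if z = 0 then e else quot0 g z)) holomorphic_on ball 0 r"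
      using khol[OF \<phi>] by simp
  next
    show "norm e \<le> 2 / r * S"
      by (rule norm_le_dual_ball) (simp only: \<phi>e, rule kle, assumption, use r in simp)
  next
    fix z :: complex assume z: "norm z < r" "z \<noteq> 0"
    show "norm (quot0 g z) \<le> 2 / r * S"
      by (rule norm_le_dual_ball) (subst q, assumption, rule z, rule kle, assumption, rule z)
    show "norm (quot0 g z - e) \<le> 4 * S / r\<^sup>2 * norm z"
    proof (rule norm_le_dual_ball)
      fix \<phi> :: "'e \<Rightarrow> complex" assume \<phi>: "\<phi> \<in> dual_ball"
      show "norm (\<phi> (quot0 g z - e)) \<le> 4 * S / r\<^sup>2 * norm z"
        using kdiff[OF \<phi> z(1)] by (simp add: dual_ball_diff[OF \<phi>] q[OF \<phi> z(2)] \<phi>e[OF \<phi>])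
    qed
  qed
qed

section \<open>Division by a coordinate\<close>

definition vupd :: "complex^'d \<Rightarrow> 'd \<Rightarrow> complex \<Rightarrow> complex^'d" where
  "vupd x j z = (\<chi> i. if i = j then z else x $ i)"

lemma vupd_nth [simp]: "vupd x j z $ i = (if i = j then z else x $ i)"
  by (simp add: vupd_def)

lemma vupd_vupd [simp]: "vupd (vupd x j z) j w = vupd x j w"
  by (simp add: vec_eq_iff)

lemma vupd_commute: "i \<noteq> j \<Longrightarrow> vupd (vupd x j z) i w = vupd (vupd x i w) j z"
  by (auto simp: vec_eq_iff)

lemma vupd_same [simp]: "vupd x j (x $ j) = x"
  by (simp add: vec_eq_iff)

lemma vupd_polydisc: "x \<in> polydisc (vec r) \<Longrightarrow> norm z < r \<Longrightarrow> vupd x j z \<in> polydisc (vec r)"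
  by (simp add: polydisc_def)

text \<open>Holomorphy is asked only in each coordinate and only after applying functionals: with
  the explicit bound \<open>S\<close>, this is a form that division by a coordinate
  preserves.\<close>

definition separately_holomorphic :: "real \<Rightarrow> real \<Rightarrow> (complex^'d \<Rightarrow> 'e::complex_banach) \<Rightarrow> bool" where
  "separately_holomorphic r S f \<longleftrightarrow>
     (\<forall>x\<in>polydisc (vec r). norm (f x) \<le> S \<and>
        (\<forall>\<phi>\<in>dual_ball. \<forall>j. (\<lambda>z. \<phi> (f (vupd x j z))) holomorphic_on ball 0 r))"

text \<open>
  The quotient of \<open>f x - f (vupd x j 0)\<close> by \<open>x $ j\<close>, extended across \<open>x $ j = 0\<close>,
  is again of the same kind. Iterating this produces the Taylor coefficients in the space itself,
  without vector-valued integrals.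
\<close>

definition slice_deriv0 :: "(complex \<Rightarrow> 'e::complex_banach) \<Rightarrow> real \<Rightarrow> real \<Rightarrow> 'e" where
  "slice_deriv0 g r S = (SOME e. (\<forall>\<phi>\<in>dual_ball. (\<lambda>z. \<phi> (if z = 0 then e else quot0 g z)) holomorphic_on ball 0 r)
    \<and> norm e \<le> 2 / r * S
    \<and> (\<forall>z. norm z < r \<and> z \<noteq> 0 \<longrightarrow> norm (quot0 g z) \<le> 2 / r * S \<and> norm (quot0 g z - e) \<le> 4 * S / r\<^sup>2 * norm z))"

definition divide_coord :: "real \<Rightarrow> real \<Rightarrow> 'd \<Rightarrow> (complex^'d \<Rightarrow> 'e::complex_banach) \<Rightarrow> complex^'d \<Rightarrow> 'e" where
  "divide_coord r S j f x = (if x $ j = 0 then slice_deriv0 (\<lambda>z. f (vupd x j z)) r S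
     else quot0 (\<lambda>z. f (vupd x j z)) (x $ j))"

lemma slice_deriv0:
  fixes f :: "complex^'d \<Rightarrow> 'e::complex_banach" and j :: 'd
  assumes r: "r > 0" and f: "separately_holomorphic r S f" and x: "x \<in> polydisc (vec r)"
  defines "g \<equiv> \<lambda>z. f (vupd x j z)"
  shows "\<phi> \<in> dual_ball \<Longrightarrow> (\<lambda>z. \<phi> (if z = 0 then slice_deriv0 g r S else quot0 g z)) holomorphic_on ball 0 r"
    and "norm (slice_deriv0 g r S) \<le> 2 / r * S"
    and "norm z < r \<Longrightarrow> z \<noteq> 0 \<Longrightarrow> norm (quot0 g z) \<le> 2 / r * S"
    and "norm z < r \<Longrightarrow> z \<noteq> 0 \<Longrightarrow> norm (quot0 g z - slice_deriv0 g r S) \<le> 4 * S / r\<^sup>2 * norm z"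
proof -
  define P where "P e \<longleftrightarrow> (\<forall>\<phi>\<in>dual_ball. (\<lambda>z. \<phi> (if z = 0 then e else quot0 g z)) holomorphic_on ball 0 r)
    \<and> norm e \<le> 2 / r * S
    \<and> (\<forall>z. norm z < r \<and> z \<noteq> 0 \<longrightarrow> norm (quot0 g z) \<le> 2 / r * S \<and> norm (quot0 g z - e) \<le> 4 * S / r\<^sup>2 * norm z)" for e
  have "\<exists>e. P e"
  proof -
    have hol: "(\<lambda>z. \<phi> (g z)) holomorphic_on ball 0 r" if "\<phi> \<in> dual_ball" for \<phi>
      using f x that unfolding separately_holomorphic_def g_def by blast
    have le: "norm (g z) \<le> S" if "norm z < r" for z
      using f vupd_polydisc[OF x that] unfolding separately_holomorphic_def g_def by blast
    show ?thesis
      by (rule difference_quotient_extends[where g = g, OF r hol le]) (auto simp: P_def)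
  qed
  then have "P (slice_deriv0 g r S)"
    unfolding slice_deriv0_def P_def[symmetric] by (rule someI_ex)
  then show "\<phi> \<in> dual_ball \<Longrightarrow> (\<lambda>z. \<phi> (if z = 0 then slice_deriv0 g r S else quot0 g z)) holomorphic_on ball 0 r"
    "norm (slice_deriv0 g r S) \<le> 2 / r * S"
    "norm z < r \<Longrightarrow> z \<noteq> 0 \<Longrightarrow> norm (quot0 g z) \<le> 2 / r * S"
    "norm z < r \<Longrightarrow> z \<noteq> 0 \<Longrightarrow> norm (quot0 g z - slice_deriv0 g r S) \<le> 4 * S / r\<^sup>2 * norm z"
    unfolding P_def by blast+
qed

lemma divide_coord_split:
  "f x = f (vupd x j 0) + (x $ j) *\<^sub>C divide_coord r S j f x"
proof (cases "x $ j = 0")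
  case True
  then show ?thesis by (metis add_0_right scaleC_0_left vupd_same)
next
  case False
  then show ?thesis by (simp add: divide_coord_def quot0_def scaleC_scaleC)
qed

text \<open>In direction \<open>j\<close> this is the filled difference quotient of a slice. In
  another direction it is plain algebra while \<open>x $ j\<close> is nonzero; on the hyperplane
  \<open>x $ j = 0\<close> the function is a uniform limit of such slices, since the Lipschitz bound
  of \<open>slice_deriv0\<close> has the same constant at all points of the polydisc.\<close>

lemma separately_holomorphic_divide_coord:
  fixes f :: "complex^'d \<Rightarrow> 'e::complex_banach"
  assumes r: "r > 0" and f: "separately_holomorphic r S f"
  shows "separately_holomorphic r (2 / r * S) (divide_coord r S j f)"
  unfolding separately_holomorphic_def
proof (intro ballI conjI allI)
  let ?T = "divide_coord r S j f"
  have off: "(\<lambda>z. \<phi> (?T (vupd x l z))) holomorphic_on ball 0 r"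
    if x: "x \<in> polydisc (vec r)" and \<phi>: "\<phi> \<in> dual_ball" and l: "l \<noteq> j" and xj: "x $ j \<noteq> 0" for x \<phi> l
  proof -
    have "\<phi> (?T (vupd x l z)) = inverse (x $ j) * (\<phi> (f (vupd x l z)) - \<phi> (f (vupd (vupd x j 0) l z)))" for z
      using l xj by (simp add: divide_coord_def quot0_def dual_ball_scaleC[OF \<phi>] dual_ball_diff[OF \<phi>] vupd_commute[of j l])
    moreover have "vupd x j 0 \<in> polydisc (vec r)" using x r by (intro vupd_polydisc) auto
    then have "(\<lambda>z. inverse (x $ j) * (\<phi> (f (vupd x l z)) - \<phi> (f (vupd (vupd x j 0) l z)))) holomorphic_on ball 0 r"
      using f x \<phi> unfolding separately_holomorphic_def by (intro holomorphic_intros) blast+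
    ultimately show ?thesis by simp
  qed
  fix x :: "complex^'d" assume x: "x \<in> polydisc (vec r)"
  have xj: "norm (x $ j) < r" using x by (simp add: polydisc_def)
  show "norm (?T x) \<le> 2 / r * S"
    unfolding divide_coord_def using slice_deriv0(2,3)[OF r f x, where j = j] xj by simp
  fix \<phi> :: "'e \<Rightarrow> complex" and l assume \<phi>: "\<phi> \<in> dual_ball"
  show "(\<lambda>z. \<phi> (?T (vupd x l z))) holomorphic_on ball 0 r"
  proof (cases "l = j")
    case True
    then show ?thesis
      using slice_deriv0(1)[OF r f x \<phi>, where j = j] by (simp add: divide_coord_def cong: if_cong)
  next
    case False
    show ?thesis
    proof (cases "x $ j = 0")
      case xj: True
      define z where "z n = complex_of_real (r / (real n + 2))" for n :: nat
      have zn: "norm (z n) < r" "z n \<noteq> 0" for n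
        using r by (simp_all add: z_def norm_divide field_simps add_pos_nonneg del: of_real_divide)
      have z0: "(\<lambda>n. norm (z n)) \<longlonglongrightarrow> 0"
      proof -
        have "(\<lambda>n. r / (real n + 2)) \<longlonglongrightarrow> 0" by real_asymp
        moreover have "norm (z n) = r / (real n + 2)" for n
          using r by (simp add: z_def norm_divide del: of_real_divide)
        ultimately show ?thesis by simp
      qed
      show ?thesis
      proof (rule holomorphic_uniform_sequence)
        show "(\<lambda>w. \<phi> (?T (vupd (vupd x j (z n)) l w))) holomorphic_on ball 0 r" for n
          by (rule off) (use vupd_polydisc[OF x] zn \<phi> False in auto)
        fix w :: complex assume "w \<in> ball 0 r"
        then obtain d where d: "d > 0" "cball w d \<subseteq> ball 0 r"
          using open_contains_cball open_ball by blast
        have "uniform_limit (cball w d) (\<lambda>n w. \<phi> (?T (vupd (vupd x j (z n)) l w))) (\<lambda>w. \<phi> (?T (vupd x l w))) sequentially"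
        proof (rule uniform_limitI)
          fix \<epsilon> :: real assume \<epsilon>: "\<epsilon> > 0"
          have "(\<lambda>n. 4 * S / r\<^sup>2 * norm (z n)) \<longlonglongrightarrow> 4 * S / r\<^sup>2 * 0"
            by (intro tendsto_intros z0)
          then have "eventually (\<lambda>n. 4 * S / r\<^sup>2 * norm (z n) < \<epsilon>) sequentially"
            by (rule order_tendstoD) (use \<epsilon> in simp)
          then show "\<forall>\<^sub>F n in sequentially. \<forall>u\<in>cball w d. dist (\<phi> (?T (vupd (vupd x j (z n)) l u))) (\<phi> (?T (vupd x l u))) < \<epsilon>"
          proof (rule eventually_mono, intro ballI)
            fix n u assume n: "4 * S / r\<^sup>2 * norm (z n) < \<epsilon>" and u: "u \<in> cball w d"
            have y: "vupd x l u \<in> polydisc (vec r)" using u d x by (intro vupd_polydisc) auto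
            have c: "vupd (vupd x j (z n)) l u = vupd (vupd x l u) j (z n)"
              using vupd_commute[OF False] .
            have "dist (\<phi> (?T (vupd (vupd x j (z n)) l u))) (\<phi> (?T (vupd x l u)))
               = norm (\<phi> (?T (vupd (vupd x l u) j (z n)) - ?T (vupd x l u)))"
              by (simp add: dist_norm dual_ball_diff[OF \<phi>] c)
            also have "\<dots> \<le> norm (?T (vupd (vupd x l u) j (z n)) - ?T (vupd x l u))"
              by (rule dual_ball_norm[OF \<phi>])
            also have "\<dots> \<le> 4 * S / r\<^sup>2 * norm (z n)"
              using slice_deriv0(4)[OF r f y zn, where j = j] False xj zn by (simp add: divide_coord_def)
            finally show "dist (\<phi> (?T (vupd (vupd x j (z n)) l u))) (\<phi> (?T (vupd x l u))) < \<epsilon>"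
              using n by simp
          qed
        qed
        then show "\<exists>d>0. cball w d \<subseteq> ball 0 r \<and> uniform_limit (cball w d) (\<lambda>n w. \<phi> (?T (vupd (vupd x j (z n)) l w))) (\<lambda>w. \<phi> (?T (vupd x l w))) sequentially"
          using d by blast
      qed simp
    qed (rule off[OF x \<phi> False])
  qed
qed

section \<open>Multivariate expansions from iterated division\<close>

lemma summable_on_monomial:
  fixes q :: "'d::finite \<Rightarrow> real"
  assumes "\<And>j. 0 \<le> q j" "\<And>j. q j < 1"
  shows "(\<lambda>\<alpha>. \<Prod>j\<in>UNIV. q j ^ \<alpha> j) summable_on UNIV"
proof -
  have "Infinite_Set_Sum.abs_summable_on (\<lambda>n. q j ^ n) (UNIV :: nat set)" for j
    using assms[of j] by (subst abs_summable_on_nat_iff') (simp add: summable_geometric)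
  then have "Infinite_Set_Sum.abs_summable_on (\<lambda>\<alpha>. \<Prod>j\<in>UNIV. q j ^ \<alpha> j) (PiE UNIV (\<lambda>_. UNIV :: nat set))"
    by (intro abs_summable_on_prod_PiE) auto
  then have "(\<lambda>\<alpha>. norm (\<Prod>j\<in>UNIV. q j ^ \<alpha> j)) summable_on UNIV"
    by (simp add: abs_summable_equivalent[symmetric] PiE_UNIV_domain)
  then show ?thesis by (rule abs_summable_summable)
qed

lemma abs_summable_mps:
  fixes F :: "('d::finite, 'e::complex_banach) mps"
  assumes "\<And>\<alpha>. norm (F \<alpha>) \<le> S * L ^ mdeg \<alpha>" "L \<ge> 0" "\<And>j. L * norm (x $ j) < 1"
  shows "(\<lambda>\<alpha>. norm (monomial x \<alpha> *\<^sub>C F \<alpha>)) summable_on UNIV"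
proof (rule summable_on_comparison_test)
  show "(\<lambda>\<alpha>. S * (\<Prod>j\<in>UNIV. (L * norm (x $ j)) ^ \<alpha> j)) summable_on UNIV"
    using assms(2,3) by (intro summable_on_cmult_right summable_on_monomial) auto
  fix \<alpha> :: "'d \<Rightarrow> nat"
  have "norm (monomial x \<alpha> *\<^sub>C F \<alpha>) \<le> norm (monomial x \<alpha>) * (S * L ^ mdeg \<alpha>)"
    by (simp add: norm_scaleC assms(1) mult_left_mono)
  also have "\<dots> = S * (\<Prod>j\<in>UNIV. (L * norm (x $ j)) ^ \<alpha> j)"
    by (simp add: monomial_def mdeg_def power_sum prod_norm[symmetric] norm_power power_mult_distrib prod.distrib)
  finally show "norm (monomial x \<alpha> *\<^sub>C F \<alpha>) \<le> S * (\<Prod>j\<in>UNIV. (L * norm (x $ j)) ^ \<alpha> j)" .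
qed simp

text \<open>The current bound is passed along because \<open>slice_deriv0\<close> selects its value
  by a condition that mentions it; each division costs a factor \<open>2 / r\<close>.\<close>

primrec divide_coord_iter :: "real \<Rightarrow> real \<Rightarrow> 'd \<Rightarrow> (complex^'d \<Rightarrow> 'e::complex_banach) \<Rightarrow> nat \<Rightarrow> complex^'d \<Rightarrow> 'e" where
  "divide_coord_iter r S j f 0 = f"
| "divide_coord_iter r S j f (Suc i) = divide_coord r (S * (2 / r) ^ i) j (divide_coord_iter r S j f i)"

lemma separately_holomorphic_divide_coord_iter:
  assumes r: "r > 0" and f: "separately_holomorphic r S f"
  shows "separately_holomorphic r (S * (2 / r) ^ i) (divide_coord_iter r S j f i)"
proof (induction i)
  case (Suc i)
  from separately_holomorphic_divide_coord[OF r this, of j]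
  show ?case by (simp add: mult_ac)
qed (use f in simp)

text \<open>Repeated splitting leaves the remainder \<open>(x $ j) ^ n\<close> times the n-th
  quotient, of size at most \<open>S * (2 * norm (x $ j) / r) ^ n\<close>. It tends to 0 on the
  polydisc of half the radius.\<close>

lemma separately_holomorphic_sums:
  fixes f :: "complex^'d \<Rightarrow> 'e::complex_banach"
  assumes r: "r > 0" and f: "separately_holomorphic r S f" and x: "x \<in> polydisc (vec (r / 2))"
  shows "(\<lambda>i. (x $ j) ^ i *\<^sub>C divide_coord_iter r S j f i (vupd x j 0)) sums f x"
proof -
  define g where "g = divide_coord_iter r S j f"
  have g: "g 0 = f" "separately_holomorphic r (S * (2 / r) ^ i) (g i)" for i
    unfolding g_def using separately_holomorphic_divide_coord_iter[OF r f] by simp_all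
  have gs: "g i y = g i (vupd y j 0) + (y $ j) *\<^sub>C g (Suc i) y" for i y
    unfolding g_def divide_coord_iter.simps by (rule divide_coord_split)
  have xr: "x \<in> polydisc (vec r)"
  proof -
    have "norm (x $ i) < r / 2" for i using x by (simp add: polydisc_def)
    then have "norm (x $ i) < r" for i by (rule less_trans) (use r in simp)
    then show ?thesis by (simp add: polydisc_def)
  qed
  have fx: "f x = (\<Sum>i<n. (x $ j) ^ i *\<^sub>C g i (vupd x j 0)) + (x $ j) ^ n *\<^sub>C g n x" for n
  proof (induction n)
    case (Suc n)
    have "(x $ j) ^ n *\<^sub>C g n x = (x $ j) ^ n *\<^sub>C g n (vupd x j 0) + (x $ j) ^ Suc n *\<^sub>C g (Suc n) x"
      by (subst gs) (simp add: scaleC_add_right scaleC_scaleC mult.commute)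
    then show ?case using Suc by simp
  qed (simp add: g(1))
  have "(\<lambda>n. (x $ j) ^ n *\<^sub>C g n x) \<longlonglongrightarrow> 0"
  proof (rule Lim_null_comparison)
    show "\<forall>\<^sub>F n in sequentially. norm ((x $ j) ^ n *\<^sub>C g n x) \<le> S * (2 * norm (x $ j) / r) ^ n"
    proof (intro always_eventually allI)
      fix n
      have "norm (g n x) \<le> S * (2 / r) ^ n"
        using g(2)[of n] xr unfolding separately_holomorphic_def by blast
      then have "norm ((x $ j) ^ n *\<^sub>C g n x) \<le> norm (x $ j) ^ n * (S * (2 / r) ^ n)"
        by (simp add: norm_scaleC norm_power mult_left_mono)
      also have "\<dots> = S * (2 * norm (x $ j) / r) ^ n"
        by (simp add: power_mult_distrib power_divide)
      finally show "norm ((x $ j) ^ n *\<^sub>C g n x) \<le> S * (2 * norm (x $ j) / r) ^ n" .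
    qed
    have "norm (x $ j) < r / 2" using x by (simp add: polydisc_def)
    then have "(\<lambda>n. S * (2 * norm (x $ j) / r) ^ n) \<longlonglongrightarrow> S * 0"
      using r by (intro tendsto_mult tendsto_const LIMSEQ_power_zero) (auto simp: field_simps)
    then show "(\<lambda>n. S * (2 * norm (x $ j) / r) ^ n) \<longlonglongrightarrow> 0" by simp
  qed
  then have "(\<lambda>n. f x - (x $ j) ^ n *\<^sub>C g n x) \<longlonglongrightarrow> f x - 0"
    by (intro tendsto_intros)
  moreover have "f x - (x $ j) ^ n *\<^sub>C g n x = (\<Sum>i<n. (x $ j) ^ i *\<^sub>C g i (vupd x j 0))" for n
    by (subst fx[of n]) simp
  ultimately show ?thesis
    by (simp add: sums_def g_def)
qed

lemma monomial_fun_upd: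
  assumes "\<beta> j = 0"
  shows "monomial x (\<beta>(j := i)) = (x $ j) ^ i * monomial (vupd x j 0) \<beta>"
proof -
  have "monomial x (\<beta>(j := i)) = (x $ j) ^ i * (\<Prod>l\<in>UNIV - {j}. (x $ l) ^ \<beta> l)"
    unfolding monomial_def by (subst prod.remove[of _ j]) (auto intro!: prod.cong)
  moreover have "monomial (vupd x j 0) \<beta> = (\<Prod>l\<in>UNIV - {j}. (x $ l) ^ \<beta> l)"
    unfolding monomial_def using assms by (subst prod.remove[of _ j]) (auto intro!: prod.cong)
  ultimately show ?thesis by simp
qed

lemma mdeg_fun_upd: "\<beta> j = 0 \<Longrightarrow> mdeg (\<beta>(j := i)) = i + mdeg \<beta>"
  unfolding mdeg_def by (subst (1 2) sum.remove[of UNIV j]) auto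

text \<open>
  Induction over the set of coordinates in which \<open>x\<close> is nonzero: expand in one coordinate, then expand
  the coefficient functions on the coordinate hyperplane.
\<close>

lemma separately_holomorphic_expansion_aux:
  fixes f :: "complex^'d \<Rightarrow> 'e::complex_banach"
  assumes r: "r > 0" and "finite A" and "separately_holomorphic r S f"
  shows "\<exists>F. (\<forall>\<alpha>. norm (F \<alpha>) \<le> S * (2 / r) ^ mdeg \<alpha>) \<and> (\<forall>\<alpha>. (\<exists>j\<in>-A. \<alpha> j \<noteq> 0) \<longrightarrow> F \<alpha> = 0) \<and>
     (\<forall>x\<in>polydisc (vec (r / 2)). (\<forall>j\<in>-A. x $ j = 0) \<longrightarrow> ((\<lambda>\<alpha>. monomial x \<alpha> *\<^sub>C F \<alpha>) has_sum f x) UNIV)"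
  using assms(2,3)
proof (induction A arbitrary: f S rule: finite_induct)
  case empty
  define F where "F \<alpha> = (if \<alpha> = (\<lambda>_. 0) then f 0 else 0)" for \<alpha> :: "'d \<Rightarrow> nat"
  have "(0 :: complex^'d) \<in> polydisc (vec r)" using r by (simp add: polydisc_def)
  then have f0: "norm (f 0) \<le> S" using empty unfolding separately_holomorphic_def by blast
  moreover have "S \<ge> 0" using f0 norm_ge_zero order_trans by blast
  ultimately have "norm (F \<alpha>) \<le> S * (2 / r) ^ mdeg \<alpha>" for \<alpha>
    using r by (auto simp: F_def mdeg_def)
  moreover have "F \<alpha> = 0" if "\<exists>j\<in>-{}. \<alpha> j \<noteq> 0" for \<alpha>
    using that by (auto simp: F_def)
  moreover have "((\<lambda>\<alpha>. monomial x \<alpha> *\<^sub>C F \<alpha>) has_sum f x) UNIV" if "\<forall>j\<in>-{}. x $ j = 0" for x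
  proof -
    have "x = 0" using that by (simp add: vec_eq_iff)
    have "((\<lambda>\<alpha>. monomial x \<alpha> *\<^sub>C F \<alpha>) has_sum (\<Sum>\<alpha>\<in>{\<lambda>_. 0}. monomial x \<alpha> *\<^sub>C F \<alpha>)) {\<lambda>_. 0}"
      by (rule has_sum_finite) simp
    also have "?this \<longleftrightarrow> ((\<lambda>\<alpha>. monomial x \<alpha> *\<^sub>C F \<alpha>) has_sum (\<Sum>\<alpha>\<in>{\<lambda>_. 0}. monomial x \<alpha> *\<^sub>C F \<alpha>)) UNIV"
      by (rule has_sum_cong_neutral) (auto simp: F_def)
    finally show ?thesis by (simp add: \<open>x = 0\<close> monomial_def F_def)
  qed
  ultimately show ?case by blast
next
  case (insert j A)
  define g where "g = divide_coord_iter r S j f"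
  have g: "separately_holomorphic r (S * (2 / r) ^ i) (g i)" for i
    unfolding g_def by (rule separately_holomorphic_divide_coord_iter[OF r insert.prems])
  have fs: "(\<lambda>i. (x $ j) ^ i *\<^sub>C g i (vupd x j 0)) sums f x" if "x \<in> polydisc (vec (r / 2))" for x
    unfolding g_def by (rule separately_holomorphic_sums[OF r insert.prems that])
  from choice[OF allI[OF insert.IH[OF g]]] obtain H where Hall:
    "\<forall>i. (\<forall>\<alpha>. norm (H i \<alpha>) \<le> S * (2 / r) ^ i * (2 / r) ^ mdeg \<alpha>) \<and>
      (\<forall>\<alpha>. (\<exists>j\<in>-A. \<alpha> j \<noteq> 0) \<longrightarrow> H i \<alpha> = 0) \<and>
      (\<forall>x\<in>polydisc (vec (r / 2)). (\<forall>j\<in>-A. x $ j = 0) \<longrightarrow> ((\<lambda>\<alpha>. monomial x \<alpha> *\<^sub>C H i \<alpha>) has_sum g i x) UNIV)"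
    by (rule exE)
  then have H: "\<And>i \<alpha>. norm (H i \<alpha>) \<le> S * (2 / r) ^ i * (2 / r) ^ mdeg \<alpha>"
    and H0: "\<And>i \<alpha>. \<exists>j\<in>-A. \<alpha> j \<noteq> 0 \<Longrightarrow> H i \<alpha> = 0"
    and Hsum: "\<And>i x. x \<in> polydisc (vec (r / 2)) \<Longrightarrow> \<forall>j\<in>-A. x $ j = 0 \<Longrightarrow> ((\<lambda>\<alpha>. monomial x \<alpha> *\<^sub>C H i \<alpha>) has_sum g i x) UNIV"
    by blast+
  have H0j: "H i \<beta> = 0" if "0 < \<beta> j" for i \<beta>
    by (rule H0) (use that insert.hyps in auto)
  \<comment> \<open>The exponent at \<open>j\<close> selects the coefficient function of the
    one-coordinate expansion; the other exponents select a coefficient of that function.\<close>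
  define F where "F \<alpha> = H (\<alpha> j) (\<alpha>(j := 0))" for \<alpha>
  have F: "norm (F \<alpha>) \<le> S * (2 / r) ^ mdeg \<alpha>" for \<alpha>
  proof -
    have "mdeg ((\<alpha>(j := 0))(j := \<alpha> j)) = \<alpha> j + mdeg (\<alpha>(j := 0))"
      by (rule mdeg_fun_upd) simp
    then have "mdeg \<alpha> = \<alpha> j + mdeg (\<alpha>(j := 0))" by simp
    then show ?thesis using H[of "\<alpha> j" "\<alpha>(j := 0)"] by (simp add: F_def power_add mult.assoc)
  qed
  moreover have "F \<alpha> = 0" if "\<exists>l\<in>-insert j A. \<alpha> l \<noteq> 0" for \<alpha>
    unfolding F_def by (rule H0) (use that in auto)
  moreover have "((\<lambda>\<alpha>. monomial x \<alpha> *\<^sub>C F \<alpha>) has_sum f x) UNIV"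
    if x: "x \<in> polydisc (vec (r / 2))" and xA: "\<forall>l\<in>-insert j A. x $ l = 0" for x
  proof -
    let ?T = "\<lambda>\<alpha>. monomial x \<alpha> *\<^sub>C F \<alpha>"
    let ?B = "{\<beta> :: 'd \<Rightarrow> nat. \<beta> j = 0}"
    \<comment> \<open>Summability of the multiple series comes first, from the coefficient bound;
      only then may it be summed iteratively to identify its value with \<open>f x\<close>.\<close>
    have "(\<lambda>\<alpha>. norm (?T \<alpha>)) summable_on UNIV"
      by (rule abs_summable_mps[OF F]) (use r x in \<open>auto simp: polydisc_def field_simps\<close>)
    then have "?T summable_on UNIV" by (rule abs_summable_summable)
    then obtain s where s: "(?T has_sum s) UNIV" unfolding summable_on_def by blast
    have "((\<lambda>(i, \<beta>). ?T (\<beta>(j := i))) has_sum s) (Sigma UNIV (\<lambda>_. ?B)) \<longleftrightarrow> (?T has_sum s) UNIV"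
      by (rule has_sum_reindex_bij_witness[where j = "\<lambda>(i, \<beta>). \<beta>(j := i)" and i = "\<lambda>\<alpha>. (\<alpha> j, \<alpha>(j := 0))"])
         (auto simp: fun_upd_idem)
    with s have "((\<lambda>(i, \<beta>). ?T (\<beta>(j := i))) has_sum s) (Sigma UNIV (\<lambda>_. ?B))" by simp
    then have "((\<lambda>i. (x $ j) ^ i *\<^sub>C g i (vupd x j 0)) has_sum s) UNIV"
    proof (rule has_sum_SigmaD)
      fix i
      let ?x = "vupd x j 0"
      have "((\<lambda>\<beta>. monomial ?x \<beta> *\<^sub>C H i \<beta>) has_sum g i ?x) UNIV"
        by (rule Hsum) (use x xA r in \<open>auto intro!: vupd_polydisc\<close>)
      also have "?this \<longleftrightarrow> ((\<lambda>\<beta>. monomial ?x \<beta> *\<^sub>C H i \<beta>) has_sum g i ?x) ?B"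
        by (rule has_sum_cong_neutral) (auto simp: H0j)
      finally have "((\<lambda>\<beta>. (x $ j) ^ i *\<^sub>C (monomial ?x \<beta> *\<^sub>C H i \<beta>)) has_sum (x $ j) ^ i *\<^sub>C g i ?x) ?B"
        by (rule has_sum_bounded_linear[OF bounded_linear_scaleC_right, unfolded o_def])
      also have "?this \<longleftrightarrow> ((\<lambda>\<beta>. case (i, \<beta>) of (i, \<beta>) \<Rightarrow> ?T (\<beta>(j := i))) has_sum (x $ j) ^ i *\<^sub>C g i ?x) ?B"
        by (rule has_sum_cong) (simp add: F_def monomial_fun_upd scaleC_scaleC fun_upd_idem)
      finally show "((\<lambda>\<beta>. case (i, \<beta>) of (i, \<beta>) \<Rightarrow> ?T (\<beta>(j := i))) has_sum (x $ j) ^ i *\<^sub>C g i ?x) ?B" .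
    qed
    then have "(\<lambda>i. (x $ j) ^ i *\<^sub>C g i (vupd x j 0)) sums s" by (rule has_sum_imp_sums)
    with fs[OF x] have "f x = s" by (rule sums_unique2)
    with s show ?thesis by simp
  qed
  ultimately show ?case by blast
qed

text \<open>Serves coordinate slices as well as lines through the origin. In the latter case
  \<open>x = 0\<close>, whence the terms \<open>0 + t *s v\<close> further on.\<close>

lemma holomorphic_map_on_dual_affine:
  assumes f: "holomorphic_map_on f \<Omega>" and \<phi>: "\<phi> \<in> dual_ball"
    and sub: "\<And>z. z \<in> T \<Longrightarrow> x + z *s u \<in> \<Omega>"
  shows "(\<lambda>z. \<phi> (f (x + z *s u))) holomorphic_on T"
  unfolding holomorphic_on_def
proof
  fix z assume z: "z \<in> T"
  obtain D where D: "(f has_derivative D) (at (x + z *s u) within \<Omega>)" "\<And>c v. D (c *s v) = c *\<^sub>C D v"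
    using f sub[OF z] unfolding holomorphic_map_on_def by blast
  have bl: "bounded_linear (\<lambda>h. h *s u)"
    by (intro linear_conv_bounded_linear[THEN iffD1] linearI) (simp_all add: vec_eq_iff algebra_simps)
  have "((\<lambda>z. x + z *s u) has_derivative (\<lambda>h. h *s u)) (at z within T)"
    using has_derivative_add[OF has_derivative_const bounded_linear.has_derivative[OF bl has_derivative_ident]] by simp
  moreover have "(f has_derivative D) (at (x + z *s u) within (\<lambda>z. x + z *s u) ` T)"
    by (rule has_derivative_subset[OF D(1)]) (use sub in auto)
  ultimately have "((\<lambda>z. f (x + z *s u)) has_derivative (\<lambda>h. D (h *s u))) (at z within T)"
    by (rule has_derivative_in_compose)
  then have "((\<lambda>z. \<phi> (f (x + z *s u))) has_derivative (\<lambda>h. \<phi> (D (h *s u)))) (at z within T)"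
    by (rule bounded_linear.has_derivative[OF dual_ball_bounded_linear[OF \<phi>]])
  moreover have "(\<lambda>h. \<phi> (D (h *s u))) = (\<lambda>h. \<phi> (D u) * h)"
    by (simp add: D(2) dual_ball_scaleC[OF \<phi>] mult.commute fun_eq_iff)
  ultimately have "((\<lambda>z. \<phi> (f (x + z *s u))) has_field_derivative \<phi> (D u)) (at z within T)"
    by (simp add: has_field_derivative_def)
  then show "(\<lambda>z. \<phi> (f (x + z *s u))) field_differentiable at z within T"
    by (auto simp: field_differentiable_def)
qed

text \<open>With uniqueness this makes the definite description in \<open>taylor_series\<close>
  proper, so that the congruences in the asymptotic expansion speak about actual
  coefficients.\<close>

lemma bounded_holomorphic_has_mps_expansion:
  fixes f :: "complex^'d \<Rightarrow> 'e::complex_banach"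
  assumes r: "r > 0" and f: "f \<in> bounded_holomorphic (polydisc (vec r))"
  shows "has_mps_expansion f (taylor_series f)"
proof -
  have hol: "holomorphic_map_on f (polydisc (vec r))" and "bounded (f ` polydisc (vec r))"
    using f by (auto simp: bounded_holomorphic_def)
  then obtain S where S: "\<And>x. x \<in> polydisc (vec r) \<Longrightarrow> norm (f x) \<le> S"
    by (auto simp: bounded_iff)
  have "separately_holomorphic r S f"
    unfolding separately_holomorphic_def
  proof (intro ballI conjI allI S)
    fix x :: "complex^'d" and \<phi> :: "'e \<Rightarrow> complex" and j
    assume x: "x \<in> polydisc (vec r)" and \<phi>: "\<phi> \<in> dual_ball"
    have e: "vupd x j z = vupd x j 0 + z *s axis j 1" for z
      by (simp add: vec_eq_iff axis_def)
    have "(\<lambda>z. \<phi> (f (vupd x j 0 + z *s axis j 1))) holomorphic_on ball 0 r"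
      by (rule holomorphic_map_on_dual_affine[OF hol \<phi>])
        (subst e[symmetric], rule vupd_polydisc[OF x], simp)
    then show "(\<lambda>z. \<phi> (f (vupd x j z))) holomorphic_on ball 0 r"
      by (subst e)
  qed
  from separately_holomorphic_expansion_aux[OF r finite[of UNIV] this]
  obtain F where "\<forall>x\<in>polydisc (vec (r / 2)). ((\<lambda>\<alpha>. monomial x \<alpha> *\<^sub>C F \<alpha>) has_sum f x) UNIV"
    by auto
  then have F: "has_mps_expansion f F"
    using r unfolding has_mps_expansion_def by (intro exI[of _ "r / 2"]) auto
  then show ?thesis
    unfolding taylor_series_def by (rule theI[of "has_mps_expansion f"]) (rule has_mps_expansion_unique[OF _ F])
qed

section \<open>The germ on lines through the origin\<close>

lemma is_Arg_mult: "is_Arg z s \<Longrightarrow> is_Arg w t \<Longrightarrow> is_Arg (z * w) (s + t)"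
proof -
  assume "is_Arg z s" "is_Arg w t"
  then have "z * w = (of_real (norm z) * exp (\<i> * of_real s)) * (of_real (norm w) * exp (\<i> * of_real t))"
    unfolding is_Arg_def by presburger
  then show ?thesis
    by (simp add: is_Arg_def norm_mult distrib_left exp_add mult_ac)
qed

lemma is_Arg_power: "is_Arg z s \<Longrightarrow> is_Arg (z ^ n) (real n * s)"
proof (induction n)
  case (Suc n)
  from is_Arg_mult[OF Suc.prems Suc.IH[OF Suc.prems]] show ?case by (simp add: algebra_simps)
qed (simp add: is_Arg_def)

lemma mps_eval_has_sum:
  fixes p :: "('d::finite, complex) mps"
  assumes "mps_abs_conv_on p \<Omega>" "x \<in> \<Omega>"
  shows "((\<lambda>\<alpha>. monomial x \<alpha> *\<^sub>C p \<alpha>) has_sum mps_eval p x) UNIV"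
  unfolding mps_eval_def
  by (rule has_sum_infsum, rule abs_summable_summable) (use assms in \<open>simp add: mps_abs_conv_on_def\<close>)

lemma mps_eval_line_sums:
  assumes "mps_abs_conv_on p (polydisc (vec \<rho>))" "t *s v \<in> polydisc (vec \<rho>)"
  shows "(\<lambda>m. mps_hom p m v * t ^ m) sums mps_eval p (t *s v)"
  by (rule has_sum_imp_sums_line[OF mps_eval_has_sum[OF assms]])

lemma mdeg_eq_0_iff: "mdeg \<alpha> = 0 \<longleftrightarrow> \<alpha> = (\<lambda>_. 0)"
  by (auto simp: mdeg_def)

lemma mps_eval_bounded:
  fixes p :: "('d::finite, complex) mps"
  assumes conv: "mps_abs_conv_on p (polydisc (vec r))" and \<rho>: "0 < \<rho>" "\<rho> < r"
  obtains S where "S > 0" "\<And>x. x \<in> polydisc (vec \<rho>) \<Longrightarrow> norm (mps_eval p x) \<le> S"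
proof -
  let ?v = "\<chi> j. complex_of_real \<rho>"
  let ?g = "\<lambda>\<alpha>. norm (monomial ?v \<alpha> *\<^sub>C p \<alpha>)"
  have g: "?g summable_on UNIV"
    using conv \<rho> unfolding mps_abs_conv_on_def by (auto simp: polydisc_def)
  have "norm (mps_eval p x) \<le> infsum ?g UNIV" if x: "x \<in> polydisc (vec \<rho>)" for x
  proof -
    have xr: "x \<in> polydisc (vec r)" using x \<rho> by (auto simp: polydisc_def intro: less_trans)
    have sx: "(\<lambda>\<alpha>. norm (monomial x \<alpha> *\<^sub>C p \<alpha>)) summable_on UNIV"
      using conv xr by (simp add: mps_abs_conv_on_def)
    have "norm (mps_eval p x) \<le> (\<Sum>\<^sub>\<infinity>\<alpha>. norm (monomial x \<alpha> *\<^sub>C p \<alpha>))"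
      unfolding mps_eval_def by (rule norm_infsum_bound[OF sx])
    also have "\<dots> \<le> infsum ?g UNIV"
    proof (rule infsum_mono[OF sx g])
      fix \<alpha>
      have "norm (monomial x \<alpha>) \<le> \<rho> ^ mdeg \<alpha>"
        by (rule norm_monomial_le) (use x in \<open>auto simp: polydisc_def intro: less_imp_le\<close>)
      also have "\<rho> ^ mdeg \<alpha> = norm (monomial ?v \<alpha>)"
        using \<rho> by (simp add: monomial_def mdeg_def power_sum prod_norm[symmetric] norm_power)
      finally show "norm (monomial x \<alpha> *\<^sub>C p \<alpha>) \<le> ?g \<alpha>"
        by (simp add: norm_scaleC mult_right_mono)
    qed
    finally show ?thesis .
  qed
  moreover have "infsum ?g UNIV \<ge> 0" by (rule infsum_nonneg) simp
  ultimately show ?thesis by (intro that[of "infsum ?g UNIV + 1"]) force+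
qed

section \<open>Order and leading form of the germ\<close>

definition mps_order :: "('d::finite, complex) mps \<Rightarrow> nat" where
  "mps_order p = (LEAST m. \<exists>\<alpha>. mdeg \<alpha> = m \<and> p \<alpha> \<noteq> 0)"

lemma mps_order_below: "mdeg \<alpha> < mps_order p \<Longrightarrow> p \<alpha> = 0"
  unfolding mps_order_def using not_less_Least by blast

lemma mps_order_attained:
  assumes "p \<noteq> (\<lambda>_. 0)"
  obtains \<alpha> where "mdeg \<alpha> = mps_order p" "p \<alpha> \<noteq> 0"
proof -
  have "\<exists>m \<alpha>. mdeg \<alpha> = m \<and> p \<alpha> \<noteq> 0" using assms by auto
  then have "\<exists>\<alpha>. mdeg \<alpha> = mps_order p \<and> p \<alpha> \<noteq> 0"
    unfolding mps_order_def by (rule LeastI_ex)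
  then show ?thesis using that by blast
qed

lemma mps_order_pos:
  fixes p :: "('d::finite, complex) mps"
  assumes r: "r > 0" and conv: "mps_abs_conv_on p (polydisc (vec r))"
    and p: "p \<noteq> (\<lambda>_. 0)" and p0: "mps_eval p 0 = 0"
  shows "mps_order p \<ge> 1"
proof (rule ccontr)
  assume "\<not> mps_order p \<ge> 1"
  then have "mps_order p = 0" by simp
  then obtain \<alpha> where "mdeg \<alpha> = 0" "p \<alpha> \<noteq> 0" using mps_order_attained[OF p] by metis
  then have p00: "p (\<lambda>_. 0) \<noteq> 0" using mdeg_eq_0_iff[of \<alpha>] by simp
  have "(\<lambda>m. mps_hom p m 0 * 0 ^ m) sums mps_eval p (0 *s 0)"
    by (rule mps_eval_line_sums[OF conv]) (use r in \<open>simp add: polydisc_def\<close>)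
  then have "mps_hom p 0 0 = 0"
    using powser_sums_zero[of "\<lambda>m. mps_hom p m 0"] sums_unique2 p0 by fastforce
  moreover have "mps_hom p 0 0 = p (\<lambda>_. 0)"
    by (simp add: mps_hom_def mdeg_eq_0_iff monomial_def scaleC_complex_def)
  ultimately show False using p00 by simp
qed

text \<open>A form vanishing near a point has zero coefficients, by the coefficient bound with
  \<open>S = 0\<close>. Searching near the point with all coordinates 1 keeps every coordinate
  nonzero and of modulus below 2.\<close>

lemma mps_hom_order_nonzero:
  fixes p :: "('d::finite, complex) mps"
  assumes p: "p \<noteq> (\<lambda>_. 0)"
  obtains v0 :: "complex^'d" and \<epsilon> q0 :: real where "\<epsilon> > 0" "q0 > 0"
    "\<forall>v. (\<forall>j. norm (v $ j - v0 $ j) < \<epsilon>) \<longrightarrow>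
       q0 \<le> norm (mps_hom p (mps_order p) v) \<and> (\<forall>j. v $ j \<noteq> 0 \<and> norm (v $ j) < 2)"
proof -
  let ?Q = "mps_hom p (mps_order p)"
  let ?one = "\<chi> j. 1 :: complex^'d"
  obtain \<alpha> where \<alpha>: "mdeg \<alpha> = mps_order p" "p \<alpha> \<noteq> 0" using mps_order_attained[OF p] .
  have "\<exists>v. (\<forall>j. norm (v $ j - ?one $ j) < 1 / 2) \<and> ?Q v \<noteq> 0"
  proof (rule ccontr)
    assume "\<not> ?thesis"
    then have z: "norm (mps_hom p (mdeg \<alpha>) v) \<le> 0" if "\<And>j. norm (v $ j - ?one $ j) < 1 / 2" for v
      using that \<alpha>(1) by auto
    obtain L where L: "L \<ge> 1" "\<And>S (c :: ('d, complex) mps) (\<alpha> :: 'd \<Rightarrow> nat).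
       (\<And>v. (\<And>j. norm (v $ j - ?one $ j) < 1 / 2) \<Longrightarrow> norm (mps_hom c (mdeg \<alpha>) v) \<le> S) \<Longrightarrow>
       norm (c \<alpha>) \<le> S * L ^ mdeg \<alpha>"
      by (rule mps_hom_coeff_bound[of "1 / 2" ?one]) (simp, blast)
    have "norm (p \<alpha>) \<le> 0 * L ^ mdeg \<alpha>" by (rule L(2)) (rule z)
    then show False using \<alpha>(2) by simp
  qed
  then obtain v0 where v0: "\<And>j. norm (v0 $ j - 1) < 1 / 2" "?Q v0 \<noteq> 0" by auto
  define U where "U = {v. norm (?Q v0) / 2 < norm (?Q v)} \<inter> (\<Inter>j. {v. norm (v $ j - 1) < 1 / 2})"
  have "continuous_on UNIV (?Q)"
    unfolding mps_hom_def monomial_def scaleC_complex_def by (intro continuous_intros)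
  then have "open U"
    unfolding U_def
    by (intro open_Int open_INT ballI open_Collect_less continuous_intros) auto
  moreover have "v0 \<in> U" using v0 by (simp add: U_def)
  ultimately obtain e where e: "e > 0" "\<And>v. dist v v0 < e \<Longrightarrow> v \<in> U"
    unfolding open_dist by blast
  \<comment> \<open>The Euclidean norm is at most the sum of the coordinate moduli, so this polydisc
    fits into the ball of radius \<open>e\<close>.\<close>
  define \<epsilon> where "\<epsilon> = e / real CARD('d)"
  show ?thesis
  proof (rule that[of \<epsilon> "norm (?Q v0) / 2" v0])
    show "\<epsilon> > 0" using e by (simp add: \<epsilon>_def)
    show "norm (?Q v0) / 2 > 0" using v0 by simp
    show "\<forall>v. (\<forall>j. norm (v $ j - v0 $ j) < \<epsilon>) \<longrightarrow>
       norm (?Q v0) / 2 \<le> norm (?Q v) \<and> (\<forall>j. v $ j \<noteq> 0 \<and> norm (v $ j) < 2)"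
    proof (intro allI impI conjI)
      fix v assume v: "\<forall>j. norm (v $ j - v0 $ j) < \<epsilon>"
      have "norm (v - v0) \<le> (\<Sum>j\<in>UNIV. norm ((v - v0) $ j))"
        unfolding norm_vec_def by (rule L2_set_le_sum) simp
      also have "\<dots> < (\<Sum>j\<in>(UNIV :: 'd set). \<epsilon>)"
        by (rule sum_strict_mono) (use v in auto)
      also have "\<dots> = e" by (simp add: \<epsilon>_def)
      finally have "v \<in> U" using e(2) by (simp add: dist_norm)
      then have a: "norm (?Q v0) / 2 < norm (?Q v)" "\<And>j. norm (v $ j - 1) < 1 / 2" by (auto simp: U_def)
      have "v $ j \<noteq> 0 \<and> norm (v $ j) < 2" for j
      proof
        show "v $ j \<noteq> 0" using a(2)[of j] by auto
        show "norm (v $ j) < 2" using a(2)[of j] norm_triangle_sub[of "v $ j" 1] by simp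
    qed
    then show "norm (?Q v0) / 2 \<le> norm (?Q v)" "v $ j \<noteq> 0" "norm (v $ j) < 2" for j using a by auto
    qed
  qed
qed

lemma scale_mem_polydisc:
  assumes "\<And>j. norm (v $ j) < 2" "norm t < r / 2"
  shows "t *s v \<in> polydisc (vec r)"
proof -
  have "norm t * norm (v $ j) < r" for j
  proof -
    have "norm t * norm (v $ j) \<le> norm t * 2"
      using assms(1)[of j] by (intro mult_left_mono) auto
    then show ?thesis using assms(2) by simp
  qed
  then show ?thesis by (simp add: polydisc_def norm_mult)
qed

text \<open>On lines with \<open>norm (v $ j) < 2\<close> the germ has the common bound
  \<open>S\<close>, and the leading coefficient is at least \<open>q0\<close> in modulus; hence
  \<open>\<tau>\<close> can be chosen before \<open>v\<close>.\<close>

lemma mps_eval_line_asymptotic: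
  fixes p :: "('d::finite, complex) mps"
  assumes r: "r > 0" and conv: "mps_abs_conv_on p (polydisc (vec r))" and q0: "q0 > 0" and \<epsilon>: "\<epsilon> > 0"
  obtains \<tau> where "\<tau> > 0" "\<And>v t. q0 \<le> norm (mps_hom p (mps_order p) v) \<Longrightarrow> (\<And>j. norm (v $ j) < 2) \<Longrightarrow>
      t \<noteq> 0 \<Longrightarrow> norm t < \<tau> \<Longrightarrow>
      norm (mps_eval p (t *s v) / (t ^ mps_order p * mps_hom p (mps_order p) v) - 1) \<le> \<epsilon>"
proof -
  let ?l = "mps_order p" and ?Q = "mps_hom p (mps_order p)"
  obtain S where S: "S > 0" "\<And>x. x \<in> polydisc (vec (r / 2)) \<Longrightarrow> norm (mps_eval p x) \<le> S"
    using mps_eval_bounded[OF conv, of "r / 2"] r by auto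
  define T where "T = r / 4"
  have T: "T > 0" using r by (simp add: T_def)
  \<comment> \<open>The first entry admits the Taylor remainder bound; the second solves
    \<open>2 * S * \<tau> / (T ^ (?l + 1) * q0) = \<epsilon>\<close>.\<close>
  define \<tau> where "\<tau> = min (T / 2) (\<epsilon> * q0 * T ^ (?l + 1) / (2 * S))"
  show ?thesis
  proof (rule that[of \<tau>])
    show "\<tau> > 0" using T S \<epsilon> q0 by (simp add: \<tau>_def)
    fix v and t :: complex assume v: "q0 \<le> norm (?Q v)" "\<And>j. norm (v $ j) < 2" and t: "t \<noteq> 0" "norm t < \<tau>"
    define G where "G t = mps_eval p (t *s v)" for t
    have mem: "t *s v \<in> polydisc (vec (r / 2))" if "norm t < T" for t
      by (rule scale_mem_polydisc) (use v that in \<open>auto simp: T_def\<close>)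
    have mem': "t *s v \<in> polydisc (vec r)" if "norm t < T" for t
      by (rule scale_mem_polydisc) (use v that r in \<open>auto simp: T_def\<close>)
    have Gsum: "(\<lambda>m. mps_hom p m v * t ^ m) sums G t" if "norm t < T" for t
      unfolding G_def by (rule mps_eval_line_sums[OF conv mem'[OF that]])
    have Ghol: "G holomorphic_on ball 0 T"
      by (rule power_series_holomorphic[where a = "\<lambda>m. mps_hom p m v"]) (use Gsum in simp)
    have "norm (G t - (\<Sum>m<?l + 1. (deriv ^^ m) G 0 / fact m * t ^ m)) \<le> 2 * S * (norm t / T) ^ (?l + 1)"
      by (rule taylor_remainder_bound[OF Ghol T]) (use S(2) mem t in \<open>auto simp: G_def \<tau>_def\<close>)
    also have "(\<Sum>m<?l + 1. (deriv ^^ m) G 0 / fact m * t ^ m) = (\<Sum>m<?l + 1. mps_hom p m v * t ^ m)"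
      by (simp add: higher_deriv_power_series_0[OF T Gsum])
    also have "\<dots> = ?Q v * t ^ ?l"
      by (simp add: mps_hom_def mps_order_below)
    finally have "norm (G t - t ^ ?l * ?Q v) \<le> 2 * S * (norm t / T) ^ (?l + 1)" by (simp add: mult.commute)
    moreover have nz: "t ^ ?l * ?Q v \<noteq> 0" using t v q0 by auto
    have "G t / (t ^ ?l * ?Q v) - 1 = (G t - t ^ ?l * ?Q v) / (t ^ ?l * ?Q v)"
      using divide_self[OF nz] by (simp only: diff_divide_distrib)
    ultimately have "norm (G t / (t ^ ?l * ?Q v) - 1) \<le> 2 * S * (norm t / T) ^ (?l + 1) / norm (t ^ ?l * ?Q v)"
      by (simp only: norm_divide) (rule divide_right_mono, auto)
    also have "\<dots> \<le> 2 * S * (norm t / T) ^ (?l + 1) / (norm t ^ ?l * q0)"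
      using v(1) q0 t S T nz unfolding norm_mult norm_power by (intro divide_left_mono mult_left_mono mult_pos_pos) auto
    also have "\<dots> = 2 * S * norm t / (T ^ (?l + 1) * q0)"
      using t by (simp add: power_divide)
    also have "\<dots> \<le> \<epsilon>"
      using t S T q0 by (simp add: \<tau>_def field_simps)
    finally show "norm (mps_eval p (t *s v) / (t ^ ?l * ?Q v) - 1) \<le> \<epsilon>" by (simp add: G_def)
  qed
qed

lemma mps_mult_order:
  assumes "\<And>\<beta>. mdeg \<beta> < M \<Longrightarrow> q \<beta> = 0" "mdeg \<alpha> < M"
  shows "mps_mult q H \<alpha> = 0"
  unfolding mps_mult_def
proof (rule sum.neutral, safe)
  fix \<beta> :: "'a \<Rightarrow> nat" assume "\<beta> \<le> \<alpha>"
  then have "mdeg \<beta> \<le> mdeg \<alpha>" unfolding mdeg_def by (intro sum_mono) (simp add: le_fun_def)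
  then show "q \<beta> *\<^sub>C H (\<lambda>j. \<alpha> j - \<beta> j) = 0" using assms by simp
qed

lemma mps_power_order: "mdeg \<alpha> < mps_order p * n \<Longrightarrow> mps_power p n \<alpha> = 0"
proof (induction n arbitrary: \<alpha>)
  case (Suc n)
  show ?case
    unfolding mps_power.simps mps_mult_def
  proof (rule sum.neutral, safe)
    fix \<beta> :: "'a \<Rightarrow> nat" assume "\<beta> \<le> \<alpha>"
    then have "mdeg \<alpha> = mdeg \<beta> + mdeg (\<lambda>j. \<alpha> j - \<beta> j)"
      unfolding mdeg_def sum.distrib[symmetric] by (intro sum.cong) (auto simp: le_fun_def)
    then have "mdeg \<beta> < mps_order p \<or> mdeg (\<lambda>j. \<alpha> j - \<beta> j) < mps_order p * n"
      using Suc.prems by auto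
    then show "p \<beta> *\<^sub>C mps_power p n (\<lambda>j. \<alpha> j - \<beta> j) = 0"
      using Suc.IH mps_order_below[of \<beta> p] by auto
  qed
qed simp

text \<open>This is how the coefficients of \<open>F\<close> are read off from the approximating
  functions: multiples of the n-th power of the germ start in degree \<open>mps_order p * n\<close>
  or later.\<close>

lemma mps_cong_coeff_eq:
  assumes "mps_cong p n F G" "mdeg \<alpha> < mps_order p * n"
  shows "F \<alpha> = G \<alpha>"
proof -
  obtain H where H: "(\<lambda>\<alpha>. F \<alpha> - G \<alpha>) = mps_mult (mps_power p n) H"
    using assms(1) unfolding mps_cong_def by blast
  have "F \<alpha> - G \<alpha> = 0"
    using fun_cong[OF H, of \<alpha>] mps_mult_order[OF mps_power_order assms(2)] by simp
  then show ?thesis by simp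
qed

section \<open>Uniformity of the summability data over all directions\<close>

definition P_region :: "('d::finite, complex) mps \<Rightarrow> real \<Rightarrow> real \<Rightarrow> real \<Rightarrow> (complex^'d) set" where
  "P_region p H r \<theta> = {x \<in> polydisc (vec r). mps_eval p x \<noteq> 0 \<and> (\<forall>j. x $ j \<noteq> 0) \<and>
     (\<exists>\<psi>. is_Arg (mps_eval p x) \<psi> \<and> \<bar>\<psi> - \<theta>\<bar> < H)}"

text \<open>
  A single \<open>K\<close> serves for all constants in the Gevrey bounds, which makes the condition
  monotone in \<open>\<delta>\<close>, \<open>r\<close> and \<open>K\<close>.
\<close>

definition P_gevrey_at :: "('d::finite, complex) mps \<Rightarrow> real \<Rightarrow> ('d, 'e::complex_banach) mps \<Rightarrow>
    real \<Rightarrow> real \<Rightarrow> real \<Rightarrow> real \<Rightarrow> (complex^'d \<Rightarrow> 'e) \<Rightarrow> (nat \<Rightarrow> complex^'d \<Rightarrow> 'e) \<Rightarrow> bool" where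
  "P_gevrey_at p k F \<delta> r K \<theta> f fn \<longleftrightarrow>
     holomorphic_map_on f (P_region p (pi / (2 * k) + \<delta>) r \<theta>) \<and>
     (\<forall>n. fn n \<in> bounded_holomorphic (polydisc (vec r)) \<and> mps_cong p n (taylor_series (fn n)) F \<and>
        (\<forall>x\<in>polydisc (vec r). norm (fn n x) \<le> K * K ^ n * fact n powr (1 / k))) \<and>
     (\<forall>N. \<forall>x\<in>P_region p (pi / (2 * k) + \<delta>) r \<theta>.
        norm (f x - fn N x) \<le> K * K ^ N * fact N powr (1 / k) * norm (mps_eval p x) ^ N)"

lemma holomorphic_map_on_subset:
  "holomorphic_map_on f \<Omega> \<Longrightarrow> \<Omega>' \<subseteq> \<Omega> \<Longrightarrow> holomorphic_map_on f \<Omega>'"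
  unfolding holomorphic_map_on_def
proof
  fix x assume f: "\<forall>x\<in>\<Omega>. \<exists>D. (f has_derivative D) (at x within \<Omega>) \<and> (\<forall>c v. D (c *s v) = c *\<^sub>C D v)"
    and sub: "\<Omega>' \<subseteq> \<Omega>" and "x \<in> \<Omega>'"
  then obtain D where D: "(f has_derivative D) (at x within \<Omega>)" "\<forall>c v. D (c *s v) = c *\<^sub>C D v"
    by blast
  from has_derivative_subset[OF D(1) sub] D(2)
  show "\<exists>D. (f has_derivative D) (at x within \<Omega>') \<and> (\<forall>c v. D (c *s v) = c *\<^sub>C D v)" by blast
qed

lemma bounded_holomorphic_subset:
  "f \<in> bounded_holomorphic \<Omega> \<Longrightarrow> \<Omega>' \<subseteq> \<Omega> \<Longrightarrow> f \<in> bounded_holomorphic \<Omega>'"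
  unfolding bounded_holomorphic_def
  using holomorphic_map_on_subset[of f \<Omega> \<Omega>'] bounded_subset[OF _ image_mono, of f \<Omega> \<Omega>'] by blast

lemma polydisc_mono: "r' \<le> r \<Longrightarrow> polydisc (vec r') \<subseteq> polydisc (vec r)"
  unfolding polydisc_def by (rule Collect_mono) (simp, meson less_le_trans)

lemma P_gevrey_at_mono:
  assumes G: "P_gevrey_at p k F \<delta> r K \<theta> f fn" and le: "\<delta>' \<le> \<delta>" "r' \<le> r" "0 \<le> K" "K \<le> K'"
  shows "P_gevrey_at p k F \<delta>' r' K' \<theta> f fn"
proof -
  have sub: "P_region p (pi / (2 * k) + \<delta>') r' \<theta> \<subseteq> P_region p (pi / (2 * k) + \<delta>) r \<theta>"
    using polydisc_mono[OF le(2)] le(1) by (fastforce simp: P_region_def)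
  have K: "K * K ^ n * fact n powr (1 / k) \<le> K' * K' ^ n * fact n powr (1 / k)" for n
    using le by (intro mult_right_mono mult_mono power_mono) auto
  show ?thesis
    unfolding P_gevrey_at_def
  proof (intro conjI allI ballI)
    show "holomorphic_map_on f (P_region p (pi / (2 * k) + \<delta>') r' \<theta>)"
      using G sub unfolding P_gevrey_at_def by (blast intro: holomorphic_map_on_subset)
    fix n
    show "fn n \<in> bounded_holomorphic (polydisc (vec r'))"
      using G polydisc_mono[OF le(2)] unfolding P_gevrey_at_def by (blast intro: bounded_holomorphic_subset)
    show "mps_cong p n (taylor_series (fn n)) F" using G unfolding P_gevrey_at_def by blast
    show "norm (fn n x) \<le> K' * K' ^ n * fact n powr (1 / k)" if "x \<in> polydisc (vec r')" for x
      using G polydisc_mono[OF le(2)] that K[of n] unfolding P_gevrey_at_def by (meson order_trans subset_iff)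
    show "norm (f x - fn n x) \<le> K' * K' ^ n * fact n powr (1 / k) * norm (mps_eval p x) ^ n"
      if "x \<in> P_region p (pi / (2 * k) + \<delta>') r' \<theta>" for x
    proof -
      have "norm (f x - fn n x) \<le> K * K ^ n * fact n powr (1 / k) * norm (mps_eval p x) ^ n"
        using G that sub unfolding P_gevrey_at_def by blast
      also have "\<dots> \<le> K' * K' ^ n * fact n powr (1 / k) * norm (mps_eval p x) ^ n"
        by (rule mult_right_mono[OF K]) simp
      finally show ?thesis .
    qed
  qed
qed

text \<open>The opening exceeds \<open>pi / k\<close> strictly, so one sum also serves all nearby
  directions, on somewhat smaller sectors.\<close>

lemma P_summable_locally_uniform:
  fixes p :: "('d::finite, complex) mps" and F :: "('d, 'e::complex_banach) mps"
  assumes k: "k > 0" and sum: "P_summable_in_direction p k F \<theta>"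
  obtains \<delta> r K where "\<delta> > 0" "r > 0" "K > 0"
    "\<And>\<theta>'. \<bar>\<theta>' - \<theta>\<bar> < \<delta> \<Longrightarrow> \<exists>f fn. P_gevrey_at p k F \<delta> r K \<theta>' f fn"
proof -
  obtain a b R f where data: "P_sector_data p a b R" and mid: "(a + b) / 2 = \<theta>" and op: "b - a > pi / k"
    and hol: "holomorphic_map_on f (P_sector p a b R)" and asy: "P_gevrey_asymptotic p (1 / k) a b R f F"
    using sum unfolding P_summable_in_direction_def by (elim exE conjE) (rule that)
  from asy obtain r fn K A where r: "r > 0" and K: "K > 0" and A: "A > 0"
    and fn0: "\<forall>n. fn n \<in> bounded_holomorphic (polydisc (vec r)) \<and>
             mps_cong p n (taylor_series (fn n)) F \<and>
             (\<forall>x\<in>polydisc (vec r). norm (fn n x) \<le> K * A ^ n * fact n powr (1 / k))"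
    and sub: "\<forall>a' b' R'. a < a' \<and> a' < b' \<and> b' < b \<and> (\<forall>j. 0 < R' $ j \<and> R' $ j < R $ j) \<longrightarrow>
           (\<exists>C>0. \<exists>B>0. \<forall>N. \<forall>x \<in> P_sector p a' b' R' \<inter> polydisc (vec r).
              norm (f x - fn N x) \<le> C * B ^ N * fact N powr (1 / k) * norm (mps_eval p x) ^ N)"
    unfolding P_gevrey_asymptotic_def by (elim exE conjE) (rule that)
  have fn: "fn n \<in> bounded_holomorphic (polydisc (vec r))" "mps_cong p n (taylor_series (fn n)) F"
      "x \<in> polydisc (vec r) \<Longrightarrow> norm (fn n x) \<le> K * A ^ n * fact n powr (1 / k)" for n x
    using fn0 by blast+
  define h where "h = pi / (2 * k)"
  \<comment> \<open>\<open>H\<close> lies strictly inside the given half-opening, as the Gevrey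
    bounds hold only on proper subsectors. Since \<open>H = h + 2 * \<delta>\<close>, one
    \<open>\<delta>\<close> pays for moving the direction and the other remains as excess over
    \<open>h\<close>.\<close>
  define H where "H = ((b - a) / 2 + h) / 2"
  define \<delta> where "\<delta> = (H - h) / 2"
  have hH: "0 < h" "h < H" "H < (b - a) / 2" using op k by (simp_all add: H_def h_def field_simps)
  have \<delta>: "\<delta> > 0" using hH by (simp add: \<delta>_def)
  define R' where "R' = (\<chi> j. R $ j / 2)"
  have R0: "0 < R $ j" for j using data by (simp add: P_sector_data_def)
  have "a < \<theta> - H \<and> \<theta> - H < \<theta> + H \<and> \<theta> + H < b \<and> (\<forall>j. 0 < R' $ j \<and> R' $ j < R $ j)"
    using hH mid R0 by (auto simp: R'_def field_simps)
  from sub[rule_format, OF this] obtain C B where C: "C > 0" and B: "B > 0"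
    and CB0: "\<forall>N. \<forall>x \<in> P_sector p (\<theta> - H) (\<theta> + H) R' \<inter> polydisc (vec r).
       norm (f x - fn N x) \<le> C * B ^ N * fact N powr (1 / k) * norm (mps_eval p x) ^ N"
    by (elim exE conjE) (rule that)
  have CB: "norm (f x - fn N x) \<le> C * B ^ N * fact N powr (1 / k) * norm (mps_eval p x) ^ N"
    if "x \<in> P_sector p (\<theta> - H) (\<theta> + H) R' \<inter> polydisc (vec r)" for N x
    using CB0 that by blast
  define r' where "r' = Min (insert r (range (\<lambda>j. R' $ j)))"
  have r': "r' > 0" "r' \<le> r" "r' \<le> R' $ j" for j
  proof -
    show "r' > 0" unfolding r'_def by (subst Min_gr_iff) (use r R0 in \<open>auto simp: R'_def\<close>)
    show "r' \<le> r" "r' \<le> R' $ j" unfolding r'_def by (rule Min_le; simp)+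
  qed
  define K' where "K' = max (max K A) (max C B)"
  have K': "K \<le> K'" "A \<le> K'" "C \<le> K'" "B \<le> K'" "K' > 0" using K by (auto simp: K'_def)
  show ?thesis
  proof (rule that[OF \<delta> r'(1) K'(5)])
    fix \<theta>' assume \<theta>': "\<bar>\<theta>' - \<theta>\<bar> < \<delta>"
    have reg: "P_region p (pi / (2 * k) + \<delta>) r' \<theta>' \<subseteq> P_sector p (\<theta> - H) (\<theta> + H) R' \<inter> polydisc (vec r)"
    proof
      fix x assume x: "x \<in> P_region p (pi / (2 * k) + \<delta>) r' \<theta>'"
      then obtain \<psi> where \<psi>: "is_Arg (mps_eval p x) \<psi>" "\<bar>\<psi> - \<theta>'\<bar> < h + \<delta>"
        by (auto simp: P_region_def h_def)
      have "h + \<delta> + \<delta> = H" by (simp add: \<delta>_def)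
      then have "\<theta> - H < \<psi>" "\<psi> < \<theta> + H" using \<psi>(2) \<theta>' by linarith+
      moreover have "x \<in> polydisc (vec r')" "mps_eval p x \<noteq> 0" "\<And>j. x $ j \<noteq> 0" using x by (auto simp: P_region_def)
      moreover from this have "norm (x $ j) < R' $ j" for j
        using r'(3)[of j] by (auto simp: polydisc_def intro: less_le_trans)
      moreover have "x \<in> polydisc (vec r)" using polydisc_mono[OF r'(2)] calculation by blast
      ultimately show "x \<in> P_sector p (\<theta> - H) (\<theta> + H) R' \<inter> polydisc (vec r)"
        using \<psi>(1) by (auto simp: P_sector_def)
    qed
    have "P_sector p (\<theta> - H) (\<theta> + H) R' \<subseteq> P_sector p a b R"
    proof
      fix x assume x: "x \<in> P_sector p (\<theta> - H) (\<theta> + H) R'"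
      then obtain \<psi> where \<psi>: "is_Arg (mps_eval p x) \<psi>" "\<theta> - H < \<psi>" "\<psi> < \<theta> + H"
        by (auto simp: P_sector_def)
      have "a < \<psi>" "\<psi> < b" using \<psi> hH mid by (simp_all add: field_simps)
      moreover have "norm (x $ j) < R $ j" for j
      proof -
        have "norm (x $ j) < R $ j / 2" using x by (simp add: P_sector_def R'_def)
        then show ?thesis using R0[of j] by simp
      qed
      ultimately show "x \<in> P_sector p a b R" using x \<psi>(1) by (auto simp: P_sector_def)
    qed
    with reg hol have h1: "holomorphic_map_on f (P_region p (pi / (2 * k) + \<delta>) r' \<theta>')"
      by (blast intro: holomorphic_map_on_subset)
    have "P_gevrey_at p k F \<delta> r' K' \<theta>' f fn"
      unfolding P_gevrey_at_def
    proof (intro conjI allI ballI h1 fn(2))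
      fix n
      show "fn n \<in> bounded_holomorphic (polydisc (vec r'))"
        by (rule bounded_holomorphic_subset[OF fn(1) polydisc_mono[OF r'(2)]])
      fix x
      show "norm (fn n x) \<le> K' * K' ^ n * fact n powr (1 / k)" if "x \<in> polydisc (vec r')"
      proof -
        have "norm (fn n x) \<le> K * A ^ n * fact n powr (1 / k)"
          using that polydisc_mono[OF r'(2)] by (intro fn(3)) blast
        also have "\<dots> \<le> K' * K' ^ n * fact n powr (1 / k)"
          using K A K' by (intro mult_right_mono mult_mono power_mono) auto
        finally show ?thesis .
      qed
      show "norm (f x - fn n x) \<le> K' * K' ^ n * fact n powr (1 / k) * norm (mps_eval p x) ^ n"
        if "x \<in> P_region p (pi / (2 * k) + \<delta>) r' \<theta>'"
      proof -
        have "norm (f x - fn n x) \<le> C * B ^ n * fact n powr (1 / k) * norm (mps_eval p x) ^ n"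
          using that reg by (intro CB) blast
        also have "\<dots> \<le> K' * K' ^ n * fact n powr (1 / k) * norm (mps_eval p x) ^ n"
          using C B K' by (intro mult_right_mono mult_mono power_mono) auto
        finally show ?thesis .
      qed
    qed
    then show "\<exists>f fn. P_gevrey_at p k F \<delta> r' K' \<theta>' f fn" by blast
  qed
qed

text \<open>Bisection form of compactness on \<open>[0, 2 * pi]\<close>: two intervals with data are
  merged by taking minima of \<open>\<delta>\<close>, \<open>r\<close> and the maximum of
  \<open>K\<close>.\<close>

lemma P_summable_uniform:
  fixes p :: "('d::finite, complex) mps" and F :: "('d, 'e::complex_banach) mps"
  assumes k: "k > 0" and sum: "\<And>\<theta>. P_summable_in_direction p k F \<theta>"
  obtains \<delta> r K where "\<delta> > 0" "r > 0" "K > 0" "\<And>\<theta>. \<exists>f fn. P_gevrey_at p k F \<delta> r K \<theta> f fn"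
proof -
  define U where "U a b \<longleftrightarrow> (\<exists>\<delta>>0. \<exists>r>0. \<exists>K>0. \<forall>\<theta>\<in>{a..b}. \<exists>f fn. P_gevrey_at p k F \<delta> r K \<theta> f fn)" for a b
  have "U 0 (2 * pi)"
  proof (rule Bolzano)
    fix a b c assume "U a b" "U b c" "a \<le> b" "b \<le> c"
    obtain \<delta>1 r1 K1 where 1: "\<delta>1 > 0" "r1 > 0" "K1 > 0" "\<And>\<theta>. \<theta> \<in> {a..b} \<Longrightarrow> \<exists>f fn. P_gevrey_at p k F \<delta>1 r1 K1 \<theta> f fn"
      using \<open>U a b\<close> unfolding U_def by blast
    obtain \<delta>2 r2 K2 where 2: "\<delta>2 > 0" "r2 > 0" "K2 > 0" "\<And>\<theta>. \<theta> \<in> {b..c} \<Longrightarrow> \<exists>f fn. P_gevrey_at p k F \<delta>2 r2 K2 \<theta> f fn"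
      using \<open>U b c\<close> unfolding U_def by blast
    have "\<exists>f fn. P_gevrey_at p k F (min \<delta>1 \<delta>2) (min r1 r2) (max K1 K2) \<theta> f fn" if "\<theta> \<in> {a..c}" for \<theta>
    proof (cases "\<theta> \<le> b")
      case True
      then have "\<theta> \<in> {a..b}" using that by simp
      from 1(4)[OF this] obtain f fn where "P_gevrey_at p k F \<delta>1 r1 K1 \<theta> f fn" by blast
      then have "P_gevrey_at p k F (min \<delta>1 \<delta>2) (min r1 r2) (max K1 K2) \<theta> f fn"
        by (rule P_gevrey_at_mono) (use 1 in auto)
      then show ?thesis by blast
    next
      case False
      then have "\<theta> \<in> {b..c}" using that by simp
      from 2(4)[OF this] obtain f fn where "P_gevrey_at p k F \<delta>2 r2 K2 \<theta> f fn" by blast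
      then have "P_gevrey_at p k F (min \<delta>1 \<delta>2) (min r1 r2) (max K1 K2) \<theta> f fn"
        by (rule P_gevrey_at_mono) (use 2 in auto)
      then show ?thesis by blast
    qed
    moreover have "min \<delta>1 \<delta>2 > 0" "min r1 r2 > 0" "max K1 K2 > 0" using 1 2 by auto
    ultimately show "U a c" unfolding U_def by blast
  next
    fix \<theta> :: real
    obtain \<delta> r K where *: "\<delta> > 0" "r > 0" "K > 0"
      "\<And>\<theta>'. \<bar>\<theta>' - \<theta>\<bar> < \<delta> \<Longrightarrow> \<exists>f fn. P_gevrey_at p k F \<delta> r K \<theta>' f fn"
      using P_summable_locally_uniform[OF k sum, of \<theta>] by blast
    have "U a b" if ab: "a \<le> \<theta>" "\<theta> \<le> b" "b - a < \<delta>" for a b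
    proof -
      have "\<exists>f fn. P_gevrey_at p k F \<delta> r K \<theta>' f fn" if "\<theta>' \<in> {a..b}" for \<theta>'
        by (rule *(4)) (use that ab in auto)
      then show ?thesis using *(1-3) unfolding U_def by blast
    qed
    then show "\<exists>d>0. \<forall>a b. a \<le> \<theta> \<and> \<theta> \<le> b \<and> b - a < d \<longrightarrow> U a b" using *(1) by blast
  qed simp
  then obtain \<delta> r K where *: "\<delta> > 0" "r > 0" "K > 0"
    "\<And>\<theta>. \<theta> \<in> {0..2 * pi} \<Longrightarrow> \<exists>f fn. P_gevrey_at p k F \<delta> r K \<theta> f fn"
    unfolding U_def by blast
  show ?thesis
  proof (rule that[OF *(1-3)])
    fix \<theta> :: real
    \<comment> \<open>\<open>P_region\<close> admits every value of the argument, so it is periodic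
      in the direction and one period suffices.\<close>
    define m where "m = \<lfloor>\<theta> / (2 * pi)\<rfloor>"
    define \<theta>' where "\<theta>' = \<theta> - of_int m * (2 * pi)"
    have "of_int m \<le> \<theta> / (2 * pi)" "\<theta> / (2 * pi) < of_int m + 1" unfolding m_def by linarith+
    then have "\<theta>' \<in> {0..2 * pi}" by (simp add: \<theta>'_def field_simps)
    have "P_region p H r' \<theta>' = P_region p H r' \<theta>" for H r'
    proof -
      have "(\<exists>\<psi>. is_Arg z \<psi> \<and> \<bar>\<psi> - \<theta>'\<bar> < H) \<longleftrightarrow> (\<exists>\<psi>. is_Arg z \<psi> \<and> \<bar>\<psi> - \<theta>\<bar> < H)" for z
      proof
        assume "\<exists>\<psi>. is_Arg z \<psi> \<and> \<bar>\<psi> - \<theta>'\<bar> < H"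
        then obtain \<psi> where "is_Arg z \<psi>" "\<bar>\<psi> - \<theta>'\<bar> < H" by blast
        then show "\<exists>\<psi>. is_Arg z \<psi> \<and> \<bar>\<psi> - \<theta>\<bar> < H"
          using is_Arg_2pi_iff[of z \<psi> m]
          by (intro exI[of _ "\<psi> + of_int m * (2 * pi)"]) (simp add: \<theta>'_def diff_diff_eq2)
      next
        assume "\<exists>\<psi>. is_Arg z \<psi> \<and> \<bar>\<psi> - \<theta>\<bar> < H"
        then obtain \<psi> where "is_Arg z \<psi>" "\<bar>\<psi> - \<theta>\<bar> < H" by blast
        then show "\<exists>\<psi>. is_Arg z \<psi> \<and> \<bar>\<psi> - \<theta>'\<bar> < H"
          using is_Arg_2pi_iff[of z "\<psi> - of_int m * (2 * pi)" m]
          by (intro exI[of _ "\<psi> - of_int m * (2 * pi)"]) (simp add: \<theta>'_def)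
      qed
      then show ?thesis by (simp add: P_region_def)
    qed
    then show "\<exists>f fn. P_gevrey_at p k F \<delta> r K \<theta> f fn"
      using *(4)[OF \<open>\<theta>' \<in> {0..2 * pi}\<close>] by (simp add: P_gevrey_at_def)
  qed
qed

section \<open>Transfer to lines and the final estimate\<close>

lemma P_gevrey_at_line:
  fixes p :: "('d::finite, complex) mps" and F :: "('d, 'e::complex_banach) mps"
  assumes G: "P_gevrey_at p k F \<delta> r K \<theta> f fn" and r: "r > 0" and K: "K > 0"
    and \<phi>: "\<phi> \<in> dual_ball" and v: "\<And>j. norm (v $ j) < 2"
    and t: "t *s v \<in> P_region p (pi / (2 * k) + \<delta>) r \<theta>" "norm t \<le> r / 4"
    and P: "norm (mps_eval p (t *s v)) \<le> b * norm t ^ mps_order p"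
    and b: "1 / (r / 2) ^ mps_order p \<le> b"
  shows "norm (\<phi> (f (t *s v)) - (\<Sum>m<mps_order p * N. mps_hom (\<lambda>\<alpha>. \<phi> (F \<alpha>)) m v * t ^ m))
      \<le> 3 * K * (K * b) ^ N * fact N powr (1 / k) * norm t ^ (mps_order p * N)"
proof -
  let ?l = "mps_order p"
  define T where "T = r / 2"
  have T: "T > 0" using r by (simp add: T_def)
  define E where "E t = \<phi> (fn N (0 + t *s v))" for t
  have mem: "t *s v \<in> polydisc (vec r)" if "norm t < T" for t
    by (rule scale_mem_polydisc) (use v that in \<open>auto simp: T_def\<close>)
  have bh: "fn N \<in> bounded_holomorphic (polydisc (vec r))"
    and cong: "mps_cong p N (taylor_series (fn N)) F"
    and fnle: "\<And>x. x \<in> polydisc (vec r) \<Longrightarrow> norm (fn N x) \<le> K * K ^ N * fact N powr (1 / k)"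
    and fle: "norm (f (t *s v) - fn N (t *s v)) \<le> K * K ^ N * fact N powr (1 / k) * norm (mps_eval p (t *s v)) ^ N"
    using G t(1) unfolding P_gevrey_at_def by blast+
  have Ehol: "E holomorphic_on ball 0 T"
    unfolding E_def
    by (rule holomorphic_map_on_dual_affine[OF _ \<phi>]) (use bh mem in \<open>auto simp: bounded_holomorphic_def\<close>)
  have Ele: "norm (E t) \<le> K * K ^ N * fact N powr (1 / k)" if "norm t < T" for t
    using dual_ball_norm[OF \<phi>] fnle[OF mem[OF that]] by (auto simp: E_def intro: order_trans)
  have coef: "(deriv ^^ m) E 0 / fact m = mps_hom (\<lambda>\<alpha>. \<phi> (F \<alpha>)) m v" if m: "m < ?l * N" for m
  proof -
    \<comment> \<open>The expansion may be valid only on a smaller polydisc than the bounds, but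
      derivatives at 0 are determined there.\<close>
    obtain \<rho> where \<rho>: "\<rho> > 0" and hs: "\<And>x. x \<in> polydisc (vec \<rho>) \<Longrightarrow>
        ((\<lambda>\<alpha>. monomial x \<alpha> *\<^sub>C taylor_series (fn N) \<alpha>) has_sum fn N x) UNIV"
      using bounded_holomorphic_has_mps_expansion[OF r bh] unfolding has_mps_expansion_def by blast
    have "(deriv ^^ m) E 0 = fact m * mps_hom (\<lambda>\<alpha>. \<phi> (taylor_series (fn N) \<alpha>)) m v"
    proof (rule higher_deriv_power_series_0)
      show "\<rho> / 2 > 0" using \<rho> by simp
      fix t :: complex assume "norm t < \<rho> / 2"
      then have "t *s v \<in> polydisc (vec \<rho>)" using v by (intro scale_mem_polydisc)
      from has_sum_imp_sums_line[OF has_sum_dual[OF \<phi> hs[OF this]]]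
      show "(\<lambda>m. mps_hom (\<lambda>\<alpha>. \<phi> (taylor_series (fn N) \<alpha>)) m v * t ^ m) sums E t"
        by (simp add: E_def)
    qed
    also have "mps_hom (\<lambda>\<alpha>. \<phi> (taylor_series (fn N) \<alpha>)) m v = mps_hom (\<lambda>\<alpha>. \<phi> (F \<alpha>)) m v"
      unfolding mps_hom_def by (rule sum.cong) (use m mps_cong_coeff_eq[OF cong] in auto)
    finally show ?thesis by simp
  qed
  \<comment> \<open>The error splits into the asymptotic error of \<open>fn N\<close> and the Taylor
    remainder of \<open>fn N\<close> along the line. They contribute 1 and 2 times
    \<open>?c * ?s\<close>, hence the factor 3; \<open>b\<close> dominates the constants of
    both.\<close>
  let ?c = "K * K ^ N * fact N powr (1 / k)" and ?s = "b ^ N * norm t ^ (?l * N)"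
  have c0: "?c \<ge> 0" using K by simp
  have e1: "norm (\<phi> (f (t *s v)) - E t) \<le> ?c * ?s"
  proof -
    have "norm (\<phi> (f (t *s v)) - E t) = norm (\<phi> (f (t *s v) - fn N (t *s v)))"
      by (simp add: E_def dual_ball_diff[OF \<phi>])
    also have "\<dots> \<le> norm (f (t *s v) - fn N (t *s v))" by (rule dual_ball_norm[OF \<phi>])
    also have "\<dots> \<le> ?c * norm (mps_eval p (t *s v)) ^ N" by (rule fle)
    also have "\<dots> \<le> ?c * (b * norm t ^ ?l) ^ N"
      using P by (intro mult_left_mono[OF _ c0] power_mono) auto
    also have "(b * norm t ^ ?l) ^ N = ?s" by (simp add: power_mult_distrib power_mult)
    finally show ?thesis .
  qed
  have "norm (E t - (\<Sum>m<?l * N. (deriv ^^ m) E 0 / fact m * t ^ m)) \<le> 2 * ?c * (norm t / T) ^ (?l * N)"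
    by (rule taylor_remainder_bound[OF Ehol T Ele]) (use t in \<open>auto simp: T_def\<close>)
  also have "(norm t / T) ^ (?l * N) = (1 / T ^ ?l) ^ N * norm t ^ (?l * N)"
    by (simp add: power_divide power_mult)
  also have "2 * ?c * \<dots> \<le> 2 * ?c * ?s"
    using b c0 T by (intro mult_left_mono mult_right_mono power_mono) (auto simp: T_def)
  finally have e2: "norm (E t - (\<Sum>m<?l * N. mps_hom (\<lambda>\<alpha>. \<phi> (F \<alpha>)) m v * t ^ m)) \<le> 2 * ?c * ?s"
    by (simp add: coef)
  have "norm (\<phi> (f (t *s v)) - (\<Sum>m<?l * N. mps_hom (\<lambda>\<alpha>. \<phi> (F \<alpha>)) m v * t ^ m)) \<le> ?c * ?s + 2 * ?c * ?s"
    using norm_triangle_mono[OF e1 e2] by simp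
  also have "\<dots> = 3 * K * (K * b) ^ N * fact N powr (1 / k) * norm t ^ (?l * N)"
    by (simp add: power_mult_distrib algebra_simps)
  finally show ?thesis .
qed

text \<open>The arguments of \<open>w\<close>, \<open>t ^ mps_order p\<close> and the leading form
  add up to one for the germ. The deviation of \<open>w\<close> from 1 uses half of
  \<open>\<delta>\<close>, and the angle in \<open>t\<close> is multiplied by the order.\<close>

lemma sector_line_in_P_region:
  fixes p :: "('d::finite, complex) mps"
  assumes l: "mps_order p \<ge> 1" and v: "\<And>j. norm (v $ j) < 2" "\<And>j. v $ j \<noteq> 0"
    and Q: "mps_hom p (mps_order p) v \<noteq> 0" and \<tau>: "\<tau> \<le> r / 2"
    and \<omega>: "norm \<omega> = 1" and t: "t \<in> sector \<omega> ((h + \<delta> / 2) / real (mps_order p)) \<tau>"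
    and w: "mps_eval p (t *s v) = w * (t ^ mps_order p * mps_hom p (mps_order p) v)"
      "w \<noteq> 0" "\<bar>Arg w\<bar> < \<delta> / 2"
  shows "t *s v \<in> P_region p (h + \<delta>) r (Arg (mps_hom p (mps_order p) v) + real (mps_order p) * Arg \<omega>)"
proof -
  let ?l = "mps_order p" and ?Q = "mps_hom p (mps_order p) v"
  obtain \<psi> where \<psi>: "\<bar>\<psi>\<bar> < (h + \<delta> / 2) / real ?l" "t = of_real (norm t) * \<omega> * cis \<psi>"
    and t0: "t \<noteq> 0" "norm t < \<tau>"
    using t by (auto simp: sector_def)
  have "\<omega> = cis (Arg \<omega>)" using \<omega> cis_Arg[of \<omega>] by (simp add: sgn_eq) force
  then have "t = of_real (norm t) * cis (Arg \<omega> + \<psi>)"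
    using \<psi>(2) by (metis cis_mult mult.assoc)
  then have "is_Arg t (Arg \<omega> + \<psi>)" by (simp add: is_Arg_def cis_conv_exp)
  then have "is_Arg (w * (t ^ ?l * ?Q)) (Arg w + (real ?l * (Arg \<omega> + \<psi>) + Arg ?Q))"
    using w(2) Q by (intro is_Arg_mult is_Arg_power is_Arg_Arg)
  moreover have "\<bar>Arg w + (real ?l * (Arg \<omega> + \<psi>) + Arg ?Q) - (Arg ?Q + real ?l * Arg \<omega>)\<bar> < h + \<delta>"
  proof -
    have "real ?l * \<bar>\<psi>\<bar> < h + \<delta> / 2" using \<psi>(1) l by (simp add: field_simps)
    then have "\<bar>real ?l * \<psi>\<bar> < h + \<delta> / 2" by (simp add: abs_mult)
    then have "\<bar>Arg w + real ?l * \<psi>\<bar> < h + \<delta>" using w(3) by linarith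
    then show ?thesis by (simp add: algebra_simps)
  qed
  moreover have "t *s v \<in> polydisc (vec r)"
    by (rule scale_mem_polydisc) (use v t0 \<tau> in auto)
  ultimately show ?thesis
    using w t0 Q v by (auto simp: P_region_def)
qed

lemma Arg_small:
  assumes "\<epsilon> > 0"
  obtains e where "0 < e" "e < 1" "\<And>w. norm (w - 1) \<le> e \<Longrightarrow> \<bar>Arg w\<bar> < \<epsilon>"
proof -
  have "isCont Arg 1" by (rule continuous_at_Arg) auto
  then obtain d where d: "d > 0" "\<And>w. dist w 1 < d \<Longrightarrow> dist (Arg w) (Arg 1) < \<epsilon>"
    using assms unfolding continuous_at_eps_delta by blast
  show ?thesis
  proof (rule that[of "min d 1 / 2"])
    fix w :: complex assume "norm (w - 1) \<le> min d 1 / 2"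
    then have "dist w 1 < d" using d(1) by (auto simp: dist_norm)
    from d(2)[OF this] show "\<bar>Arg w\<bar> < \<epsilon>" by (simp add: dist_real_def)
  qed (use d in auto)
qed

theorem theorem5p2:
  fixes p :: "('d::finite, complex) mps" and k :: real
    and F :: "('d, 'e::complex_banach) mps"
  assumes "CARD('d) \<ge> 2"
    and "mps_convergent p" and "p \<noteq> (\<lambda>_. 0)" and "mps_eval p 0 = 0"
    and "k > 0"
    and "P_summable p k F" and "singular_directions p k F = {}"
  shows "mps_convergent F"
proof -
  let ?l = "mps_order p" and ?Q = "mps_hom p (mps_order p)"
  obtain r0 where r0: "r0 > 0" "mps_abs_conv_on p (polydisc (vec r0))"
    using \<open>mps_convergent p\<close> unfolding mps_convergent_def by blast
  have l: "?l \<ge> 1" by (rule mps_order_pos[OF r0 assms(3,4)])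
  have "P_summable_in_direction p k F \<theta>" for \<theta>
    using \<open>singular_directions p k F = {}\<close> by (auto simp: singular_directions_def)
  from P_summable_uniform[OF \<open>k > 0\<close> this]
  obtain \<delta> r K where \<delta>: "\<delta> > 0" and r: "r > 0" and K: "K > 0"
    and "\<forall>\<theta>. \<exists>ffn. P_gevrey_at p k F \<delta> r K \<theta> (fst ffn) (snd ffn)"
    by (metis fst_conv snd_conv)
  from choice[OF this(4)] obtain ffn where ffn: "\<forall>\<theta>. P_gevrey_at p k F \<delta> r K \<theta> (fst (ffn \<theta>)) (snd (ffn \<theta>))"
    by (rule exE)
  define f fn where "f \<theta> = fst (ffn \<theta>)" and "fn \<theta> = snd (ffn \<theta>)" for \<theta>
  have G: "P_gevrey_at p k F \<delta> r K \<theta> (f \<theta>) (fn \<theta>)" for \<theta>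
    unfolding f_def fn_def by (rule ffn[rule_format])
  obtain v0 :: "complex^'d" and \<epsilon> q0 :: real where \<epsilon>: "\<epsilon> > 0" and q0: "q0 > 0"
    and V0: "\<forall>v. (\<forall>j. norm (v $ j - v0 $ j) < \<epsilon>) \<longrightarrow>
      q0 \<le> norm (?Q v) \<and> (\<forall>j. v $ j \<noteq> 0 \<and> norm (v $ j) < 2)"
    by (rule mps_hom_order_nonzero[OF \<open>p \<noteq> (\<lambda>_. 0)\<close>])
  have V: "q0 \<le> norm (?Q v) \<and> (\<forall>j. v $ j \<noteq> 0 \<and> norm (v $ j) < 2)" if "\<And>j. norm (v $ j - v0 $ j) < \<epsilon>" for v
    using V0 that by blast
  obtain e where e: "0 < e" "e < 1" and Arge: "\<And>w. norm (w - 1) \<le> e \<Longrightarrow> \<bar>Arg w\<bar> < \<delta> / 2"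
    using Arg_small[OF half_gt_zero[OF \<delta>]] by blast
  obtain \<tau>0 where \<tau>0: "\<tau>0 > 0" and asym: "\<And>v t. q0 \<le> norm (?Q v) \<Longrightarrow> (\<And>j. norm (v $ j) < 2) \<Longrightarrow>
      t \<noteq> 0 \<Longrightarrow> norm t < \<tau>0 \<Longrightarrow> norm (mps_eval p (t *s v) / (t ^ ?l * ?Q v) - 1) \<le> e"
    using mps_eval_line_asymptotic[OF r0 q0 e(1)] by blast
  define \<tau> where "\<tau> = min \<tau>0 (r / 4)"
  have \<tau>: "\<tau> > 0" "\<tau> \<le> r / 4" "\<tau> \<le> \<tau>0" using \<tau>0 r by (auto simp: \<tau>_def)
  \<comment> \<open>The constant \<open>3 * K\<close> is the line estimate at \<open>N = 0\<close>,
    where \<open>b\<close> drops out, so it depends neither on \<open>v\<close> nor on the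
    functional.\<close>
  have hom: "norm (mps_hom (\<lambda>\<alpha>. \<phi> (F \<alpha>)) m v) \<le> 3 * K / \<tau> ^ m"
    if \<phi>: "\<phi> \<in> dual_ball" and v: "\<And>j. norm (v $ j - v0 $ j) < \<epsilon>" for \<phi> m v
  proof -
    have q: "q0 \<le> norm (?Q v)" and vj: "\<And>j. v $ j \<noteq> 0" "\<And>j. norm (v $ j) < 2" using V[OF v] by auto
    have Q0: "?Q v \<noteq> 0" using q q0 by auto
    \<comment> \<open>The argument of the leading term of the germ at points of the ray spanned by
      \<open>\<omega>\<close>; the sum for this direction is the one to restrict.\<close>
    define \<theta> where "\<theta> \<omega> = Arg (?Q v) + real ?l * Arg \<omega>" for \<omega>
    define g where "g \<omega> t = \<phi> (f (\<theta> \<omega>) (0 + t *s v))" for \<omega> t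
    define H where "H = (pi / (2 * k) + \<delta> / 2) / real ?l"
    \<comment> \<open>The first term bounds the germ by the factor \<open>norm w \<le> 2\<close>;
      the second serves the Taylor remainder of the approximating functions.\<close>
    define b where "b = 2 * norm (?Q v) + 1 / (r / 2) ^ ?l"
    have b: "b > 0" "1 / (r / 2) ^ ?l \<le> b" using Q0 r by (simp_all add: b_def add_pos_pos)
    have main: "t *s v \<in> P_region p (pi / (2 * k) + \<delta>) r (\<theta> \<omega>)" "norm (mps_eval p (t *s v)) \<le> b * norm t ^ ?l" "norm t \<le> r / 4"
      if \<omega>: "norm \<omega> = 1" and t: "t \<in> sector \<omega> H \<tau>" for \<omega> t
    proof -
      have t0: "t \<noteq> 0" "norm t < \<tau>" using t by (auto simp: sector_def)
      then show "norm t \<le> r / 4" using \<tau> by simp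
      define w where "w = mps_eval p (t *s v) / (t ^ ?l * ?Q v)"
      have w1: "norm (w - 1) \<le> e" unfolding w_def by (rule asym[OF q vj(2)]) (use t0 \<tau> in auto)
      then have wn0: "w \<noteq> 0" using e by auto
      have w2: "norm w \<le> 2" using w1 e norm_triangle_sub[of w 1] by simp
      have P: "mps_eval p (t *s v) = w * (t ^ ?l * ?Q v)" using t0 Q0 by (simp add: w_def)
      show "t *s v \<in> P_region p (pi / (2 * k) + \<delta>) r (\<theta> \<omega>)"
        unfolding \<theta>_def
        by (rule sector_line_in_P_region[OF l vj(2) vj(1) Q0 _ \<omega> t[unfolded H_def] P wn0 Arge[OF w1]])
          (use \<tau> r in simp)
      have "norm (mps_eval p (t *s v)) = norm w * norm (?Q v) * norm t ^ ?l"
        by (simp add: P norm_mult norm_power)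
      also have "\<dots> \<le> b * norm t ^ ?l"
      proof (rule mult_right_mono)
        have "norm w * norm (?Q v) \<le> 2 * norm (?Q v)" using w2 by (rule mult_right_mono) simp
        also have "\<dots> \<le> b" using r by (simp add: b_def)
        finally show "norm w * norm (?Q v) \<le> b" .
      qed simp
      finally show "norm (mps_eval p (t *s v)) \<le> b * norm t ^ ?l" .
    qed
    have est: "norm (g \<omega> t - (\<Sum>m<?l * N. mps_hom (\<lambda>\<alpha>. \<phi> (F \<alpha>)) m v * t ^ m))
        \<le> 3 * K * (K * b) ^ N * fact N powr (1 / k) * norm t ^ (?l * N)"
      if "norm \<omega> = 1" "t \<in> sector \<omega> H \<tau>" for \<omega> t N
      unfolding g_def add_0
      by (rule P_gevrey_at_line[OF G r K \<phi> vj(2) main(1)[OF that] main(3)[OF that] main(2)[OF that] b(2)])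
    have "norm (mps_hom (\<lambda>\<alpha>. \<phi> (F \<alpha>)) m v) * \<tau> ^ m \<le> 3 * K"
    proof (rule summable_all_directions_coeff_bound[where g = g, OF l \<open>k > 0\<close> _ \<tau>(1) _ _ _ est])
      show "pi / (2 * (k * real ?l)) < H"
        using \<delta> l \<open>k > 0\<close> by (simp add: H_def field_simps)
      show "K * b > 0" using K b by simp
      fix \<omega> :: complex assume \<omega>: "norm \<omega> = 1"
      show "g \<omega> holomorphic_on sector \<omega> H \<tau>"
        unfolding g_def
        by (rule holomorphic_map_on_dual_affine[OF _ \<phi>])
          (use G[of "\<theta> \<omega>"] main(1)[OF \<omega>] in \<open>auto simp: P_gevrey_at_def\<close>)
      show "norm (g \<omega> t) \<le> 3 * K" if "t \<in> sector \<omega> H \<tau>" for t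
        using est[OF \<omega> that, of 0] by simp
    qed
    then show ?thesis using \<tau> by (simp add: field_simps)
  qed
  obtain L where L: "L \<ge> 1" "\<And>S (c :: ('d, complex) mps) (\<alpha> :: 'd \<Rightarrow> nat).
       (\<And>v. (\<And>j. norm (v $ j - v0 $ j) < \<epsilon>) \<Longrightarrow> norm (mps_hom c (mdeg \<alpha>) v) \<le> S) \<Longrightarrow>
       norm (c \<alpha>) \<le> S * L ^ mdeg \<alpha>"
    using mps_hom_coeff_bound[OF \<epsilon>, of v0] by blast
  have F: "norm (F \<alpha>) \<le> 3 * K * (L / \<tau>) ^ mdeg \<alpha>" for \<alpha>
  proof (rule norm_le_dual_ball)
    fix \<phi> :: "'e \<Rightarrow> complex" assume "\<phi> \<in> dual_ball"
    then have "norm (\<phi> (F \<alpha>)) \<le> 3 * K / \<tau> ^ mdeg \<alpha> * L ^ mdeg \<alpha>"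
      by (intro L(2)[of "\<lambda>\<alpha>. \<phi> (F \<alpha>)"] hom)
    then show "norm (\<phi> (F \<alpha>)) \<le> 3 * K * (L / \<tau>) ^ mdeg \<alpha>" by (simp add: power_divide)
  qed
  \<comment> \<open>Inside this radius the coefficient bound gives a product of convergent geometric
    series, one for each coordinate.\<close>
  have "mps_abs_conv_on F (polydisc (vec (\<tau> / L)))"
    unfolding mps_abs_conv_on_def
    by (intro ballI abs_summable_mps[OF F])
       (use L(1) \<tau> in \<open>auto simp: polydisc_def field_simps\<close>)
  moreover have "\<tau> / L > 0" using \<tau> L(1) by simp
  ultimately show ?thesis unfolding mps_convergent_def by blast
qed

end
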